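(* Let $\alpha\in(0,1)$ and consider the test of $H_0^{(k)}:\rho_k\ge0$ against $H_1^{(k)}:\rho_k<0$ with rejection region $C_{k,n}(\alpha)$. 1. If $p$ satisfies $H_0^{(k)}$ and $\rho_k=0$, then $\lim_{n\to\infty}P(X_{1:n}\in C_{k,n}(\alpha))=\alpha$. 2. If $p$ satisfies $H_0^{(k)}$ and $\rho_k>0$, then $\lim_{n\to\infty}P(X_{1:n}\in C_{k,n}(\alpha))=0$. 3. If $p$ satisfies $H_1^{(k)}$, then $\lim_{n\to\infty}P(X_{1:n}\in C_{k,n}(\alpha))=1$.
   Context: Let $k\ge1$ be an integer, let $m\le M-k$ be integers, $\mathcal S=\{m,\dots,M\}$, $\mathcal S_k=\{m,\dots,M-k\}$, and let $p$ be a p.m.f. on $\mathbb Z$ with support $\mathcal S$ (i.e. $p(j)>0$ iff $j\in\mathcal S$). For a real function $q$ of an integer variable, $\nabla^kq(j)=(-1)^k\Delta^kq(j)$, where $\Delta^0q(j)=q(j)$, $\Delta^1q(j)=q(j+1)-q(j)$, $\Delta^rq(j)=\Delta^1[\Delta^{r-1}q](j)$ for $r\ge2$. The notation $\nabla^k\mathbf 1_{\{X=j\}}$ means $\nabla^k$ applied to $j\mapsto\mathbf 1_{\{X=j\}}$. Put $\rho_k=\min_{j\in\mathcal S_k}\nabla^kp(j)$. Let $X_1,X_2,\dots$ be i.i.d. with p.m.f. $p$, $X_{1:n}=(X_1,\dots,X_n)$, $\widehat p_n(j)=\frac1n\sum_{i=1}^n\mathbf 1_{\{X_i=j\}}$,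 $X_{(1)}$ and $X_{(n)}$ the minimum and maximum of $X_{1:n}$, $\widehat{\mathcal S}_{k,n}=\{X_{(1)},\dots,X_{(n)}-k\}$ (all integers between the endpoints), and $\widehat T_{k,n}=\sqrt n\min_{j\in\widehat{\mathcal S}_{k,n}}\nabla^k\widehat p_n(j)$ (set to $0$ if $\widehat{\mathcal S}_{k,n}=\emptyset$). Conditionally on $X_{1:n}$, let $(\widehat Z_{j,n})_{j\in\mathcal S_k}$ be centred Gaussian with covariances equal to the empirical ones, $$\frac1n\sum_{l=1}^n\nabla^k\mathbf 1_{\{X_l=i\}}\nabla^k\mathbf 1_{\{X_l=j\}}-\nabla^k\widehat p_n(i)\,\nabla^k\widehat p_n(j),\quad i,j\in\mathcal S_k,$$ and let $\widehat\sigma^2_{j,n}$ denote the entry $i=j$. For $I\subseteq\mathcal S_k$, let $\widehat t_{\alpha,n}(I)$ be $0$ if $I=\emptyset$, and otherwise the $\alpha$-quantile of the conditional law given $X_{1:n}$ of $\min_{j\in I}\widehat Z_{j,n}$. Let $z_\beta$ be the $\beta$-quantile of the standard Gaussian and, for $n\ge2$, $$\widehat I_{0,n}=\Big\{j\in\widehat{\mathcal S}_{k,n}:\ \frac{\sqrt n\,\nabla^k\widehat p_n(j)}{\widehat\sigma_{j,n}}\le z_{1-1/n}\Big\},$$ where, if $\widehat\sigma_{j,n}=0$, the inequality is read as $\sqrt n\,\nabla^k\widehat p_n(j)\le z_{1-1/n}\widehat\sigma_{j,n}$. The event $X_{1:n}\in C_{k,n}(\alpha)$ is the event $\widehat T_{k,n}<\widehat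 t_{\alpha,n}(\widehat I_{0,n})$. *)

theory Defs
  imports "HOL-Probability.Probability"
begin

definition fwd_diff :: "(int \<Rightarrow> real) \<Rightarrow> int \<Rightarrow> real" where
  "fwd_diff q j = q (j + 1) - q j"

definition nabla :: "nat \<Rightarrow> (int \<Rightarrow> real) \<Rightarrow> int \<Rightarrow> real" where
  "nabla k q j = (-1) ^ k * (fwd_diff ^^ k) q j"

definition rho :: "nat \<Rightarrow> int \<Rightarrow> int \<Rightarrow> int pmf \<Rightarrow> real" where
  "rho k m M p = Min (nabla k (pmf p) ` {m..M - int k})"

text \<open>A sample of size \<open>n\<close> is represented by a sequence \<open>x\<close>, of which only the entries
  \<open>x 1, \<dots>, x n\<close> are used.\<close>

definition emp_pmf :: "nat \<Rightarrow> (nat \<Rightarrow> int) \<Rightarrow> int \<Rightarrow> real" where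
  "emp_pmf n x j = (\<Sum>l=1..n. of_bool (x l = j)) / real n"

definition emp_supp :: "nat \<Rightarrow> nat \<Rightarrow> (nat \<Rightarrow> int) \<Rightarrow> int set" where
  "emp_supp k n x = {Min (x ` {1..n}) .. Max (x ` {1..n}) - int k}"

definition test_stat :: "nat \<Rightarrow> nat \<Rightarrow> (nat \<Rightarrow> int) \<Rightarrow> real" where
  "test_stat k n x =
    (if emp_supp k n x = {} then 0
     else sqrt (real n) * Min (nabla k (emp_pmf n x) ` emp_supp k n x))"

definition emp_cov :: "nat \<Rightarrow> nat \<Rightarrow> (nat \<Rightarrow> int) \<Rightarrow> int \<Rightarrow> int \<Rightarrow> real" where
  "emp_cov k n x i j =
    (\<Sum>l=1..n. nabla k (\<lambda>a. of_bool (x l = a)) i * nabla k (\<lambda>a. of_bool (x l = a)) j) / real n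
      - nabla k (emp_pmf n x) i * nabla k (emp_pmf n x) j"

definition emp_sd :: "nat \<Rightarrow> nat \<Rightarrow> (nat \<Rightarrow> int) \<Rightarrow> int \<Rightarrow> real" where
  "emp_sd k n x j = sqrt (emp_cov k n x j j)"

definition quantile :: "real measure \<Rightarrow> real \<Rightarrow> real" where
  "quantile N \<beta> = Inf {t. \<beta> \<le> cdf N t}"

definition std_normal_quantile :: "real \<Rightarrow> real" where
  "std_normal_quantile \<beta> = quantile (density lborel std_normal_density) \<beta>"

text \<open>The variance may be \<open>0\<close>, in which case the law is the Dirac measure at \<open>0\<close>.\<close>

definition is_centred_normal :: "real \<Rightarrow> real measure \<Rightarrow> bool" where
  "is_centred_normal v N \<longleftrightarrow>
    (v = 0 \<and> N = return borel 0) \<or>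
    (v > 0 \<and> N = density lborel (normal_density 0 (sqrt v)))"

text \<open>A random vector is centred Gaussian with covariance matrix \<open>\<Sigma>\<close> iff each linear
  combination of its components is centred normal with the variance prescribed by \<open>\<Sigma>\<close>;
  \<open>\<Sigma>\<close> may be singular.\<close>

definition is_centred_gaussian ::
    "'i set \<Rightarrow> ('i \<Rightarrow> 'i \<Rightarrow> real) \<Rightarrow> ('i \<Rightarrow> real) measure \<Rightarrow> bool" where
  "is_centred_gaussian J \<Sigma> N \<longleftrightarrow>
    prob_space N \<and> sets N = sets (\<Pi>\<^sub>M j\<in>J. borel) \<and>
    (\<forall>c. is_centred_normal (\<Sum>i\<in>J. \<Sum>j\<in>J. c i * c j * \<Sigma> i j)
           (distr N borel (\<lambda>z. \<Sum>j\<in>J. c j * z j)))"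

text \<open>For finite \<open>J\<close> and symmetric positive semidefinite \<open>\<Sigma>\<close>, such as every empirical
  covariance matrix, this law exists and is unique (Cramer--Wold).\<close>

definition centred_gaussian :: "'i set \<Rightarrow> ('i \<Rightarrow> 'i \<Rightarrow> real) \<Rightarrow> ('i \<Rightarrow> real) measure" where
  "centred_gaussian J \<Sigma> = (THE N. is_centred_gaussian J \<Sigma> N)"

text \<open>The conditional law of the Gaussian vector given the sample \<open>x\<close> is the centred Gaussian
  law on \<open>\<real>\<^sup>J\<close>, \<open>J = {m..M - int k}\<close>, with covariance \<open>emp_cov k n x\<close>.
  The argument \<open>I\<close> is meant to be a subset of \<open>J\<close>.\<close>

definition crit_val ::
    "nat \<Rightarrow> int \<Rightarrow> int \<Rightarrow> real \<Rightarrow> nat \<Rightarrow> (nat \<Rightarrow> int) \<Rightarrow> int set \<Rightarrow> real" where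
  "crit_val k m M \<alpha> n x I =
    (if I = {} then 0
     else quantile
       (distr (centred_gaussian {m..M - int k} (emp_cov k n x)) borel (\<lambda>z. Min (z ` I))) \<alpha>)"

text \<open>Only meaningful for \<open>n \<ge> 2\<close>, as \<open>1 - 1 / n\<close> has to lie in \<open>(0, 1)\<close>.\<close>

definition active_set :: "nat \<Rightarrow> nat \<Rightarrow> (nat \<Rightarrow> int) \<Rightarrow> int set" where
  "active_set k n x =
    {j \<in> emp_supp k n x.
      if emp_sd k n x j = 0
      then sqrt (real n) * nabla k (emp_pmf n x) j
             \<le> std_normal_quantile (1 - 1 / real n) * emp_sd k n x j
      else sqrt (real n) * nabla k (emp_pmf n x) j / emp_sd k n x j
             \<le> std_normal_quantile (1 - 1 / real n)}"

definition rejection_region ::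
    "nat \<Rightarrow> int \<Rightarrow> int \<Rightarrow> real \<Rightarrow> nat \<Rightarrow> (nat \<Rightarrow> int) set" where
  "rejection_region k m M \<alpha> n =
    {x. test_stat k n x < crit_val k m M \<alpha> n x (active_set k n x)}"

end

theory Submission
  imports Defs
begin

text \<open>
  The sample differences \<open>\<surd>n (nabla k (emp_pmf n x) j - nabla k (pmf p) j)\<close> are jointly
  asymptotically Gaussian: every linear combination obeys the central limit theorem, and the
  Cramer--Wold device turns this into convergence of the probabilities of orthants, hence of the
  distribution function of minima. The same device yields uniqueness of the Gaussian law with given
  covariance, which identifies \<open>centred_gaussian\<close> with an explicit linear image of white noise.
  Its coefficients depend continuously on the empirical frequencies, and the minimum of a
  nondegenerate Gaussian vector has a distribution function that is continuous and strictly
  increasing where it lies strictly between 0 and 1, so the critical value is consistent. As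
  \<open>z (1 - 1 / n)\<close> tends to infinity but is \<open>o(\<surd>n)\<close>, under the null hypothesis the active set is,
  with probability tending to 1, the set of indices where \<open>nabla k (pmf p)\<close> vanishes.
  If that set is nonempty, the test statistic is asymptotically the minimum over it and the level is
  exact. If it is empty, the statistic is positive and the critical value is 0. If
  \<open>nabla k (pmf p)\<close> is negative somewhere, the statistic tends to minus infinity while the critical
  values stay bounded.
\<close>

text \<open>The one-dimensional central limit theorem yields only joint characteristic functions,
  whereas the test needs probabilities of orthants. The bridge is an algebra argument: multiplying
  by a character merely shifts the frequency, so the functions that preserve convergence of all
  twisted integrals contain the polynomials in \<open>sin (w * z j)\<close>, hence by tightness all
  bounded continuous functions of one coordinate, hence their products, and these sandwich
  indicators of orthants.

  Absence of atoms of the minimum needs only positive variances of single coordinates. These hold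
  because an observation \<open>j\<close> contributes \<open>1\<close> and an observation
  \<open>j + 1\<close> contributes \<open>- k\<close> to the difference at \<open>j\<close>. Strict
  monotonicity comes from connectedness, not from a density.

  The critical value is taken over a random index set. Under the null hypothesis this set is
  deterministic with high probability; under the alternative all of the finitely many subsets are
  treated at once. One exponential tail bound, uniform in \<open>n\<close>, supplies both tightness
  and consistency.\<close>

subsection \<open>The Cramer--Wold device\<close>

text \<open>For small \<open>w\<close> a function of \<open>y \<in> [-L, L]\<close> is a function of \<open>sin (w y)\<close>. A polynomial in
  \<open>sin (w y)\<close> approximating it there stays bounded on the whole line, so that tightness controls
  the error.\<close>

lemma trig_approximation:
  fixes \<phi> :: "real \<Rightarrow> real"
  assumes cont: "continuous_on UNIV \<phi>" and bd: "\<And>y. \<bar>\<phi> y\<bar> \<le> 1"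
    and "L > 0" and "\<epsilon> > 0" and "\<epsilon> \<le> 1"
  shows "\<exists>q w. real_polynomial_function q \<and> (\<forall>y. \<bar>q (sin (w * y))\<bar> \<le> 2) \<and>
    (\<forall>y. \<bar>y\<bar> \<le> L \<longrightarrow> \<bar>\<phi> y - q (sin (w * y))\<bar> \<le> \<epsilon>)"
proof -
  define w where "w = pi / (2 * L)"
  have w: "w > 0" using \<open>L > 0\<close> by (simp add: w_def)
  define h where "h = (\<lambda>s. \<phi> (arcsin s / w))"
  have "continuous_on {-1..1::real} h"
    unfolding h_def using w
    by (intro continuous_on_compose2[OF cont] continuous_intros) auto
  then obtain q where q: "real_polynomial_function q" "\<And>s. s \<in> {-1..1} \<Longrightarrow> \<bar>h s - q s\<bar> < \<epsilon>"
    using Stone_Weierstrass_real_polynomial_function[of "{-1..1::real}" h \<epsilon>] \<open>\<epsilon> > 0\<close> by auto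
  show ?thesis
  proof (intro exI[of _ q] exI[of _ w] conjI allI impI q(1))
    fix y :: real
    have "\<bar>h (sin (w * y)) - q (sin (w * y))\<bar> < \<epsilon>" by (rule q) simp
    moreover have "\<bar>h (sin (w * y))\<bar> \<le> 1" by (simp add: h_def bd)
    ultimately show "\<bar>q (sin (w * y))\<bar> \<le> 2" using \<open>\<epsilon> \<le> 1\<close> by linarith
  next
    fix y :: real
    assume "\<bar>y\<bar> \<le> L"
    then have "w * \<bar>y\<bar> \<le> w * L" using w by simp
    also have "w * L = pi / 2" using \<open>L > 0\<close> by (simp add: w_def)
    finally have "\<bar>w * y\<bar> \<le> pi / 2" using w by (simp add: abs_mult)
    then have "arcsin (sin (w * y)) = w * y" by (intro arcsin_sin) auto
    then have "h (sin (w * y)) = \<phi> y" using w by (simp add: h_def)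
    moreover have "\<bar>h (sin (w * y)) - q (sin (w * y))\<bar> < \<epsilon>" by (rule q) simp
    ultimately show "\<bar>\<phi> y - q (sin (w * y))\<bar> \<le> \<epsilon>" by simp
  qed
qed

lemma tight_borel_measurable:
  fixes f :: "'a \<Rightarrow> real"
  assumes "prob_space P" and f[measurable]: "f \<in> borel_measurable P" and "\<epsilon> > 0"
  shows "\<exists>L>0. measure P {z \<in> space P. \<bar>f z\<bar> > L} < \<epsilon>"
proof -
  interpret prob_space P by fact
  define A where "A = (\<lambda>n::nat. {z \<in> space P. \<bar>f z\<bar> > real n})"
  have "(\<lambda>n. measure P (A n)) \<longlonglongrightarrow> measure P (\<Inter>n. A n)"
    by (rule finite_Lim_measure_decseq) (auto simp: A_def decseq_def)
  moreover have "(\<Inter>n. A n) = {}"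
  proof (safe)
    fix z assume "z \<in> (\<Inter>n. A n)"
    moreover obtain n :: nat where "\<bar>f z\<bar> \<le> real n" using real_arch_simple by blast
    ultimately have "z \<in> A n" by blast
    with \<open>\<bar>f z\<bar> \<le> real n\<close> show "z \<in> {}" by (simp add: A_def)
  qed
  ultimately have "(\<lambda>n. measure P (A n)) \<longlonglongrightarrow> 0" by simp
  then have "\<forall>\<^sub>F n in sequentially. measure P (A n) < \<epsilon> \<and> n \<ge> 1"
    using \<open>\<epsilon> > 0\<close> by (auto intro: order_tendstoD eventually_ge_at_top eventually_conj)
  then obtain n where "measure P (A n) < \<epsilon>" "n \<ge> 1" by (auto dest: eventually_happens)
  then show ?thesis by (intro exI[of _ "real n"]) (auto simp: A_def)
qed

text \<open>Where \<open>\<bar>f z\<bar> \<le> L\<close> the integrands differ by at most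
  \<open>B * \<epsilon>\<close>. Elsewhere, on mass at most \<open>\<epsilon>\<close>, the factors
  differ by at most 1 + 2 = 3. The bound 2 on \<open>h'\<close> is the one that
  \<open>trig_approximation\<close> guarantees on the whole line.\<close>

lemma integral_norm_bound_off:
  fixes g :: "'a \<Rightarrow> complex" and f :: "'a \<Rightarrow> real" and h h' :: "'a \<Rightarrow> complex"
  assumes "prob_space P" and [measurable]: "g \<in> borel_measurable P" "h \<in> borel_measurable P"
    "h' \<in> borel_measurable P" "f \<in> borel_measurable P"
    and B: "\<And>z. cmod (g z) \<le> B" and h: "\<And>z. cmod (h z) \<le> 1" and h': "\<And>z. cmod (h' z) \<le> 2"
    and close: "\<And>z. \<bar>f z\<bar> \<le> L \<Longrightarrow> cmod (h z - h' z) \<le> \<epsilon>"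
    and L: "measure P {z \<in> space P. \<bar>f z\<bar> > L} \<le> \<epsilon>" and "\<epsilon> \<ge> 0"
  shows "cmod ((\<integral>z. g z * h z \<partial>P) - (\<integral>z. g z * h' z \<partial>P)) \<le> 4 * B * \<epsilon>"
proof -
  interpret prob_space P by fact
  define E where "E = {z \<in> space P. \<bar>f z\<bar> > L}"
  have [measurable]: "E \<in> sets P" by (simp add: E_def)
  have "B \<ge> 0" using B[of undefined] norm_ge_zero order_trans by blast
  have i1: "integrable P (\<lambda>z. g z * h z)"
    by (rule integrable_const_bound[of _ "B * 1"])
       (auto simp: norm_mult intro!: AE_I2 mult_mono B h \<open>B \<ge> 0\<close> simp del: mult_1_right)
  have i2: "integrable P (\<lambda>z. g z * h' z)"
    by (rule integrable_const_bound[of _ "B * 2"])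
       (auto simp: norm_mult intro!: AE_I2 mult_mono B h' \<open>B \<ge> 0\<close>)
  have i3: "integrable P (\<lambda>z. B * (\<epsilon> + 3 * indicator E z))"
    by (intro integrable_mult_right Bochner_Integration.integrable_add integrable_const integrable_real_indicator)
      (auto simp: emeasure_eq_measure)
  have "cmod ((\<integral>z. g z * h z \<partial>P) - (\<integral>z. g z * h' z \<partial>P)) = cmod (\<integral>z. g z * h z - g z * h' z \<partial>P)"
    using i1 i2 by simp
  also have "\<dots> \<le> (\<integral>z. cmod (g z * h z - g z * h' z) \<partial>P)"
    by (rule integral_norm_bound)
  also have "\<dots> \<le> (\<integral>z. B * (\<epsilon> + 3 * indicator E z) \<partial>P)"
  proof (rule integral_mono)
    show "integrable P (\<lambda>z. cmod (g z * h z - g z * h' z))" using i1 i2 by simp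
    show "integrable P (\<lambda>z. B * (\<epsilon> + 3 * indicator E z))" by (rule i3)
    fix z assume z: "z \<in> space P"
    have "cmod (h z - h' z) \<le> \<epsilon> + 3 * indicator E z"
    proof (cases "z \<in> E")
      case True
      have "cmod (h z - h' z) \<le> cmod (h z) + cmod (h' z)" by (rule norm_triangle_ineq4)
      with h[of z] h'[of z] True \<open>\<epsilon> \<ge> 0\<close> show ?thesis by simp
    next
      case False
      with z have "\<bar>f z\<bar> \<le> L" by (auto simp: E_def)
      with close False show ?thesis by simp
    qed
    then have "cmod (g z) * cmod (h z - h' z) \<le> B * (\<epsilon> + 3 * indicator E z)"
      by (intro mult_mono B \<open>B \<ge> 0\<close>) auto
    then show "cmod (g z * h z - g z * h' z) \<le> B * (\<epsilon> + 3 * indicator E z)"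
      by (simp add: norm_mult flip: right_diff_distrib)
  qed
  also have "\<dots> = B * (\<epsilon> + 3 * measure P E)"
    by (subst integral_mult_right_zero, subst Bochner_Integration.integral_add)
       (auto simp: emeasure_eq_measure prob_space)
  also have "\<dots> \<le> B * (\<epsilon> + 3 * \<epsilon>)"
    using L \<open>B \<ge> 0\<close> by (intro mult_left_mono) (auto simp: E_def)
  finally show ?thesis by (simp add: algebra_simps)
qed

text \<open>\<open>char_conv\<close> concerns one linear combination of the coordinates at a time,
  which is all that a one-dimensional limit theorem delivers. Tightness is stated per coordinate
  because the approximations below change one coordinate at a time.\<close>

locale cramer_wold =
  fixes J :: "'i set" and N :: "nat \<Rightarrow> ('i \<Rightarrow> real) measure" and Q :: "('i \<Rightarrow> real) measure"
  assumes finite_J: "finite J"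
    and prob_N: "\<And>n. prob_space (N n)" and prob_Q: "prob_space Q"
    and sets_N: "\<And>n. sets (N n) = sets (\<Pi>\<^sub>M j\<in>J. borel)"
    and sets_Q: "sets Q = sets (\<Pi>\<^sub>M j\<in>J. borel)"
    and char_conv: "\<And>t. (\<lambda>n. \<integral>z. iexp (\<Sum>j\<in>J. t j * z j) \<partial>N n) \<longlonglongrightarrow> (\<integral>z. iexp (\<Sum>j\<in>J. t j * z j) \<partial>Q)"
    and tight_N: "\<And>j \<epsilon>. j \<in> J \<Longrightarrow> \<epsilon> > 0 \<Longrightarrow>
      \<exists>L>0. \<forall>\<^sub>F n in sequentially. measure (N n) {z \<in> space (N n). \<bar>z j\<bar> > L} < \<epsilon>"
begin

abbreviation B where "B \<equiv> (\<Pi>\<^sub>M j\<in>J. borel :: real measure)"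

lemma measurable_N: "measurable (N n) A = measurable B A"
  by (rule measurable_cong_sets) (simp_all add: sets_N)

lemma measurable_Q: "measurable Q A = measurable B A"
  by (rule measurable_cong_sets) (simp_all add: sets_Q)

lemma measurable_coord: "j \<in> J \<Longrightarrow> (\<lambda>z. z j) \<in> borel_measurable B"
  by simp

definition bounded_rv :: "(('i \<Rightarrow> real) \<Rightarrow> complex) \<Rightarrow> bool" where
  "bounded_rv g \<longleftrightarrow> g \<in> borel_measurable B \<and> (\<exists>C. \<forall>z. cmod (g z) \<le> C)"

text \<open>All frequencies are required together so that multiplying \<open>g\<close> by a further
  character only translates \<open>t\<close>.\<close>

definition conv :: "(('i \<Rightarrow> real) \<Rightarrow> complex) \<Rightarrow> bool" where
  "conv g \<longleftrightarrow> bounded_rv g \<and>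
     (\<forall>t. (\<lambda>n. \<integral>z. g z * iexp (\<Sum>j\<in>J. t j * z j) \<partial>N n) \<longlonglongrightarrow> (\<integral>z. g z * iexp (\<Sum>j\<in>J. t j * z j) \<partial>Q))"

text \<open>Phrasing the property as stability makes closure under products immediate. Limits alone
  would not be multiplicative, since convergence of two sequences of integrals says nothing about
  the integrals of the products.\<close>

definition multiplier :: "(('i \<Rightarrow> real) \<Rightarrow> complex) \<Rightarrow> bool" where
  "multiplier h \<longleftrightarrow> (\<forall>g. conv g \<longrightarrow> conv (\<lambda>z. g z * h z))"

lemma bounded_rv_mult:
  assumes "bounded_rv g" and "bounded_rv h"
  shows "bounded_rv (\<lambda>z. g z * h z)"
proof -
  obtain C D where C: "\<And>z. cmod (g z) \<le> C" and D: "\<And>z. cmod (h z) \<le> D"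
    using assms by (auto simp: bounded_rv_def)
  have "C \<ge> 0" using C[of undefined] norm_ge_zero order_trans by blast
  then have "cmod (g z * h z) \<le> C * D" for z
    unfolding norm_mult by (intro mult_mono C D) auto
  then show ?thesis using assms unfolding bounded_rv_def by auto
qed

lemma bounded_rv_add:
  assumes "bounded_rv g" and "bounded_rv h"
  shows "bounded_rv (\<lambda>z. g z + h z)"
proof -
  obtain C D where "\<And>z. cmod (g z) \<le> C" and "\<And>z. cmod (h z) \<le> D"
    using assms by (auto simp: bounded_rv_def)
  then have "cmod (g z + h z) \<le> C + D" for z
    by (intro norm_triangle_mono) auto
  then show ?thesis using assms unfolding bounded_rv_def by auto
qed

lemma bounded_rv_iexp: "bounded_rv (\<lambda>z. iexp (\<Sum>j\<in>J. t j * z j))"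
  unfolding bounded_rv_def by (auto intro!: exI[of _ 1])

lemma bounded_rv_integrable:
  assumes "bounded_rv g" shows "integrable (N n) g" and "integrable Q g"
proof -
  obtain C where C: "\<And>z. cmod (g z) \<le> C" "g \<in> borel_measurable B"
    using assms by (auto simp: bounded_rv_def)
  interpret N: prob_space "N n" by (rule prob_N)
  interpret Q: prob_space Q by (rule prob_Q)
  show "integrable (N n) g"
    by (rule N.integrable_const_bound[of _ C]) (auto simp: C measurable_N)
  show "integrable Q g"
    by (rule Q.integrable_const_bound[of _ C]) (auto simp: C measurable_Q)
qed

lemma conv_const: "conv (\<lambda>_. c)"
proof -
  have "bounded_rv (\<lambda>_. c)" by (auto simp: bounded_rv_def)
  then show ?thesis unfolding conv_def
    using tendsto_mult_left[OF char_conv, of c] by simp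
qed

lemma conv_bounded: "conv g \<Longrightarrow> bounded_rv g"
  by (simp add: conv_def)

lemma conv_add:
  assumes g: "conv g" and h: "conv h"
  shows "conv (\<lambda>z. g z + h z)"
proof -
  have "(\<lambda>n. \<integral>z. (g z + h z) * iexp (\<Sum>j\<in>J. t j * z j) \<partial>N n)
      \<longlonglongrightarrow> (\<integral>z. (g z + h z) * iexp (\<Sum>j\<in>J. t j * z j) \<partial>Q)" for t
  proof -
    have i: "bounded_rv (\<lambda>z. f z * iexp (\<Sum>j\<in>J. t j * z j))" if "conv f" for f
      using conv_bounded[OF that] by (intro bounded_rv_mult bounded_rv_iexp)
    show ?thesis
      unfolding distrib_right Bochner_Integration.integral_add[OF i[OF g, THEN bounded_rv_integrable(1)] i[OF h, THEN bounded_rv_integrable(1)]]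
        Bochner_Integration.integral_add[OF i[OF g, THEN bounded_rv_integrable(2)] i[OF h, THEN bounded_rv_integrable(2)]]
      by (intro tendsto_add; use g h in \<open>unfold conv_def, blast\<close>)
  qed
  then show ?thesis
    using bounded_rv_add[OF conv_bounded[OF g] conv_bounded[OF h]] unfolding conv_def by blast
qed

lemma multiplier_mult: "multiplier g \<Longrightarrow> multiplier h \<Longrightarrow> multiplier (\<lambda>z. g z * h z)"
  unfolding multiplier_def by (simp add: mult.assoc[symmetric])

lemma multiplier_add: "multiplier g \<Longrightarrow> multiplier h \<Longrightarrow> multiplier (\<lambda>z. g z + h z)"
  unfolding multiplier_def by (simp add: distrib_left conv_add)

lemma multiplier_const: "multiplier (\<lambda>_. c)"
  unfolding multiplier_def
proof (intro allI impI)
  fix g assume g: "conv g"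
  have "bounded_rv (\<lambda>_. c)" by (auto simp: bounded_rv_def)
  with g show "conv (\<lambda>z. g z * c)" unfolding conv_def
    by (auto simp: bounded_rv_mult mult.commute[of _ c] mult.assoc intro!: tendsto_mult_left)
qed

lemma multiplier_iexp: "multiplier (\<lambda>z. iexp (\<Sum>j\<in>J. s j * z j))"
  unfolding multiplier_def
proof (intro allI impI)
  fix g assume g: "conv g"
  have *: "g z * iexp (\<Sum>j\<in>J. s j * z j) * iexp (\<Sum>j\<in>J. t j * z j)
      = g z * iexp (\<Sum>j\<in>J. (s j + t j) * z j)" for z t
    by (simp add: exp_add[symmetric] sum.distrib distrib_right distrib_left)
  have "(\<lambda>n. \<integral>z. g z * iexp (\<Sum>j\<in>J. s j * z j) * iexp (\<Sum>j\<in>J. t j * z j) \<partial>N n)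
      \<longlonglongrightarrow> (\<integral>z. g z * iexp (\<Sum>j\<in>J. s j * z j) * iexp (\<Sum>j\<in>J. t j * z j) \<partial>Q)" for t
    unfolding * using conjunct2[OF iffD1[OF conv_def g]] by (rule spec)
  moreover have "bounded_rv (\<lambda>z. g z * iexp (\<Sum>j\<in>J. s j * z j))"
    using conv_bounded[OF g] by (intro bounded_rv_mult bounded_rv_iexp)
  ultimately show "conv (\<lambda>z. g z * iexp (\<Sum>j\<in>J. s j * z j))"
    unfolding conv_def by blast
qed

lemma multiplier_sin:
  assumes "j \<in> J"
  shows "multiplier (\<lambda>z. complex_of_real (sin (w * z j)))"
proof -
  have *: "(\<Sum>i\<in>J. (if i = j then w else 0) * z i) = w * z j"
    "(\<Sum>i\<in>J. (if i = j then -w else 0) * z i) = - (w * z j)" for w :: real and z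
    using assms finite_J by (simp_all add: if_distrib[of "\<lambda>x. x * _"] cong: if_cong)
  have "multiplier (\<lambda>z. iexp (w * z j) * (1 / (2 * \<i>)) + iexp (- (w * z j)) * (- 1 / (2 * \<i>)))"
    by (intro multiplier_add multiplier_mult multiplier_const)
       (use multiplier_iexp[of "\<lambda>i. if i = j then w else 0"]
            multiplier_iexp[of "\<lambda>i. if i = j then -w else 0"] in \<open>simp_all only: * mult_minus_left\<close>)
  moreover have "iexp (w * z j) * (1 / (2 * \<i>)) + iexp (- (w * z j)) * (- 1 / (2 * \<i>))
      = complex_of_real (sin (w * z j))" for z
    by (simp add: sin_of_real[symmetric] sin_exp_eq diff_divide_distrib right_diff_distrib mult_ac)
  ultimately show ?thesis by simp
qed

lemma multiplier_poly_sin: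
  assumes "j \<in> J" and "real_polynomial_function q"
  shows "multiplier (\<lambda>z. complex_of_real (q (sin (w * z j))))"
  using assms(2)
proof induction
  case (linear f)
  then obtain c where "f = (\<lambda>x. x * c)" by (auto simp: real_bounded_linear)
  then show ?case
    using multiplier_mult[OF multiplier_sin[OF assms(1)] multiplier_const[of "complex_of_real c"]]
    by simp
next
  case (const c)
  show ?case by (rule multiplier_const)
next
  case (add f g)
  then show ?case using multiplier_add by simp
next
  case (mult f g)
  then show ?case using multiplier_mult by simp
qed

text \<open>Replace \<open>\<phi> (z j)\<close> by a polynomial in \<open>sin (w * z j)\<close>,
  which is already a multiplier. Tightness under \<open>N n\<close> and under \<open>Q\<close>
  bounds the two replacement errors, uniformly for large \<open>n\<close>, and the triangle
  inequality in three parts concludes.\<close>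

lemma multiplier_coord:
  assumes j: "j \<in> J" and cont: "continuous_on UNIV \<phi>" and bd: "\<And>y. \<bar>\<phi> y\<bar> \<le> (1::real)"
  shows "multiplier (\<lambda>z. complex_of_real (\<phi> (z j)))"
  unfolding multiplier_def
proof (intro allI impI)
  fix g assume g: "conv g"
  have \<phi>_meas[measurable]: "\<phi> \<in> borel_measurable borel"
    by (rule borel_measurable_continuous_onI[OF cont])
  note measurable_coord[OF j, measurable]
  have bdd: "bounded_rv (\<lambda>z. complex_of_real (\<phi> (z j)))"
    using bd by (auto simp: bounded_rv_def)
  have "(\<lambda>n. \<integral>z. g z * complex_of_real (\<phi> (z j)) * iexp (\<Sum>j\<in>J. t j * z j) \<partial>N n)
     \<longlonglongrightarrow> (\<integral>z. g z * complex_of_real (\<phi> (z j)) * iexp (\<Sum>j\<in>J. t j * z j) \<partial>Q)" for t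
  proof -
    define e where "e = (\<lambda>z. iexp (\<Sum>j\<in>J. t j * z j))"
    define G where "G = (\<lambda>z. g z * e z)"
    have "bounded_rv G" unfolding G_def e_def
      using conv_bounded[OF g] by (intro bounded_rv_mult bounded_rv_iexp)
    then obtain C where C: "\<And>z. cmod (G z) \<le> C" and G[measurable]: "G \<in> borel_measurable B"
      by (auto simp: bounded_rv_def)
    have "C \<ge> 0" using C[of undefined] norm_ge_zero order_trans by blast
    have "(\<lambda>n. \<integral>z. G z * complex_of_real (\<phi> (z j)) \<partial>N n) \<longlonglongrightarrow> (\<integral>z. G z * complex_of_real (\<phi> (z j)) \<partial>Q)"
      unfolding tendsto_iff
    proof (intro allI impI)
      fix r :: real assume "r > 0"
      \<comment> \<open>Each replacement costs at most \<open>4 * C * \<epsilon>\<close>, which must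
        stay below \<open>r / 3\<close>; \<open>C + 1\<close> avoids a zero denominator, and the cap
        1 is required by \<open>trig_approximation\<close>.\<close>
      define \<epsilon> where "\<epsilon> = min 1 (r / (12 * (C + 1)))"
      have \<epsilon>: "\<epsilon> > 0" "\<epsilon> \<le> 1" using \<open>r > 0\<close> \<open>C \<ge> 0\<close> by (auto simp: \<epsilon>_def)
      have "\<epsilon> \<le> r / (12 * (C + 1))" unfolding \<epsilon>_def by (rule min.cobounded2)
      moreover have "12 * (C + 1) > 0" using \<open>C \<ge> 0\<close> by simp
      ultimately have "\<epsilon> * (12 * (C + 1)) \<le> r" by (metis pos_le_divide_eq)
      then have r: "4 * C * \<epsilon> < r / 3" using \<epsilon> \<open>C \<ge> 0\<close> by (simp add: algebra_simps)
      obtain L1 where L1: "L1 > 0" "\<forall>\<^sub>F n in sequentially. measure (N n) {z \<in> space (N n). \<bar>z j\<bar> > L1} < \<epsilon>"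
        using tight_N[OF j \<epsilon>(1)] by blast
      obtain L2 where L2: "L2 > 0" "measure Q {z \<in> space Q. \<bar>z j\<bar> > L2} < \<epsilon>"
        using tight_borel_measurable[OF prob_Q _ \<epsilon>(1), of "\<lambda>z. z j"] by (auto simp: measurable_Q)
      define L where "L = max L1 L2"
      have "L > 0" using L1 by (simp add: L_def)
      obtain q w where q: "real_polynomial_function q" "\<And>y. \<bar>q (sin (w * y))\<bar> \<le> 2"
        "\<And>y. \<bar>y\<bar> \<le> L \<Longrightarrow> \<bar>\<phi> y - q (sin (w * y))\<bar> \<le> \<epsilon>"
        using trig_approximation[OF cont bd \<open>L > 0\<close> \<epsilon>] by auto
      define h where "h = (\<lambda>z::'i \<Rightarrow> real. complex_of_real (q (sin (w * z j))))"
      have "q \<in> borel_measurable borel"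
        using q(1) by (intro borel_measurable_continuous_onI continuous_at_imp_continuous_on ballI continuous_real_polymonial_function)
      then have h[measurable]: "h \<in> borel_measurable B" by (simp add: h_def)
      have "conv (\<lambda>z. g z * h z)"
        using multiplier_poly_sin[OF j q(1)] g unfolding h_def multiplier_def by blast
      then have "(\<lambda>n. \<integral>z. g z * h z * e z \<partial>N n) \<longlonglongrightarrow> (\<integral>z. g z * h z * e z \<partial>Q)"
        by (simp add: conv_def e_def)
      then have "(\<lambda>n. \<integral>z. G z * h z \<partial>N n) \<longlonglongrightarrow> (\<integral>z. G z * h z \<partial>Q)"
        by (simp add: G_def mult_ac)
      then have ev: "\<forall>\<^sub>F n in sequentially. dist (\<integral>z. G z * h z \<partial>N n) (\<integral>z. G z * h z \<partial>Q) < r / 3"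
        using \<open>r > 0\<close> by (intro tendstoD) auto
      have approx: "cmod ((\<integral>z. G z * complex_of_real (\<phi> (z j)) \<partial>P) - (\<integral>z. G z * h z \<partial>P)) \<le> 4 * C * \<epsilon>"
        if P: "prob_space P" "sets P = sets B" and l: "measure P {z \<in> space P. \<bar>z j\<bar> > L'} < \<epsilon>" "L' \<le> L" for P L'
      proof (rule integral_norm_bound_off[OF P(1), where f = "\<lambda>z. z j" and L = L])
        interpret P: prob_space P by fact
        show "G \<in> borel_measurable P" "(\<lambda>z. complex_of_real (\<phi> (z j))) \<in> borel_measurable P"
          "h \<in> borel_measurable P" "(\<lambda>z. z j) \<in> borel_measurable P" by (simp_all add: measurable_cong_sets[OF P(2) refl] j)
        have sp: "{z \<in> space P. \<bar>z j\<bar> > L'} \<in> sets P"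
          using \<open>(\<lambda>z. z j) \<in> borel_measurable P\<close> by measurable
        have "measure P {z \<in> space P. \<bar>z j\<bar> > L} \<le> measure P {z \<in> space P. \<bar>z j\<bar> > L'}"
          using \<open>L' \<le> L\<close> by (intro P.finite_measure_mono sp) auto
        then show "measure P {z \<in> space P. \<bar>z j\<bar> > L} \<le> \<epsilon>" using l by simp
        show "cmod (complex_of_real (\<phi> (z j)) - h z) \<le> \<epsilon>" if "\<bar>z j\<bar> \<le> L" for z
          using q(3)[OF that] by (simp add: h_def flip: of_real_diff)
      qed (use C bd q(2) \<epsilon> in \<open>auto simp: h_def\<close>)
      from ev L1(2) show "\<forall>\<^sub>F n in sequentially. dist (\<integral>z. G z * complex_of_real (\<phi> (z j)) \<partial>N n) (\<integral>z. G z * complex_of_real (\<phi> (z j)) \<partial>Q) < r"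
      proof eventually_elim
        case (elim n)
        have 1: "dist (\<integral>z. G z * complex_of_real (\<phi> (z j)) \<partial>N n) (\<integral>z. G z * h z \<partial>N n) \<le> 4 * C * \<epsilon>"
          unfolding dist_norm by (rule approx[OF prob_N sets_N elim(2)]) (simp add: L_def)
        have 2: "dist (\<integral>z. G z * complex_of_real (\<phi> (z j)) \<partial>Q) (\<integral>z. G z * h z \<partial>Q) \<le> 4 * C * \<epsilon>"
          unfolding dist_norm by (rule approx[OF prob_Q sets_Q L2(2)]) (simp add: L_def)
        show ?case
          using dist_triangle_third[OF le_less_trans[OF 1 r] elim(1)] le_less_trans[OF 2 r]
          by (simp add: dist_commute)
      qed
    qed
    then show ?thesis by (simp add: G_def e_def mult_ac)
  qed
  then show "conv (\<lambda>z. g z * complex_of_real (\<phi> (z j)))"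
    using g bdd by (auto simp: conv_def intro: bounded_rv_mult)
qed

text \<open>The factors are attached one at a time to the constant 1, each being a multiplier. At
  frequency zero the character disappears and the plain integral remains.\<close>

theorem integral_prod_tendsto:
  assumes "K \<subseteq> J" and "\<And>j. j \<in> K \<Longrightarrow> continuous_on UNIV (\<phi> j)"
    and "\<And>j y. j \<in> K \<Longrightarrow> \<bar>\<phi> j y\<bar> \<le> (1::real)"
  shows "(\<lambda>n. \<integral>z. (\<Prod>j\<in>K. \<phi> j (z j)) \<partial>N n) \<longlonglongrightarrow> (\<integral>z. (\<Prod>j\<in>K. \<phi> j (z j)) \<partial>Q)"
proof -
  have "finite K" using assms(1) finite_J finite_subset by blast
  then have "multiplier (\<lambda>z. \<Prod>j\<in>K. complex_of_real (\<phi> j (z j)))"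
    using assms
  proof induction
    case empty show ?case by (simp add: multiplier_const)
  next
    case (insert j K)
    then show ?case by (auto intro!: multiplier_mult multiplier_coord)
  qed
  then have "conv (\<lambda>z. 1 * (\<Prod>j\<in>K. complex_of_real (\<phi> j (z j))))"
    using conv_const unfolding multiplier_def by blast
  then have "(\<lambda>n. \<integral>z. complex_of_real (\<Prod>j\<in>K. \<phi> j (z j)) \<partial>N n) \<longlonglongrightarrow> (\<integral>z. complex_of_real (\<Prod>j\<in>K. \<phi> j (z j)) \<partial>Q)"
    unfolding conv_def by (auto dest: spec[of _ "\<lambda>_. 0"])
  then show ?thesis by (simp only: integral_complex_of_real tendsto_of_real_iff)
qed


end

section \<open>From products of continuous functions to probabilities of orthants\<close>

lemma orthant_smoothing:
  fixes P :: "('i \<Rightarrow> real) measure" and a :: "'i \<Rightarrow> real"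
  assumes P: "prob_space P" "sets P = sets (\<Pi>\<^sub>M j\<in>J. borel)" and K: "finite K" "K \<subseteq> J" and "\<delta> > 0"
  shows "measure P {z \<in> space P. \<forall>j\<in>K. a j + \<delta> < z j}
      \<le> (\<integral>z. (\<Prod>j\<in>K. 1 - cts_step (a j) (a j + \<delta>) (z j)) \<partial>P)" (is "measure P ?A \<le> ?E")
    and "(\<integral>z. (\<Prod>j\<in>K. 1 - cts_step (a j) (a j + \<delta>) (z j)) \<partial>P)
      \<le> measure P {z \<in> space P. \<forall>j\<in>K. a j < z j}" (is "_ \<le> measure P ?C")
proof -
  interpret prob_space P by fact
  \<comment> \<open>Each factor rises from 0 at \<open>a j\<close> to 1 at
    \<open>a j + \<delta>\<close>, so the product lies between the indicators of the two orthants
    and has the form required by \<open>integral_prod_tendsto\<close>.\<close>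
  let ?f = "\<lambda>z. \<Prod>j\<in>K. 1 - cts_step (a j) (a j + \<delta>) (z j)"
  have bd: "0 \<le> 1 - cts_step (a j) (a j + \<delta>) y" "1 - cts_step (a j) (a j + \<delta>) y \<le> 1" for j y
    using \<open>\<delta> > 0\<close> by (auto simp: cts_step_def divide_simps)
  have m: "(\<lambda>z. z j) \<in> borel_measurable P" if "j \<in> K" for j
    using that K by (subst measurable_cong_sets[OF P(2) refl]) auto
  have "cts_step (a j) (a j + \<delta>) \<in> borel_measurable borel" for j
    unfolding cts_step_def[abs_def] by measurable
  then have [measurable]: "?f \<in> borel_measurable P"
    by (intro borel_measurable_prod borel_measurable_diff borel_measurable_const measurable_compose[OF m])
  have "Measurable.pred P (\<lambda>z. \<forall>j\<in>K. b j < z j)" for b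
    using m K by (intro pred_intros_finite borel_measurable_less borel_measurable_pred_less) auto
  then have [measurable]: "?A \<in> sets P" "?C \<in> sets P" by auto
  have f01: "0 \<le> ?f z" "?f z \<le> 1" for z
    by (auto intro!: prod_nonneg prod_le_1 bd)
  have int: "integrable P ?f"
    by (rule integrable_const_bound[of _ 1]) (use f01 in auto)
  have "measure P ?A = (\<integral>z. indicator ?A z \<partial>P)" by simp
  also have "\<dots> \<le> ?E"
  proof (rule integral_mono)
    show "integrable P (\<lambda>z. indicat_real ?A z)" by (simp add: emeasure_eq_measure)
    show "integrable P ?f" by (rule int)
    fix z
    have "?f z = 1" if "z \<in> ?A"
      using that \<open>\<delta> > 0\<close> by (intro prod.neutral) (auto simp: cts_step_def dest!: bspec)
    then show "indicat_real ?A z \<le> ?f z"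
      using f01[of z] by (auto split: split_indicator)
  qed
  finally show "measure P ?A \<le> ?E" .
  have "?E \<le> (\<integral>z. indicator ?C z \<partial>P)"
  proof (rule integral_mono)
    show "integrable P (\<lambda>z. indicat_real ?C z)" by (simp add: emeasure_eq_measure)
    show "integrable P ?f" by (rule int)
    fix z assume "z \<in> space P"
    then have "?f z = 0" if "z \<notin> ?C"
      using that K(1) by (auto simp: cts_step_def intro!: bexI)
    then show "?f z \<le> indicat_real ?C z"
      using f01[of z] by (auto split: split_indicator)
  qed
  also have "\<dots> = measure P ?C" by simp
  finally show "?E \<le> measure P ?C" .
qed

lemma sets_orthant:
  assumes "sets P = sets (\<Pi>\<^sub>M j\<in>J. borel :: real measure)" "finite K" "K \<subseteq> J"
  shows "{z \<in> space P. \<forall>j\<in>K. a j < z j} \<in> sets P" "{z \<in> space P. \<forall>j\<in>K. a j \<le> z j} \<in> sets P"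
proof -
  have m[measurable]: "(\<lambda>z. z j) \<in> borel_measurable P" if "j \<in> K" for j
    using that assms by (subst measurable_cong_sets[OF assms(1) refl]) auto
  have "Measurable.pred P (\<lambda>z. \<forall>j\<in>K. a j < z j)" "Measurable.pred P (\<lambda>z. \<forall>j\<in>K. a j \<le> z j)"
    using assms by (auto intro!: pred_intros_finite)
  then show "{z \<in> space P. \<forall>j\<in>K. a j < z j} \<in> sets P" "{z \<in> space P. \<forall>j\<in>K. a j \<le> z j} \<in> sets P"
    by auto
qed

lemma orthant_right_continuous:
  fixes P :: "('i \<Rightarrow> real) measure"
  assumes P: "prob_space P" "sets P = sets (\<Pi>\<^sub>M j\<in>J. borel)" and K: "finite K" "K \<subseteq> J"
  shows "(\<lambda>n. measure P {z \<in> space P. \<forall>j\<in>K. a j + 1 / Suc n < z j})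
    \<longlonglongrightarrow> measure P {z \<in> space P. \<forall>j\<in>K. a j < z j}"
proof -
  interpret prob_space P by fact
  let ?A = "\<lambda>n::nat. {z \<in> space P. \<forall>j\<in>K. a j + 1 / Suc n < z j}"
  have "(\<lambda>n. measure P (?A n)) \<longlonglongrightarrow> measure P (\<Union>n. ?A n)"
  proof (rule finite_Lim_measure_incseq)
    show "range ?A \<subseteq> sets P" using sets_orthant(1)[OF P(2) K] by auto
    show "incseq ?A"
    proof (rule incseq_SucI, safe)
      fix n z j assume "\<forall>j\<in>K. a j + 1 / real (Suc n) < z j" "j \<in> K"
      moreover have "1 / real (Suc (Suc n)) \<le> 1 / real (Suc n)" by (simp add: frac_le)
      ultimately show "a j + 1 / real (Suc (Suc n)) < z j" by fastforce
    qed
  qed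
  moreover have "(\<Union>n. ?A n) = {z \<in> space P. \<forall>j\<in>K. a j < z j}"
  proof (intro equalityI subsetI)
    fix z assume "z \<in> (\<Union>n. ?A n)"
    then obtain n where z: "z \<in> space P" "\<And>j. j \<in> K \<Longrightarrow> a j + 1 / real (Suc n) < z j" by auto
    have pos: "1 / real (Suc n) > 0" by simp
    have "a j < z j" if "j \<in> K" for j
      using z(2)[OF that] pos by linarith
    then show "z \<in> {z \<in> space P. \<forall>j\<in>K. a j < z j}" using z(1) by blast
  next
    fix z assume z: "z \<in> {z \<in> space P. \<forall>j\<in>K. a j < z j}"
    have "\<forall>\<^sub>F n in sequentially. \<forall>j\<in>K. 1 / real (Suc n) < z j - a j"
      using z by (intro eventually_ball_finite[OF K(1)] ballI order_tendstoD(2)[OF LIMSEQ_Suc[OF lim_1_over_n]]) auto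
    then obtain n where "\<forall>j\<in>K. 1 / real (Suc n) < z j - a j" by (auto dest: eventually_happens)
    then show "z \<in> (\<Union>n. ?A n)" using z by (auto simp: less_diff_eq add.commute intro!: exI[of _ n])
  qed
  ultimately show ?thesis by simp
qed

text \<open>Approaching the corner from below gives the closed orthant. It agrees in measure with
  the open one when no bounding hyperplane is charged, which is why \<open>orthant_tendsto\<close>
  asks for this.\<close>

lemma orthant_left_continuous:
  fixes P :: "('i \<Rightarrow> real) measure"
  assumes P: "prob_space P" "sets P = sets (\<Pi>\<^sub>M j\<in>J. borel)" and K: "finite K" "K \<subseteq> J"
  shows "(\<lambda>n. measure P {z \<in> space P. \<forall>j\<in>K. a j - 1 / Suc n < z j})
    \<longlonglongrightarrow> measure P {z \<in> space P. \<forall>j\<in>K. a j \<le> z j}"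
proof -
  interpret prob_space P by fact
  let ?A = "\<lambda>n::nat. {z \<in> space P. \<forall>j\<in>K. a j - 1 / Suc n < z j}"
  have "(\<lambda>n. measure P (?A n)) \<longlonglongrightarrow> measure P (\<Inter>n. ?A n)"
  proof (rule finite_Lim_measure_decseq)
    show "range ?A \<subseteq> sets P" using sets_orthant(1)[OF P(2) K] by auto
    show "decseq ?A"
    proof (rule decseq_SucI, safe)
      fix n z j assume "\<forall>j\<in>K. a j - 1 / real (Suc (Suc n)) < z j" "j \<in> K"
      moreover have "1 / real (Suc (Suc n)) \<le> 1 / real (Suc n)" by (simp add: frac_le)
      ultimately show "a j - 1 / real (Suc n) < z j" by fastforce
    qed
  qed
  moreover have "(\<Inter>n. ?A n) = {z \<in> space P. \<forall>j\<in>K. a j \<le> z j}"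
  proof (intro equalityI subsetI)
    fix z assume z: "z \<in> (\<Inter>n. ?A n)"
    have "a j \<le> z j" if "j \<in> K" for j
    proof (rule LIMSEQ_le_const2)
      show "(\<lambda>n. a j - 1 / real (Suc n)) \<longlonglongrightarrow> a j"
        using tendsto_diff[OF tendsto_const LIMSEQ_Suc[OF lim_1_over_n], of "a j"] by simp
      show "\<exists>N. \<forall>n\<ge>N. a j - 1 / real (Suc n) \<le> z j" using z that by (auto intro: less_imp_le)
    qed
    then show "z \<in> {z \<in> space P. \<forall>j\<in>K. a j \<le> z j}" using z by auto
  next
    fix z assume z: "z \<in> {z \<in> space P. \<forall>j\<in>K. a j \<le> z j}"
    have "a j - 1 / real (Suc n) < z j" if "j \<in> K" for j n
    proof -
      have "1 / real (Suc n) > 0" by simp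
      moreover have "a j \<le> z j" using z that by auto
      ultimately show ?thesis by linarith
    qed
    then show "z \<in> (\<Inter>n. ?A n)" using z by auto
  qed
  ultimately show ?thesis by simp
qed

context cramer_wold
begin

lemma smoothed_orthant_tendsto:
  assumes "K \<subseteq> J" and "\<delta> > 0"
  shows "(\<lambda>n. \<integral>z. (\<Prod>j\<in>K. 1 - cts_step (a j) (a j + \<delta>) (z j)) \<partial>N n)
    \<longlonglongrightarrow> (\<integral>z. (\<Prod>j\<in>K. 1 - cts_step (a j) (a j + \<delta>) (z j)) \<partial>Q)"
proof (rule integral_prod_tendsto[OF assms(1), where \<phi> = "\<lambda>j y. 1 - cts_step (a j) (a j + \<delta>) y"])
  show "continuous_on UNIV (\<lambda>y. 1 - cts_step (a j) (a j + \<delta>) y)" for j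
    using assms(2) by (intro continuous_intros uniformly_continuous_imp_continuous cts_step_uniformly_continuous) auto
  show "\<bar>1 - cts_step (a j) (a j + \<delta>) y\<bar> \<le> 1" for j y
    using assms(2) by (auto simp: cts_step_def divide_simps)
qed

text \<open>The upper estimate smooths from the corner \<open>a - ?d\<close> up to \<open>a\<close>,
  the lower one from \<open>a\<close> up to \<open>a + ?d\<close>. As \<open>?d\<close> shrinks, the
  limits are the closed and the open orthant, whose difference lies in the null hyperplanes.\<close>

theorem orthant_tendsto:
  assumes K: "K \<subseteq> J" and null: "\<And>j. j \<in> K \<Longrightarrow> measure Q {z \<in> space Q. z j = a j} = 0"
  shows "(\<lambda>n. measure (N n) {z \<in> space (N n). \<forall>j\<in>K. a j < z j})
    \<longlonglongrightarrow> measure Q {z \<in> space Q. \<forall>j\<in>K. a j < z j}"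
proof -
  interpret Q: prob_space Q by (rule prob_Q)
  have fK: "finite K" using K finite_J finite_subset by blast
  define G where "G = (\<lambda>b. measure Q {z \<in> space Q. \<forall>j\<in>K. b j < z j})"
  define F where "F = (\<lambda>n b. measure (N n) {z \<in> space (N n). \<forall>j\<in>K. b j < z j})"
  have closed: "measure Q {z \<in> space Q. \<forall>j\<in>K. a j \<le> z j} = G a"
  proof -
    have [measurable]: "(\<lambda>z. z j) \<in> borel_measurable Q" if "j \<in> K" for j
      using that K by (subst measurable_Q) auto
    have "AE z in Q. z j \<noteq> a j" if "j \<in> K" for j
    proof (rule AE_I)
      show "{z \<in> space Q. \<not> z j \<noteq> a j} \<subseteq> {z \<in> space Q. z j = a j}" by auto
      show "emeasure Q {z \<in> space Q. z j = a j} = 0" using null[OF that] by (simp add: Q.emeasure_eq_measure)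
      show "{z \<in> space Q. z j = a j} \<in> sets Q" using that by measurable
    qed
    then have "AE z in Q. \<forall>j\<in>K. z j \<noteq> a j" by (simp add: AE_finite_all fK)
    then show ?thesis unfolding G_def
      by (intro measure_eq_AE sets_orthant[OF sets_Q fK K]) (auto elim!: eventually_mono simp: less_le)
  qed
  have upper: "\<forall>\<^sub>F n in sequentially. F n a < c" if c: "G a < c" for c
  proof -
    have "\<forall>\<^sub>F l in sequentially. G (\<lambda>j. a j - 1 / Suc l) < c"
      using orthant_left_continuous[OF prob_Q sets_Q fK K, of a] c
      unfolding closed by (intro order_tendstoD(2)) (auto simp: G_def)
    then obtain l where l: "G (\<lambda>j. a j - 1 / Suc l) < c" by (auto dest: eventually_happens)
    let ?d = "1 / real (Suc l)"
    have d: "?d > 0" by simp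
    have "(\<integral>z. (\<Prod>j\<in>K. 1 - cts_step (a j - ?d) (a j - ?d + ?d) (z j)) \<partial>Q) < c"
      using orthant_smoothing(2)[OF prob_Q sets_Q fK K d, of "\<lambda>j. a j - ?d"] l
      unfolding G_def by (rule le_less_trans)
    then have "\<forall>\<^sub>F n in sequentially. (\<integral>z. (\<Prod>j\<in>K. 1 - cts_step (a j - ?d) (a j - ?d + ?d) (z j)) \<partial>N n) < c"
      by (rule order_tendstoD(2)[OF smoothed_orthant_tendsto[OF K d, of "\<lambda>j. a j - ?d"]])
    then show ?thesis
    proof eventually_elim
      case (elim n)
      with orthant_smoothing(1)[OF prob_N sets_N fK K d, of n "\<lambda>j. a j - ?d"]
      have "measure (N n) {z \<in> space (N n). \<forall>j\<in>K. a j - ?d + ?d < z j} < c" by (rule le_less_trans)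
      then show ?case by (simp add: F_def)
    qed
  qed
  have lower: "\<forall>\<^sub>F n in sequentially. c < F n a" if c: "c < G a" for c
  proof -
    have "\<forall>\<^sub>F l in sequentially. c < G (\<lambda>j. a j + 1 / Suc l)"
      using orthant_right_continuous[OF prob_Q sets_Q fK K, of a] c
      by (intro order_tendstoD(1)) (auto simp: G_def)
    then obtain l where l: "c < G (\<lambda>j. a j + 1 / Suc l)" by (auto dest: eventually_happens)
    let ?d = "1 / real (Suc l)"
    have d: "?d > 0" by simp
    have "c < (\<integral>z. (\<Prod>j\<in>K. 1 - cts_step (a j) (a j + ?d) (z j)) \<partial>Q)"
      using l orthant_smoothing(1)[OF prob_Q sets_Q fK K d, of a]
      unfolding G_def by (rule less_le_trans)
    then have "\<forall>\<^sub>F n in sequentially. c < (\<integral>z. (\<Prod>j\<in>K. 1 - cts_step (a j) (a j + ?d) (z j)) \<partial>N n)"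
      by (rule order_tendstoD(1)[OF smoothed_orthant_tendsto[OF K d]])
    then show ?thesis
    proof eventually_elim
      case (elim n)
      then show ?case
        using orthant_smoothing(2)[OF prob_N sets_N fK K d, of n a] unfolding F_def by (rule less_le_trans)
    qed
  qed
  have "(\<lambda>n. F n a) \<longlonglongrightarrow> G a"
    by (rule order_tendstoI) (use upper lower in auto)
  then show ?thesis by (simp add: F_def G_def)
qed

end

text \<open>A half-space in one coordinate is the countable union of orthants whose other corners
  tend to minus infinity, and such half-spaces make the coordinates measurable.\<close>

lemma sets_PiM_borel_orthants:
  assumes "finite J"
  shows "sets (\<Pi>\<^sub>M j\<in>J. borel :: real measure)
    = sigma_sets (\<Pi>\<^sub>E j\<in>J. UNIV) {Pi\<^sub>E J A | A. \<forall>j\<in>J. A j \<in> range greaterThan}"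
proof
  let ?E = "{Pi\<^sub>E J A | A. \<forall>j\<in>J. A j \<in> range (greaterThan :: real \<Rightarrow> _)}"
  define S where "S = sigma (\<Pi>\<^sub>E j\<in>J. UNIV) ?E"
  have E: "?E \<subseteq> Pow (\<Pi>\<^sub>E j\<in>J. UNIV)" by auto
  have S: "space S = (\<Pi>\<^sub>E j\<in>J. UNIV)" "sets S = sigma_sets (\<Pi>\<^sub>E j\<in>J. UNIV) ?E"
    using E by (simp_all add: S_def space_measure_of_conv)
  have "(\<lambda>z. z i) \<in> borel_measurable S" if i: "i \<in> J" for i
    unfolding borel_measurable_iff_greater
  proof
    fix a :: real
    let ?B = "\<lambda>n j. if j = i then {a<..} else {- real n<..}"
    have "{z \<in> space S. a < z i} = (\<Union>n. Pi\<^sub>E J (?B n))"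
    proof (intro equalityI subsetI)
      fix z assume z: "z \<in> {z \<in> space S. a < z i}"
      obtain n :: nat where "Max ((\<lambda>j. - z j) ` J) < real n" using reals_Archimedean2 by blast
      then have "- real n < z j" if "j \<in> J" for j
        using that assms by (subst (asm) Max_less_iff) (auto simp: minus_less_iff)
      then have "z \<in> Pi\<^sub>E J (?B n)" using z by (auto simp: S PiE_def Pi_def)
      then show "z \<in> (\<Union>n. Pi\<^sub>E J (?B n))" by blast
    next
      fix z assume "z \<in> (\<Union>n. Pi\<^sub>E J (?B n))"
      then obtain n where n: "z \<in> Pi\<^sub>E J (?B n)" by blast
      then have "z i \<in> ?B n i" using i by (rule PiE_mem)
      then show "z \<in> {z \<in> space S. a < z i}" using n by (auto simp: S PiE_def)
    qed
    moreover have "Pi\<^sub>E J (?B n) \<in> sets S" for n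
      unfolding S by (rule sigma_sets.Basic) auto
    ultimately show "{z \<in> space S. a < z i} \<in> sets S" by auto
  qed
  then have "sets (\<Pi>\<^sub>M j\<in>J. borel :: real measure) \<subseteq> sets S"
  proof (intro sets_PiM_in_sets)
    fix i A assume m: "\<And>i. i \<in> J \<Longrightarrow> (\<lambda>z. z i) \<in> borel_measurable S" and "i \<in> J" "A \<in> sets (borel :: real measure)"
    then have "(\<lambda>z. z i) -` A \<inter> space S \<in> sets S" by (blast intro: measurable_sets)
    moreover have "(\<lambda>z. z i) -` A \<inter> space S = {z \<in> space S. z i \<in> A}" by auto
    ultimately show "{z \<in> space S. z i \<in> A} \<in> sets S" by simp
  qed (simp add: S)
  then show "sets (\<Pi>\<^sub>M j\<in>J. borel :: real measure) \<subseteq> sigma_sets (\<Pi>\<^sub>E j\<in>J. UNIV) ?E"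
    by (simp add: S)
  have "?E \<subseteq> sets (\<Pi>\<^sub>M j\<in>J. borel :: real measure)"
    using assms by (auto intro!: sets_PiM_I_finite)
  then show "sigma_sets (\<Pi>\<^sub>E j\<in>J. UNIV) ?E \<subseteq> sets (\<Pi>\<^sub>M j\<in>J. borel :: real measure)"
    using sets.sigma_sets_subset[of ?E "\<Pi>\<^sub>M j\<in>J. borel :: real measure"] by (simp add: space_PiM)
qed

text \<open>A constant sequence of laws is a degenerate instance of the convergence statement.\<close>

theorem cramer_wold_unique:
  fixes P Q :: "('i \<Rightarrow> real) measure"
  assumes J: "finite J" and P: "prob_space P" "sets P = sets (\<Pi>\<^sub>M j\<in>J. borel)"
    and Q: "prob_space Q" "sets Q = sets (\<Pi>\<^sub>M j\<in>J. borel)"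
    and char: "\<And>t. (\<integral>z. iexp (\<Sum>j\<in>J. t j * z j) \<partial>P) = (\<integral>z. iexp (\<Sum>j\<in>J. t j * z j) \<partial>Q)"
  shows "P = Q"
proof -
  have le: "measure P {z \<in> space P. \<forall>j\<in>J. a j < z j} \<le> measure Q {z \<in> space Q. \<forall>j\<in>J. a j < z j}"
    if P: "prob_space P" "sets P = sets (\<Pi>\<^sub>M j\<in>J. borel)"
    and Q: "prob_space Q" "sets Q = sets (\<Pi>\<^sub>M j\<in>J. borel)"
    and char: "\<And>t. (\<integral>z. iexp (\<Sum>j\<in>J. t j * z j) \<partial>P) = (\<integral>z. iexp (\<Sum>j\<in>J. t j * z j) \<partial>Q)" for P Q a
  proof -
    interpret cramer_wold J "\<lambda>_. P" Q
    proof (rule cramer_wold.intro)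
      fix j \<epsilon> assume "j \<in> J" "(\<epsilon>::real) > 0"
      moreover have "(\<lambda>z. z j) \<in> borel_measurable P"
        using \<open>j \<in> J\<close> by (subst measurable_cong_sets[OF P(2) refl]) auto
      ultimately show "\<exists>L>0. \<forall>\<^sub>F n in sequentially. measure P {z \<in> space P. \<bar>z j\<bar> > L} < \<epsilon>"
        using tight_borel_measurable[OF P(1)] by simp
    qed (use J P Q char in \<open>simp_all only: tendsto_const\<close>)
    \<comment> \<open>For a constant sequence the smoothed integrals agree exactly. Only the corner
      is then moved, from above, so atoms on the boundary do no harm.\<close>
    have "measure P {z \<in> space P. \<forall>j\<in>J. a j + 1 / Suc n < z j} \<le> measure Q {z \<in> space Q. \<forall>j\<in>J. a j < z j}" for n
    proof -
      let ?d = "1 / real (Suc n)"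
      have d: "?d > 0" by simp
      have "(\<integral>z. (\<Prod>j\<in>J. 1 - cts_step (a j) (a j + ?d) (z j)) \<partial>P) = (\<integral>z. (\<Prod>j\<in>J. 1 - cts_step (a j) (a j + ?d) (z j)) \<partial>Q)"
        using smoothed_orthant_tendsto[OF subset_refl d] by (simp add: LIMSEQ_const_iff)
      then show ?thesis
        using orthant_smoothing(1)[OF P J subset_refl d, of a] orthant_smoothing(2)[OF Q J subset_refl d, of a]
        by linarith
    qed
    then show ?thesis
      by (intro LIMSEQ_le_const2[OF orthant_right_continuous[OF P J subset_refl]]) auto
  qed
  have eq: "measure P {z \<in> space P. \<forall>j\<in>J. a j < z j} = measure Q {z \<in> space Q. \<forall>j\<in>J. a j < z j}" for a
    using le[OF P Q char, of a] le[OF Q P char[symmetric], of a] by simp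
  interpret P: prob_space P by (rule P)
  interpret Q: prob_space Q by (rule Q)
  have sp: "space P = (\<Pi>\<^sub>E j\<in>J. UNIV)" "space Q = (\<Pi>\<^sub>E j\<in>J. UNIV)"
    using sets_eq_imp_space_eq[OF P(2)] sets_eq_imp_space_eq[OF Q(2)] by (simp_all add: space_PiM)
  let ?E = "{Pi\<^sub>E J A | A. \<forall>j\<in>J. A j \<in> range (greaterThan :: real \<Rightarrow> _)}"
  show ?thesis
  proof (rule measure_eqI_generator_eq[where E = ?E and A = "\<lambda>n. \<Pi>\<^sub>E j\<in>J. {- real n <..}"])
    show "Int_stable ?E"
    proof (rule Int_stableI)
      fix a b assume "a \<in> ?E" "b \<in> ?E"
      then obtain A B where AB: "a = Pi\<^sub>E J A" "b = Pi\<^sub>E J B" "\<And>j. j \<in> J \<Longrightarrow> A j \<in> range greaterThan"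
        "\<And>j. j \<in> J \<Longrightarrow> B j \<in> range greaterThan" by auto
      have "A j \<inter> B j \<in> range greaterThan" if j: "j \<in> J" for j
      proof -
        obtain u v where "A j = {u<..}" "B j = {v<..}" using AB(3,4)[OF j] by auto
        then have "A j \<inter> B j = {max u v<..}" by auto
        then show ?thesis by blast
      qed
      then show "a \<inter> b \<in> ?E" unfolding AB PiE_Int by blast
    qed
    show "?E \<subseteq> Pow (\<Pi>\<^sub>E j\<in>J. UNIV)" by auto
    show "sets P = sigma_sets (\<Pi>\<^sub>E j\<in>J. UNIV) ?E" "sets Q = sigma_sets (\<Pi>\<^sub>E j\<in>J. UNIV) ?E"
      using sets_PiM_borel_orthants[OF J] P Q by simp_all
    show "emeasure P X = emeasure Q X" if X: "X \<in> ?E" for X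
    proof -
      obtain A where A: "X = Pi\<^sub>E J A" "\<forall>j\<in>J. A j \<in> range greaterThan" using X by auto
      then have "\<forall>j\<in>J. \<exists>u. A j = {u<..}" by auto
      from bchoice[OF this] obtain a where a: "\<forall>j\<in>J. A j = {a j<..}" by blast
      then have "X = {z \<in> (\<Pi>\<^sub>E j\<in>J. UNIV). \<forall>j\<in>J. a j < z j}"
        unfolding A by (auto simp: PiE_def Pi_def)
      then show ?thesis using eq[of a] by (simp add: P.emeasure_eq_measure Q.emeasure_eq_measure sp)
    qed
    show "range (\<lambda>n. \<Pi>\<^sub>E j\<in>J. {- real n <..}) \<subseteq> ?E" by auto
    show "(\<Union>n. \<Pi>\<^sub>E j\<in>J. {- real n <..}) = (\<Pi>\<^sub>E j\<in>J. UNIV)"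
    proof (intro equalityI subsetI)
      fix z assume z: "z \<in> (\<Pi>\<^sub>E j\<in>J. UNIV :: real set)"
      \<comment> \<open>The inserted 0 keeps \<open>Max\<close> meaningful when \<open>J\<close> is
        empty.\<close>
      obtain n :: nat where "Max (insert 0 ((\<lambda>j. - z j) ` J)) < real n" using reals_Archimedean2 by blast
      then have "- real n < z j" if "j \<in> J" for j
        using that J by (auto simp: Max_less_iff minus_less_iff)
      then show "z \<in> (\<Union>n. \<Pi>\<^sub>E j\<in>J. {- real n <..})" using z by (auto simp: PiE_def Pi_def)
    qed auto
  qed (simp add: P.emeasure_eq_measure)
qed

subsection \<open>Gaussian laws as linear images of white noise\<close>

lemma char_normal_density:
  assumes "\<sigma> > 0"
  shows "char (density lborel (normal_density 0 \<sigma>)) t = exp (- ((\<sigma> * t)\<^sup>2) / 2)"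
proof -
  interpret prob_space std_normal_distribution by (rule prob_space_normal_density) simp
  have "distributed std_normal_distribution lborel (\<lambda>x. x) (normal_density 0 1)"
    by (auto simp: distributed_def distr_id2)
  from normal_density_affine[OF this, of \<sigma> 0] assms
  have "distr std_normal_distribution lborel (\<lambda>x. \<sigma> * x) = density lborel (normal_density 0 \<sigma>)"
    by (simp add: distributed_def)
  then have "char (density lborel (normal_density 0 \<sigma>)) t = char (distr std_normal_distribution lborel (\<lambda>x. \<sigma> * x)) t"
    by simp
  also have "\<dots> = (CLINT x|std_normal_distribution. iexp (t * (\<sigma> * x)))"
    unfolding char_def by (subst integral_distr) auto
  also have "\<dots> = char std_normal_distribution (\<sigma> * t)"
    by (simp add: char_def mult_ac)
  also have "\<dots> = complex_of_real (exp (- ((\<sigma> * t)\<^sup>2) / 2))"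
    by (simp add: char_std_normal_distribution)
  finally show ?thesis by simp
qed

lemma is_centred_normal_char:
  assumes "is_centred_normal v N"
  shows "char N t = exp (- (v * t\<^sup>2) / 2)"
proof -
  consider "v = 0" "N = return borel 0" | "v > 0" "N = density lborel (normal_density 0 (sqrt v))"
    using assms by (auto simp: is_centred_normal_def)
  then show ?thesis
  proof cases
    case 1
    then show ?thesis by (simp add: char_def integral_return)
  next
    case 2
    then show ?thesis by (simp add: char_normal_density power_mult_distrib)
  qed
qed

lemma is_centred_normalI:
  assumes "real_distribution N" and "v \<ge> 0" and "\<And>t. char N t = exp (- (v * t\<^sup>2) / 2)"
  shows "is_centred_normal v N"
proof -
  define R where "R = (if v = 0 then return borel 0 else density lborel (normal_density 0 (sqrt v)))"
  have R: "is_centred_normal v R" using assms(2) by (auto simp: R_def is_centred_normal_def)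
  have "real_distribution R"
  proof (cases "v = 0")
    case True
    then show ?thesis
      by (auto simp: R_def real_distribution_def real_distribution_axioms_def prob_space_return)
  next
    case False
    then show ?thesis
      using prob_space_normal_density assms(2)
      by (auto simp: R_def real_distribution_def real_distribution_axioms_def)
  qed
  moreover have "char N = char R" using assms(3) is_centred_normal_char[OF R] by auto
  ultimately have "N = R" using assms(1) Levy_uniqueness by blast
  with R show ?thesis by simp
qed

lemma is_centred_gaussian_char:
  assumes "finite J" and "is_centred_gaussian J \<Sigma> N"
  shows "(\<integral>z. iexp (\<Sum>j\<in>J. t j * z j) \<partial>N) = exp (- (\<Sum>i\<in>J. \<Sum>j\<in>J. t i * t j * \<Sigma> i j) / 2)"
proof -
  have sets: "sets N = sets (\<Pi>\<^sub>M j\<in>J. borel :: real measure)" using assms(2) by (simp add: is_centred_gaussian_def)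
  have m: "(\<lambda>z. \<Sum>j\<in>J. t j * z j) \<in> borel_measurable N"
    by (subst measurable_cong_sets[OF sets refl]) simp
  have "(\<integral>z. iexp (\<Sum>j\<in>J. t j * z j) \<partial>N) = char (distr N borel (\<lambda>z. \<Sum>j\<in>J. t j * z j)) 1"
    unfolding char_def by (subst integral_distr[OF m]) (simp_all del: of_real_sum)
  also have "\<dots> = exp (- (\<Sum>i\<in>J. \<Sum>j\<in>J. t i * t j * \<Sigma> i j) / 2)"
    using assms(2) by (subst is_centred_normal_char) (auto simp: is_centred_gaussian_def)
  finally show ?thesis .
qed

lemma centred_gaussian_eqI:
  assumes J: "finite J" and N: "is_centred_gaussian J \<Sigma> N"
  shows "centred_gaussian J \<Sigma> = N"
  unfolding centred_gaussian_def
proof (rule the_equality)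
  show "is_centred_gaussian J \<Sigma> N" by (rule N)
next
  fix N' assume N': "is_centred_gaussian J \<Sigma> N'"
  show "N' = N"
  proof (rule cramer_wold_unique[OF J])
    show "(\<integral>z. iexp (\<Sum>j\<in>J. t j * z j) \<partial>N') = (\<integral>z. iexp (\<Sum>j\<in>J. t j * z j) \<partial>N)" for t
      by (simp only: is_centred_gaussian_char[OF J N] is_centred_gaussian_char[OF J N'])
  qed (use N N' in \<open>simp_all add: is_centred_gaussian_def\<close>)
qed

definition white_noise :: "'s set \<Rightarrow> ('s \<Rightarrow> real) measure" where
  "white_noise S = (\<Pi>\<^sub>M x\<in>S. std_normal_distribution)"

lemma prob_space_white_noise: "prob_space (white_noise S)"
  unfolding white_noise_def by (intro prob_space_PiM prob_space_normal_density) simp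

lemma measurable_white_noise: "measurable (white_noise S) A = measurable (\<Pi>\<^sub>M x\<in>S. borel) A"
  unfolding white_noise_def by (intro measurable_cong_sets sets_PiM_cong) auto

lemma white_noise_char:
  assumes "finite S"
  shows "(\<integral>w. iexp (\<Sum>x\<in>S. b x * w x) \<partial>white_noise S) = exp (- (\<Sum>x\<in>S. (b x)\<^sup>2) / 2)"
proof -
  interpret P: prob_space std_normal_distribution by (rule prob_space_normal_density) simp
  interpret product_sigma_finite "\<lambda>_. std_normal_distribution"
    by (simp add: product_sigma_finite_def P.sigma_finite_measure_axioms)
  have "(\<integral>w. iexp (\<Sum>x\<in>S. b x * w x) \<partial>white_noise S) = (\<integral>w. (\<Prod>x\<in>S. iexp (b x * w x)) \<partial>white_noise S)"
    using assms by (simp add: exp_sum[symmetric] sum_distrib_left)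
  also have "\<dots> = (\<Prod>x\<in>S. CLINT y|std_normal_distribution. iexp (b x * y))"
    unfolding white_noise_def
  proof (rule product_integral_prod[OF assms])
    show "integrable std_normal_distribution (\<lambda>y. iexp (b x * y))" for x
      by (rule P.integrable_const_bound[of _ 1]) auto
  qed
  also have "\<dots> = (\<Prod>x\<in>S. exp (- ((b x)\<^sup>2) / 2))"
    using char_std_normal_distribution by (simp add: char_def fun_eq_iff)
  also have "\<dots> = exp (- (\<Sum>x\<in>S. (b x)\<^sup>2) / 2)"
    using assms by (simp add: exp_sum[symmetric] sum_negf sum_divide_distrib)
  finally show ?thesis by simp
qed

definition linear_image :: "'i set \<Rightarrow> 's set \<Rightarrow> ('i \<Rightarrow> 's \<Rightarrow> real) \<Rightarrow> ('i \<Rightarrow> real) measure" where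
  "linear_image J S A = distr (white_noise S) (\<Pi>\<^sub>M j\<in>J. borel) (\<lambda>w. \<lambda>j\<in>J. \<Sum>x\<in>S. A j x * w x)"

lemma measurable_linear_form [measurable]:
  "(\<lambda>w. \<Sum>x\<in>S. b x * w x) \<in> borel_measurable (white_noise S)"
  unfolding measurable_white_noise by simp

lemma measurable_linear_map [measurable]:
  "(\<lambda>w. \<lambda>j\<in>J. \<Sum>x\<in>S. A j x * w x) \<in> measurable (white_noise S) (\<Pi>\<^sub>M j\<in>J. borel)"
  by (intro measurable_restrict measurable_linear_form)

lemma linear_form_centred_normal:
  assumes "finite S"
  shows "is_centred_normal (\<Sum>x\<in>S. (b x)\<^sup>2) (distr (white_noise S) borel (\<lambda>w. \<Sum>x\<in>S. b x * w x))"
proof (rule is_centred_normalI)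
  interpret prob_space "white_noise S" by (rule prob_space_white_noise)
  show "real_distribution (distr (white_noise S) borel (\<lambda>w. \<Sum>x\<in>S. b x * w x))"
    by (rule real_distribution_distr) measurable
  show "(\<Sum>x\<in>S. (b x)\<^sup>2) \<ge> 0" by (simp add: sum_nonneg)
  fix t
  have "char (distr (white_noise S) borel (\<lambda>w. \<Sum>x\<in>S. b x * w x)) t
      = (\<integral>w. iexp (t * (\<Sum>x\<in>S. b x * w x)) \<partial>white_noise S)"
    unfolding char_def by (rule integral_distr) measurable
  also have "\<dots> = (\<integral>w. iexp (\<Sum>x\<in>S. (t * b x) * w x) \<partial>white_noise S)"
    by (simp only: sum_distrib_left mult.assoc)
  also have "\<dots> = exp (- ((\<Sum>x\<in>S. (b x)\<^sup>2) * t\<^sup>2) / 2)"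
    by (subst white_noise_char[OF assms]) (simp add: power_mult_distrib sum_distrib_left mult.commute)
  finally show "char (distr (white_noise S) borel (\<lambda>w. \<Sum>x\<in>S. b x * w x)) t
      = exp (- ((\<Sum>x\<in>S. (b x)\<^sup>2) * t\<^sup>2) / 2)" .
qed

text \<open>The combination with coefficients \<open>c\<close> is a linear form in the noise with
  coefficients \<open>b\<close>, and the sum of the squares of \<open>b\<close> is the quadratic
  form of \<open>\<Sigma>\<close> at \<open>c\<close>. Any factorisation of \<open>\<Sigma>\<close>,
  rectangular or of deficient rank, will do.\<close>

lemma linear_image_gaussian:
  assumes J: "finite J" and S: "finite S"
    and \<Sigma>: "\<And>i j. i \<in> J \<Longrightarrow> j \<in> J \<Longrightarrow> \<Sigma> i j = (\<Sum>x\<in>S. A i x * A j x)"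
  shows "is_centred_gaussian J \<Sigma> (linear_image J S A)"
  unfolding is_centred_gaussian_def
proof (intro conjI allI)
  interpret prob_space "white_noise S" by (rule prob_space_white_noise)
  show "prob_space (linear_image J S A)"
    unfolding linear_image_def by (rule prob_space_distr) measurable
  show "sets (linear_image J S A) = sets (\<Pi>\<^sub>M j\<in>J. borel)" by (simp add: linear_image_def)
  fix c :: "'a \<Rightarrow> real"
  define b where "b x = (\<Sum>j\<in>J. c j * A j x)" for x
  have "distr (linear_image J S A) borel (\<lambda>z. \<Sum>j\<in>J. c j * z j)
      = distr (white_noise S) borel (\<lambda>w. \<Sum>j\<in>J. c j * (\<Sum>x\<in>S. A j x * w x))"
    unfolding linear_image_def
    by (subst distr_distr) (auto simp: comp_def intro!: distr_cong sum.cong)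
  also have "(\<lambda>w. \<Sum>j\<in>J. c j * (\<Sum>x\<in>S. A j x * w x)) = (\<lambda>w. \<Sum>x\<in>S. b x * w x)"
    unfolding b_def sum_distrib_left sum_distrib_right
    by (subst sum.swap) (simp add: mult_ac)
  finally have 1: "distr (linear_image J S A) borel (\<lambda>z. \<Sum>j\<in>J. c j * z j)
      = distr (white_noise S) borel (\<lambda>w. \<Sum>x\<in>S. b x * w x)" .
  have "(\<Sum>x\<in>S. (b x)\<^sup>2) = (\<Sum>x\<in>S. \<Sum>i\<in>J. \<Sum>j\<in>J. c i * c j * (A i x * A j x))"
    by (simp add: b_def power2_eq_square sum_product mult_ac)
  also have "\<dots> = (\<Sum>i\<in>J. \<Sum>x\<in>S. \<Sum>j\<in>J. c i * c j * (A i x * A j x))"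
    by (rule sum.swap)
  also have "\<dots> = (\<Sum>i\<in>J. \<Sum>j\<in>J. \<Sum>x\<in>S. c i * c j * (A i x * A j x))"
    by (intro sum.cong refl sum.swap)
  also have "\<dots> = (\<Sum>i\<in>J. \<Sum>j\<in>J. c i * c j * \<Sigma> i j)"
    by (simp add: \<Sigma> sum_distrib_left)
  finally show "is_centred_normal (\<Sum>i\<in>J. \<Sum>j\<in>J. c i * c j * \<Sigma> i j)
      (distr (linear_image J S A) borel (\<lambda>z. \<Sum>j\<in>J. c j * z j))"
    using linear_form_centred_normal[OF S, of b] 1 by simp
qed

subsection \<open>Quantiles of the minimum of a Gaussian vector\<close>

lemma tendsto_Min:
  fixes f :: "'j \<Rightarrow> 'x \<Rightarrow> real"
  assumes "finite I" and "I \<noteq> {}" and "\<And>j. j \<in> I \<Longrightarrow> (f j \<longlongrightarrow> l j) F"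
  shows "((\<lambda>x. Min ((\<lambda>j. f j x) ` I)) \<longlongrightarrow> Min (l ` I)) F"
  using assms
proof (induction rule: finite_ne_induct)
  case (insert j I)
  then have "((\<lambda>x. min (f j x) (Min ((\<lambda>j. f j x) ` I))) \<longlongrightarrow> min (l j) (Min (l ` I))) F"
    by (intro tendsto_min) auto
  then show ?case using insert.hyps by simp
qed simp

lemma (in real_distribution) quantile_le:
  assumes "\<alpha> > 0" and "\<alpha> \<le> cdf M b"
  shows "quantile M \<alpha> \<le> b"
  unfolding quantile_def
proof (rule cInf_lower)
  show "b \<in> {t. \<alpha> \<le> cdf M t}" using assms by simp
  have "\<forall>\<^sub>F t in at_bot. cdf M t < \<alpha>"
    using cdf_lim_at_bot assms(1) by (rule order_tendstoD(2))
  then obtain a where "\<And>t. t \<le> a \<Longrightarrow> cdf M t < \<alpha>" by (auto simp: eventually_at_bot_linorder)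
  then show "bdd_below {t. \<alpha> \<le> cdf M t}"
    by (intro bdd_belowI[of _ a]) (metis linorder_not_le mem_Collect_eq less_imp_le)
qed

lemma (in real_distribution) quantile_ge:
  assumes "\<alpha> < 1" and "cdf M a < \<alpha>"
  shows "a \<le> quantile M \<alpha>"
  unfolding quantile_def
proof (rule cInf_greatest)
  have "\<forall>\<^sub>F t in at_top. \<alpha> < cdf M t"
    using cdf_lim_at_top_prob assms(1) by (rule order_tendstoD(1))
  then obtain t where "\<alpha> < cdf M t" by (auto simp: eventually_at_top_linorder)
  then show "{t. \<alpha> \<le> cdf M t} \<noteq> {}" by (auto intro: less_imp_le)
  fix t assume "t \<in> {t. \<alpha> \<le> cdf M t}"
  then have "cdf M a < cdf M t" using assms(2) by simp
  then show "a \<le> t" using cdf_nondecreasing[of t a] by force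
qed

definition min_form :: "'i set \<Rightarrow> 's set \<Rightarrow> ('i \<Rightarrow> 's \<Rightarrow> real) \<Rightarrow> ('s \<Rightarrow> real) \<Rightarrow> real" where
  "min_form I S A w = Min ((\<lambda>j. \<Sum>x\<in>S. A j x * w x) ` I)"

definition min_law :: "'i set \<Rightarrow> 's set \<Rightarrow> ('i \<Rightarrow> 's \<Rightarrow> real) \<Rightarrow> real measure" where
  "min_law I S A = distr (white_noise S) borel (min_form I S A)"

lemma measurable_min_form:
  "finite I \<Longrightarrow> min_form I S A \<in> borel_measurable (white_noise S)"
  unfolding min_form_def[abs_def] by (intro borel_measurable_Min measurable_linear_form)

lemma real_distribution_min_law: "finite I \<Longrightarrow> real_distribution (min_law I S A)"
  unfolding min_law_def
  by (intro prob_space.real_distribution_distr prob_space_white_noise measurable_min_form)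

lemma cdf_min_law:
  "finite I \<Longrightarrow> cdf (min_law I S A) t = measure (white_noise S) {w \<in> space (white_noise S). min_form I S A w \<le> t}"
  unfolding cdf_def min_law_def
  by (subst measure_distr[OF measurable_min_form]) (auto intro!: arg_cong[where f = "measure _"])

lemma min_law_linear_image:
  assumes "finite J" and "I \<subseteq> J"
  shows "distr (linear_image J S A) borel (\<lambda>z. Min (z ` I)) = min_law I S A"
proof -
  have fin: "finite I" using assms finite_subset by blast
  have m: "(\<lambda>z. Min (z ` I)) \<in> borel_measurable (\<Pi>\<^sub>M j\<in>J. borel :: real measure)"
    using assms(2) by (intro borel_measurable_Min fin measurable_component_singleton) auto
  have "(\<lambda>j\<in>J. \<Sum>x\<in>S. A j x * w x) ` I = (\<lambda>j. \<Sum>x\<in>S. A j x * w x) ` I" for w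
    using assms(2) by (intro image_cong) auto
  then show ?thesis
    unfolding linear_image_def min_law_def
    by (subst distr_distr[OF m measurable_linear_map]) (auto simp: comp_def min_form_def intro!: distr_cong)
qed

lemma normal_no_atom:
  assumes "is_centred_normal v N" and "v > 0"
  shows "measure N {t} = 0"
proof -
  have N: "N = density lborel (normal_density 0 (sqrt v))" using assms by (auto simp: is_centred_normal_def)
  have "emeasure N {t} = (\<integral>\<^sup>+x. ennreal (normal_density 0 (sqrt v) x) * indicator {t} x \<partial>lborel)"
    unfolding N by (rule emeasure_density) auto
  also have "\<dots> = (\<integral>\<^sup>+x. 0 \<partial>(lborel :: real measure))"
    by (intro nn_integral_cong_AE) (use AE_lborel_singleton[of t] in \<open>auto elim!: eventually_mono\<close>)
  finally show ?thesis by (simp add: measure_def)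
qed

text \<open>The minimum is attained by one of the forms, so the event is covered by finitely many
  events on which a single nondegenerate normal variable takes the value \<open>t\<close>. The
  dependence between the forms is irrelevant.\<close>

lemma min_law_no_atom:
  assumes "finite S" and "finite I" and "I \<noteq> {}" and pos: "\<And>j. j \<in> I \<Longrightarrow> (\<Sum>x\<in>S. (A j x)\<^sup>2) > 0"
  shows "measure (white_noise S) {w \<in> space (white_noise S). min_form I S A w = t} = 0"
proof -
  interpret prob_space "white_noise S" by (rule prob_space_white_noise)
  let ?Z = "\<lambda>j. {w \<in> space (white_noise S). (\<Sum>x\<in>S. A j x * w x) = t}"
  have Z: "prob (?Z j) = 0" if "j \<in> I" for j
  proof -
    have "prob (?Z j) = measure (distr (white_noise S) borel (\<lambda>w. \<Sum>x\<in>S. A j x * w x)) {t}"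
      by (subst measure_distr) (auto intro!: arg_cong[where f = "measure _"])
    also have "\<dots> = 0"
      by (rule normal_no_atom[OF linear_form_centred_normal[OF assms(1)] pos[OF that]])
    finally show ?thesis .
  qed
  have "{w \<in> space (white_noise S). min_form I S A w = t} \<subseteq> (\<Union>j\<in>I. ?Z j)"
  proof safe
    fix w assume w: "w \<in> space (white_noise S)" and "t = min_form I S A w"
    then have "t \<in> (\<lambda>j. \<Sum>x\<in>S. A j x * w x) ` I"
      unfolding min_form_def using Min_in[of "(\<lambda>j. \<Sum>x\<in>S. A j x * w x) ` I"] assms by auto
    then show "w \<in> (\<Union>j\<in>I. {wa \<in> space (white_noise S). (\<Sum>x\<in>S. A j x * wa x) = min_form I S A w})"
      using w \<open>t = _\<close> by auto
  qed
  then have "prob {w \<in> space (white_noise S). min_form I S A w = t} \<le> prob (\<Union>j\<in>I. ?Z j)"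
    by (intro finite_measure_mono sets.finite_UN assms) measurable
  also have "\<dots> \<le> (\<Sum>j\<in>I. prob (?Z j))"
    by (intro finite_measure_subadditive_finite assms) auto
  also have "\<dots> = 0" using Z by simp
  finally show ?thesis by (simp add: measure_le_0_iff)
qed

lemma std_normal_interval_positive:
  assumes "a < b"
  shows "measure std_normal_distribution {a<..<b} > 0"
proof -
  interpret prob_space std_normal_distribution by (rule prob_space_normal_density) simp
  have "emeasure std_normal_distribution {a<..<b} \<noteq> 0"
  proof
    assume "emeasure std_normal_distribution {a<..<b} = 0"
    then have "AE x in std_normal_distribution. x \<notin> {a<..<b}"
      by (intro AE_not_in) auto
    then have "AE x in lborel. x \<notin> {a<..<b}"
      by (subst (asm) AE_density) (auto simp: normal_density_pos)
    then have "emeasure lborel {a<..<b} = 0"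
      by (subst (asm) AE_iff_measurable[of "{a<..<b}"]) auto
    then show False using assms by simp
  qed
  then show ?thesis by (simp add: emeasure_eq_measure zero_less_measure_iff)
qed

lemma normal_box_positive:
  assumes "finite S" and "\<delta> > (0::real)"
  shows "measure (white_noise S) (\<Pi>\<^sub>E x\<in>S. {a x - \<delta> <..< a x + \<delta>}) > 0"
proof -
  interpret P: prob_space std_normal_distribution by (rule prob_space_normal_density) simp
  interpret product_sigma_finite "\<lambda>_. std_normal_distribution"
    by (simp add: product_sigma_finite_def P.sigma_finite_measure_axioms)
  interpret W: prob_space "white_noise S" by (rule prob_space_white_noise)
  have pos: "emeasure std_normal_distribution {u - \<delta> <..< u + \<delta>} \<noteq> 0" for u
    using std_normal_interval_positive[of "u - \<delta>" "u + \<delta>"] assms(2) by (auto simp: measure_def)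
  have "emeasure (white_noise S) (\<Pi>\<^sub>E x\<in>S. {a x - \<delta> <..< a x + \<delta>})
      = (\<Prod>x\<in>S. emeasure std_normal_distribution {a x - \<delta> <..< a x + \<delta>})"
    unfolding white_noise_def by (rule emeasure_PiM[OF assms(1)]) simp
  also have "\<dots> \<noteq> 0" using pos assms(1) by simp
  finally show ?thesis by (simp add: W.emeasure_eq_measure zero_less_measure_iff)
qed

text \<open>The minimum of linear forms is continuous, so its range is an interval, and the Gaussian
  law charges every nonempty open set; hence the distribution function of the minimum has no
  flat part strictly between \<open>0\<close> and \<open>1\<close>.\<close>

lemma cdf_min_law_strict:
  assumes S: "finite S" and I: "finite I" "I \<noteq> {}" and "s < t"
    and pos: "cdf (min_law I S A) s > 0" and lt1: "cdf (min_law I S A) t < 1"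
  shows "cdf (min_law I S A) s < cdf (min_law I S A) t"
proof -
  interpret prob_space "white_noise S" by (rule prob_space_white_noise)
  let ?h = "min_form I S A"
  note [measurable] = measurable_min_form[OF I(1)]
  obtain w1 where w1: "?h w1 \<le> s"
  proof -
    have "{w \<in> space (white_noise S). ?h w \<le> s} \<noteq> {}"
      using pos unfolding cdf_min_law[OF I(1)] by (metis less_irrefl measure_empty)
    then show ?thesis using that by blast
  qed
  obtain w2 where w2: "?h w2 > t"
  proof -
    have "{w \<in> space (white_noise S). ?h w \<le> t} \<noteq> space (white_noise S)"
      using lt1 unfolding cdf_min_law[OF I(1)] by (metis less_irrefl prob_space)
    then obtain w where "\<not> ?h w \<le> t" by blast
    then show ?thesis using that by (simp add: not_le)
  qed
  have lim: "((\<lambda>n. ?h (u n)) \<longlongrightarrow> ?h v) F" if "\<And>x. x \<in> S \<Longrightarrow> ((\<lambda>n. u n x) \<longlongrightarrow> v x) F"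
    for u :: "'z \<Rightarrow> 'a \<Rightarrow> real" and v F
    unfolding min_form_def
    by (rule tendsto_Min[OF I]) (intro tendsto_sum tendsto_mult tendsto_const that)
  define g where "g = (\<lambda>\<theta>::real. ?h (\<lambda>x. (1 - \<theta>) * w1 x + \<theta> * w2 x))"
  have "continuous_on {0..1} g"
    unfolding g_def continuous_on_def by (intro ballI lim tendsto_intros)
  moreover have "g 0 \<le> (s + t) / 2" "(s + t) / 2 \<le> g 1" using w1 w2 \<open>s < t\<close> by (auto simp: g_def)
  ultimately obtain \<theta> where \<theta>: "g \<theta> = (s + t) / 2"
    using IVT'[of g 0 "(s + t) / 2" 1] by auto
  \<comment> \<open>At this point of the segment from \<open>w1\<close> to \<open>w2\<close> the
    minimum is halfway between \<open>s\<close> and \<open>t\<close>. By continuity a whole box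
    around it stays strictly between them, and the mass of that box separates the two values of the
    distribution function.\<close>
  define w0 where "w0 = (\<lambda>x. (1 - \<theta>) * w1 x + \<theta> * w2 x)"
  have w0: "s < ?h w0" "?h w0 < t" using \<theta> \<open>s < t\<close> by (auto simp: g_def w0_def)
  define U where "U = (\<lambda>n::nat. \<Pi>\<^sub>E x\<in>S. {w0 x - 1 / real (Suc n) <..< w0 x + 1 / real (Suc n)})"
  have "\<exists>n. \<forall>w\<in>U n. s < ?h w \<and> ?h w < t"
  proof (rule ccontr)
    assume "\<not> ?thesis"
    then have "\<forall>n. \<exists>w. w \<in> U n \<and> \<not> (s < ?h w \<and> ?h w < t)" by blast
    then obtain u where u: "\<And>n. u n \<in> U n" "\<And>n. \<not> (s < ?h (u n) \<and> ?h (u n) < t)" by metis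
    have "(\<lambda>n. ?h (u n)) \<longlonglongrightarrow> ?h w0"
    proof (rule lim)
      fix x assume "x \<in> S"
      show "(\<lambda>n. u n x) \<longlonglongrightarrow> w0 x"
      proof (rule LIMSEQ_I)
        fix r :: real assume "r > 0"
        then obtain N where N: "1 / real (Suc N) < r" using nat_approx_posE by metis
        have "norm (u n x - w0 x) < r" if "n \<ge> N" for n
        proof -
          have "u n x \<in> {w0 x - 1 / real (Suc n) <..< w0 x + 1 / real (Suc n)}"
            using u(1)[of n] \<open>x \<in> S\<close> unfolding U_def by (rule PiE_mem)
          then have "\<bar>u n x - w0 x\<bar> < 1 / real (Suc n)" by auto
          also have "\<dots> \<le> 1 / real (Suc N)" using that by (simp add: frac_le)
          finally show ?thesis using N by simp
        qed
        then show "\<exists>N. \<forall>n\<ge>N. norm (u n x - w0 x) < r" by blast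
      qed
    qed
    then have "\<forall>\<^sub>F n in sequentially. s < ?h (u n) \<and> ?h (u n) < t"
      using w0 by (auto intro: order_tendstoD eventually_conj)
    then show False using u(2) by simp
  qed
  then obtain n where n: "\<And>w. w \<in> U n \<Longrightarrow> s < ?h w \<and> ?h w < t" by blast
  have Un: "U n \<in> sets (white_noise S)"
    unfolding U_def white_noise_def by (intro sets_PiM_I_finite S) simp
  have "cdf (min_law I S A) s < cdf (min_law I S A) s + prob (U n)"
    using normal_box_positive[OF S, of "1 / real (Suc n)" w0] by (simp add: U_def)
  also have "\<dots> = prob ({w \<in> space (white_noise S). ?h w \<le> s} \<union> U n)"
    unfolding cdf_min_law[OF I(1)] using n Un
    by (intro finite_measure_Union[symmetric]) force+
  also have "\<dots> \<le> cdf (min_law I S A) t"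
    unfolding cdf_min_law[OF I(1)] using n sets.sets_into_space[OF Un] \<open>s < t\<close>
    by (intro finite_measure_mono) (auto intro: less_imp_le)
  finally show ?thesis .
qed

section \<open>Continuity of the quantile in the coefficients of the linear forms\<close>

locale nondegenerate_min =
  fixes I :: "'i set" and S :: "'s set" and A :: "'i \<Rightarrow> 's \<Rightarrow> real" and \<alpha> :: real
  assumes S: "finite S" and I: "finite I" "I \<noteq> {}"
    and pos: "\<And>j. j \<in> I \<Longrightarrow> (\<Sum>x\<in>S. (A j x)\<^sup>2) > 0"
    and \<alpha>: "0 < \<alpha>" "\<alpha> < 1"
begin

sublocale law: real_distribution "min_law I S A" by (rule real_distribution_min_law[OF I(1)])

abbreviation q where "q \<equiv> quantile (min_law I S A) \<alpha>"

lemma isCont_cdf_min_law: "isCont (cdf (min_law I S A)) t"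
proof -
  have "measure (min_law I S A) {t} = measure (white_noise S) {w \<in> space (white_noise S). min_form I S A w = t}"
    unfolding min_law_def by (subst measure_distr[OF measurable_min_form[OF I(1)]])
      (auto intro!: arg_cong[where f = "measure _"])
  then show ?thesis by (simp add: law.isCont_cdf min_law_no_atom[OF S I pos])
qed

lemma cdf_below_quantile: "t < q \<Longrightarrow> cdf (min_law I S A) t < \<alpha>"
  using law.quantile_le[OF \<alpha>(1), of t] by force

text \<open>Values to the left of \<open>q\<close> are below \<open>\<alpha>\<close> and values to
  the right are at least \<open>\<alpha>\<close>; continuity at \<open>q\<close> forces equality.
  This equality is what later makes the level exact.\<close>

lemma cdf_quantile: "cdf (min_law I S A) q = \<alpha>"
proof (rule antisym)
  have lim: "(cdf (min_law I S A) \<longlongrightarrow> cdf (min_law I S A) q) (at_left q)"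
    "(cdf (min_law I S A) \<longlongrightarrow> cdf (min_law I S A) q) (at_right q)"
    using isCont_cdf_min_law[of q] by (auto simp: isCont_def filterlim_at_split)
  show "cdf (min_law I S A) q \<le> \<alpha>"
    by (rule tendsto_upperbound[OF lim(1)])
       (auto simp: eventually_at_left_field intro!: exI[of _ "q - 1"] less_imp_le cdf_below_quantile)
  have "\<alpha> \<le> cdf (min_law I S A) t" if "t > q" for t
    using that law.quantile_ge[OF \<alpha>(2), of t] by force
  then show "\<alpha> \<le> cdf (min_law I S A) q"
    by (intro tendsto_lowerbound[OF lim(2)]) (auto simp: eventually_at_right_field intro!: exI[of _ "q + 1"])
qed

text \<open>The value at \<open>q\<close> is \<open>\<alpha> > 0\<close>. Hence either the value at
  \<open>t\<close> is 1, or both lie where \<open>cdf_min_law_strict\<close> excludes a flat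
  part.\<close>

lemma cdf_above_quantile: "q < t \<Longrightarrow> \<alpha> < cdf (min_law I S A) t"
  using cdf_min_law_strict[OF S I, of q t A] cdf_quantile \<alpha> law.cdf_bounded_prob[of t] by force

text \<open>The noise is the same for all \<open>n\<close> and only the coefficients move, so the
  minima converge pointwise. The indicators then converge off the null event that the limiting
  minimum equals \<open>t\<close>, and dominated convergence applies.\<close>

lemma cdf_min_law_tendsto:
  assumes "\<And>j x. j \<in> I \<Longrightarrow> x \<in> S \<Longrightarrow> (\<lambda>n. A' n j x) \<longlonglongrightarrow> A j x"
  shows "(\<lambda>n. cdf (min_law I S (A' n)) t) \<longlonglongrightarrow> cdf (min_law I S A) t"
proof -
  interpret W: prob_space "white_noise S" by (rule prob_space_white_noise)
  note [measurable] = measurable_min_form[OF I(1)]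
  let ?f = "\<lambda>A w. indicat_real {w \<in> space (white_noise S). min_form I S A w \<le> t} w"
  have "(\<lambda>n. \<integral>w. ?f (A' n) w \<partial>white_noise S) \<longlonglongrightarrow> (\<integral>w. ?f A w \<partial>white_noise S)"
  proof (rule integral_dominated_convergence[where w = "\<lambda>_. 1"])
    have "AE w in white_noise S. min_form I S A w \<noteq> t"
    proof (rule AE_I)
      show "emeasure (white_noise S) {w \<in> space (white_noise S). min_form I S A w = t} = 0"
        using min_law_no_atom[OF S I pos] by (simp add: W.emeasure_eq_measure)
    qed auto
    then show "AE w in white_noise S. (\<lambda>n. ?f (A' n) w) \<longlonglongrightarrow> ?f A w"
    proof eventually_elim
      case (elim w)
      have lim: "(\<lambda>n. min_form I S (A' n) w) \<longlonglongrightarrow> min_form I S A w"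
        unfolding min_form_def by (rule tendsto_Min[OF I]) (intro tendsto_intros assms)
      have "\<forall>\<^sub>F n in sequentially. ?f (A' n) w = ?f A w"
      proof (cases "min_form I S A w < t")
        case True
        with lim have "\<forall>\<^sub>F n in sequentially. min_form I S (A' n) w < t" by (rule order_tendstoD)
        then show ?thesis by (rule eventually_mono) (use True in \<open>auto simp: indicator_def\<close>)
      next
        case False
        with elim have gt: "t < min_form I S A w" by simp
        with lim have "\<forall>\<^sub>F n in sequentially. t < min_form I S (A' n) w" by (rule order_tendstoD)
        then show ?thesis by (rule eventually_mono) (use gt in \<open>auto simp: indicator_def\<close>)
      qed
      then show ?case by (rule tendsto_eventually)
    qed
    show "(\<lambda>w. ?f A w) \<in> borel_measurable (white_noise S)" by measurable
    show "(\<lambda>w. ?f (A' n) w) \<in> borel_measurable (white_noise S)" for n by measurable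
    show "AE w in white_noise S. norm (?f (A' n) w) \<le> 1" for n by (simp add: indicator_def)
  qed simp
  then show ?thesis by (simp add: cdf_min_law[OF I(1)])
qed

text \<open>Convergence of distribution functions passes to the quantile because the limit is
  strictly below \<open>\<alpha>\<close> on the left of \<open>q\<close> and strictly above it on
  the right.\<close>

lemma quantile_min_law_tendsto:
  assumes "\<And>j x. j \<in> I \<Longrightarrow> x \<in> S \<Longrightarrow> (\<lambda>n. A' n j x) \<longlonglongrightarrow> A j x"
  shows "(\<lambda>n. quantile (min_law I S (A' n)) \<alpha>) \<longlonglongrightarrow> q"
proof (rule order_tendstoI)
  fix a assume "a < q"
  then obtain b where b: "a < b" "b < q" using dense by blast
  have "\<forall>\<^sub>F n in sequentially. cdf (min_law I S (A' n)) b < \<alpha>"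
    using cdf_min_law_tendsto[OF assms] cdf_below_quantile[OF b(2)] by (rule order_tendstoD(2))
  then show "\<forall>\<^sub>F n in sequentially. a < quantile (min_law I S (A' n)) \<alpha>"
  proof eventually_elim
    case (elim n)
    from real_distribution.quantile_ge[OF real_distribution_min_law[OF I(1)] \<alpha>(2) elim] b(1)
    show ?case by simp
  qed
next
  fix a assume "q < a"
  then obtain b where b: "q < b" "b < a" using dense by blast
  have "\<forall>\<^sub>F n in sequentially. \<alpha> < cdf (min_law I S (A' n)) b"
    using cdf_min_law_tendsto[OF assms] cdf_above_quantile[OF b(1)] by (rule order_tendstoD(1))
  then show "\<forall>\<^sub>F n in sequentially. quantile (min_law I S (A' n)) \<alpha> < a"
  proof eventually_elim
    case (elim n)
    from real_distribution.quantile_le[OF real_distribution_min_law[OF I(1)] \<alpha>(1) less_imp_le[OF elim]] b(2)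
    show ?case by simp
  qed
qed

end

subsection \<open>Differences and weighted covariances\<close>

text \<open>The contribution of one observation \<open>x\<close> to the difference at
  \<open>j\<close>. As a function of \<open>x\<close> it is the signed binomial coefficient of order
  \<open>x - j\<close>, supported on the integers from \<open>j\<close> to
  \<open>j + k\<close>.\<close>

abbreviation cell :: "nat \<Rightarrow> int \<Rightarrow> int \<Rightarrow> real" where
  "cell k x j \<equiv> nabla k (\<lambda>a. of_bool (x = a)) j"

lemma nabla_0: "nabla 0 q j = q j"
  by (simp add: nabla_def)

lemma nabla_Suc: "nabla (Suc k) q j = nabla k q j - nabla k q (j + 1)"
  by (simp add: nabla_def fwd_diff_def algebra_simps)

lemma nabla_sum: "nabla k (\<lambda>a. \<Sum>x\<in>A. c x * g x a) j = (\<Sum>x\<in>A. c x * nabla k (g x) j)"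
  by (induction k arbitrary: j)
     (simp_all add: nabla_0 nabla_Suc right_diff_distrib sum_subtractf)

lemma cell_before: "x < j \<Longrightarrow> cell k x j = 0"
  by (induction k arbitrary: j) (simp_all add: nabla_0 nabla_Suc)

lemma cell_at: "cell k j j = 1"
  by (induction k) (simp_all add: nabla_0 nabla_Suc cell_before)

text \<open>Together with \<open>cell_at\<close> this provides two distinct values within the
  support of \<open>p\<close>, which excludes zero variance.\<close>

lemma cell_next: "cell k (j + 1) j = - real k"
  by (induction k) (simp_all add: nabla_0 nabla_Suc cell_at)

text \<open>Through this identity the differences and covariances depend on the sample only via
  finitely many empirical frequencies, so that consistency of the frequencies carries over to them
  by continuity.\<close>

lemma sum_sample_eq_weighted:
  assumes "finite S" and "x ` {1..n} \<subseteq> S"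
  shows "(\<Sum>l=1..n. g (x l)) / real n = (\<Sum>y\<in>S. emp_pmf n x y * g y)"
proof -
  have "(\<Sum>y\<in>S. of_bool (x l = y) * g y) = g (x l)" if "l \<in> {1..n}" for l
    using assms that by (simp add: of_bool_def image_subset_iff if_distrib[of "\<lambda>u. u * _"] cong: if_cong)
  then have "(\<Sum>l=1..n. g (x l)) = (\<Sum>l=1..n. \<Sum>y\<in>S. of_bool (x l = y) * g y)"
    by simp
  also have "\<dots> = (\<Sum>y\<in>S. (\<Sum>l=1..n. of_bool (x l = y)) * g y)"
    by (subst sum.swap) (simp add: sum_distrib_right)
  finally show ?thesis by (simp add: emp_pmf_def sum_divide_distrib)
qed

lemma nabla_emp_pmf: "nabla k (emp_pmf n x) j = (\<Sum>l=1..n. cell k (x l) j) / real n"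
proof -
  have "emp_pmf n x = (\<lambda>a. \<Sum>l=1..n. (1 / real n) * of_bool (x l = a))"
    by (intro ext) (simp only: emp_pmf_def sum_divide_distrib times_divide_eq_left mult_1_left)
  then show ?thesis
    using nabla_sum[of k "\<lambda>_. 1 / real n" "\<lambda>l a. of_bool (x l = a)" "{1..n}" j]
    by (simp only: sum_divide_distrib times_divide_eq_left mult_1_left)
qed

definition wmean :: "nat \<Rightarrow> int set \<Rightarrow> (int \<Rightarrow> real) \<Rightarrow> int \<Rightarrow> real" where
  "wmean k S w j = (\<Sum>x\<in>S. w x * cell k x j)"

text \<open>The rows of \<open>root_cov\<close> form a square root of the covariance matrix, so that the Gaussian
  vector is realised as a linear image of white noise depending continuously on the weights.\<close>

definition root_cov :: "nat \<Rightarrow> int set \<Rightarrow> (int \<Rightarrow> real) \<Rightarrow> int \<Rightarrow> int \<Rightarrow> real" where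
  "root_cov k S w j x = sqrt (w x) * (cell k x j - wmean k S w j)"

text \<open>Expanding the centred product produces three mean terms; since the weights have total
  mass 1, they combine to a single subtracted product of means.\<close>

lemma root_cov_product:
  assumes "\<And>x. x \<in> S \<Longrightarrow> w x \<ge> 0" and "(\<Sum>x\<in>S. w x) = 1"
  shows "(\<Sum>x\<in>S. root_cov k S w i x * root_cov k S w j x)
    = (\<Sum>x\<in>S. w x * (cell k x i * cell k x j)) - wmean k S w i * wmean k S w j"
proof -
  have "root_cov k S w i x * root_cov k S w j x
      = w x * (cell k x i * cell k x j) - wmean k S w j * (w x * cell k x i)
        - wmean k S w i * (w x * cell k x j) + wmean k S w i * wmean k S w j * w x" if "x \<in> S" for x
  proof -
    have "root_cov k S w i x * root_cov k S w j x
        = (sqrt (w x) * sqrt (w x)) * ((cell k x i - wmean k S w i) * (cell k x j - wmean k S w j))"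
      unfolding root_cov_def by (simp only: mult_ac)
    also have "sqrt (w x) * sqrt (w x) = w x" using assms(1)[OF that] by simp
    finally have "root_cov k S w i x * root_cov k S w j x
        = w x * ((cell k x i - wmean k S w i) * (cell k x j - wmean k S w j))" .
    then show ?thesis by (simp add: algebra_simps)
  qed
  then have "(\<Sum>x\<in>S. root_cov k S w i x * root_cov k S w j x)
     = (\<Sum>x\<in>S. w x * (cell k x i * cell k x j)) - wmean k S w j * (\<Sum>x\<in>S. w x * cell k x i)
        - wmean k S w i * (\<Sum>x\<in>S. w x * cell k x j) + wmean k S w i * wmean k S w j * (\<Sum>x\<in>S. w x)"
    by (simp add: sum.distrib sum_subtractf sum_distrib_left)
  then show ?thesis using assms(2) by (simp add: wmean_def[symmetric])
qed

lemma emp_pmf_nonneg: "emp_pmf n x a \<ge> 0"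
  by (simp add: emp_pmf_def sum_nonneg)

lemma sum_emp_pmf:
  assumes "finite S" and "x ` {1..n} \<subseteq> S" and "n \<ge> 1"
  shows "(\<Sum>y\<in>S. emp_pmf n x y) = 1"
  using sum_sample_eq_weighted[of S x n "\<lambda>_. 1"] assms by simp

lemma nabla_emp_pmf_wmean:
  assumes "finite S" and "x ` {1..n} \<subseteq> S"
  shows "nabla k (emp_pmf n x) j = wmean k S (emp_pmf n x) j"
  unfolding nabla_emp_pmf wmean_def by (rule sum_sample_eq_weighted[OF assms])

lemma emp_cov_eq:
  assumes "finite S" and "x ` {1..n} \<subseteq> S" and "n \<ge> 1"
  shows "emp_cov k n x i j = (\<Sum>y\<in>S. root_cov k S (emp_pmf n x) i y * root_cov k S (emp_pmf n x) j y)"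
proof -
  have "emp_cov k n x i j = (\<Sum>y\<in>S. emp_pmf n x y * (cell k y i * cell k y j))
      - wmean k S (emp_pmf n x) i * wmean k S (emp_pmf n x) j"
    unfolding emp_cov_def nabla_emp_pmf_wmean[OF assms(1,2)]
    using sum_sample_eq_weighted[OF assms(1,2), where g = "\<lambda>y. cell k y i * cell k y j"] by simp
  then show ?thesis
    by (simp only: root_cov_product[OF emp_pmf_nonneg sum_emp_pmf[OF assms]])
qed

text \<open>Replaces the definite description of the Gaussian law by a concrete law whose
  coefficients are continuous functions of the empirical frequencies.\<close>

lemma crit_val_eq:
  assumes "finite S" and "x ` {1..n} \<subseteq> S" and "n \<ge> 1"
    and "I \<subseteq> {m..M - int k}" and "I \<noteq> {}"
  shows "crit_val k m M \<alpha> n x I = quantile (min_law I S (root_cov k S (emp_pmf n x))) \<alpha>"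
proof -
  let ?J = "{m..M - int k}"
  have "centred_gaussian ?J (emp_cov k n x) = linear_image ?J S (root_cov k S (emp_pmf n x))"
    using emp_cov_eq[OF assms(1-3)] assms(1)
    by (intro centred_gaussian_eqI linear_image_gaussian) auto
  then show ?thesis
    using assms(4,5) by (simp add: crit_val_def min_law_linear_image)
qed

lemma emp_sd_eq:
  assumes "finite S" and "x ` {1..n} \<subseteq> S" and "n \<ge> 1"
  shows "emp_sd k n x j = sqrt (\<Sum>y\<in>S. (root_cov k S (emp_pmf n x) j y)\<^sup>2)"
  by (simp add: emp_sd_def emp_cov_eq[OF assms] power2_eq_square)

lemma tendsto_wmean:
  assumes "\<And>x. x \<in> S \<Longrightarrow> (\<lambda>n. w n x) \<longlonglongrightarrow> v x"
  shows "(\<lambda>n. wmean k S (w n) j) \<longlonglongrightarrow> wmean k S v j"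
  unfolding wmean_def by (intro tendsto_intros assms)

lemma tendsto_root_cov:
  assumes "\<And>x. x \<in> S \<Longrightarrow> (\<lambda>n. w n x) \<longlonglongrightarrow> v x" and "x \<in> S"
  shows "(\<lambda>n. root_cov k S (w n) j x) \<longlonglongrightarrow> root_cov k S v j x"
  unfolding root_cov_def using assms(2) by (intro tendsto_intros tendsto_wmean assms(1))

text \<open>Dominated convergence gives continuity along sequences, while the probability estimates
  need a tolerance for the frequencies. A failing tolerance \<open>1 / Suc n\<close> for every
  \<open>n\<close> would yield a sequence contradicting the assumption.\<close>

lemma sequentially_continuous_delta:
  fixes \<Phi> :: "('x \<Rightarrow> real) \<Rightarrow> real"
  assumes cont: "\<And>w. (\<And>x. x \<in> S \<Longrightarrow> (\<lambda>n. w n x) \<longlonglongrightarrow> v x) \<Longrightarrow> (\<lambda>n. \<Phi> (w n)) \<longlonglongrightarrow> \<Phi> v"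
    and "\<epsilon> > 0"
  shows "\<exists>\<delta>>0. \<forall>w. (\<forall>x\<in>S. \<bar>w x - v x\<bar> < \<delta>) \<longrightarrow> \<bar>\<Phi> w - \<Phi> v\<bar> < \<epsilon>"
proof (rule ccontr)
  assume "\<not> ?thesis"
  then have "\<forall>n::nat. \<exists>w. (\<forall>x\<in>S. \<bar>w x - v x\<bar> < 1 / real (Suc n)) \<and> \<not> \<bar>\<Phi> w - \<Phi> v\<bar> < \<epsilon>"
    by (metis of_nat_0_less_iff zero_less_Suc zero_less_divide_1_iff)
  then obtain w where w: "\<And>n x. x \<in> S \<Longrightarrow> \<bar>w n x - v x\<bar> < 1 / real (Suc n)"
    "\<And>n. \<not> \<bar>\<Phi> (w n) - \<Phi> v\<bar> < \<epsilon>" by metis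
  have "(\<lambda>n. w n x) \<longlonglongrightarrow> v x" if "x \<in> S" for x
  proof (rule LIM_zero_cancel, rule Lim_null_comparison)
    show "\<forall>\<^sub>F n in sequentially. norm (w n x - v x) \<le> 1 / real (Suc n)"
      using w(1)[OF that] by (simp add: less_imp_le)
    show "(\<lambda>n. 1 / real (Suc n)) \<longlonglongrightarrow> 0" by (rule LIMSEQ_Suc[OF lim_1_over_n])
  qed
  then have "(\<lambda>n. \<Phi> (w n)) \<longlonglongrightarrow> \<Phi> v" by (rule cont)
  then have "\<forall>\<^sub>F n in sequentially. \<bar>\<Phi> (w n) - \<Phi> v\<bar> < \<epsilon>"
    using \<open>\<epsilon> > 0\<close> by (auto dest: tendstoD simp: dist_real_def)
  then show False using w(2) by simp
qed

lemma emp_supp_eq: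
  assumes "x ` {1..n} \<subseteq> {m..M}" and "emp_pmf n x m > 0" and "emp_pmf n x M > 0"
  shows "emp_supp k n x = {m..M - int k}"
proof -
  have ex: "a \<in> x ` {1..n}" if pos: "emp_pmf n x a > 0" for a
  proof (rule ccontr)
    assume "a \<notin> x ` {1..n}"
    then have "\<And>l. l \<in> {1..n} \<Longrightarrow> x l \<noteq> a" by auto
    then have "emp_pmf n x a = 0" by (simp add: emp_pmf_def)
    then show False using pos by simp
  qed
  have "Min (x ` {1..n}) = m" "Max (x ` {1..n}) = M"
    using ex[OF assms(2)] ex[OF assms(3)] assms(1) by (auto intro!: Min_eqI Max_eqI simp: image_subset_iff)
  then show ?thesis by (simp add: emp_supp_def)
qed

text \<open>Multiplying by a positive standard deviation turns the quotient form into the product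
  form used for a vanishing one, so later arguments need no case distinction.\<close>

lemma active_set_iff:
  assumes "finite S" and "x ` {1..n} \<subseteq> S" and "n \<ge> 1"
  shows "j \<in> active_set k n x \<longleftrightarrow> j \<in> emp_supp k n x \<and>
    sqrt (real n) * nabla k (emp_pmf n x) j \<le> std_normal_quantile (1 - 1 / real n) * emp_sd k n x j"
proof -
  have "emp_sd k n x j \<ge> 0" unfolding emp_sd_eq[OF assms] by (simp add: sum_nonneg)
  then show ?thesis by (auto simp: active_set_def pos_divide_le_eq)
qed

section \<open>Growth of the normal quantile at level \<open>1 - 1 / n\<close>\<close>

lemma std_normal_quantile_at_top:
  "\<forall>\<^sub>F n in sequentially. K \<le> std_normal_quantile (1 - 1 / real n)"
proof -
  interpret real_distribution std_normal_distribution by (rule real_dist_normal_dist)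
  have "cdf std_normal_distribution K < 1"
  proof -
    have "cdf std_normal_distribution K + prob {K<..<K+1} = prob ({..K} \<union> {K<..<K+1})"
      unfolding cdf_def by (intro finite_measure_Union[symmetric]) auto
    also have "\<dots> \<le> 1" by (rule prob_le_1)
    finally show ?thesis using std_normal_interval_positive[of K "K + 1"] by simp
  qed
  moreover have "(\<lambda>n. 1 - 1 / real n) \<longlonglongrightarrow> 1 - 0" by (intro tendsto_diff tendsto_const lim_1_over_n)
  ultimately have "\<forall>\<^sub>F n in sequentially. cdf std_normal_distribution K < 1 - 1 / real n"
    by (intro order_tendstoD(1)) auto
  then show ?thesis using eventually_gt_at_top[of 0]
  proof eventually_elim
    case (elim n)
    then show ?case unfolding std_normal_quantile_def by (intro quantile_ge) auto
  qed
qed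

text \<open>Chebyshev's inequality with the second moment would only bound the quantile by the square root
  of \<open>n\<close>, which is not small enough; hence the fourth moment.\<close>

lemma std_normal_quantile_small:
  assumes "c > 0"
  shows "\<forall>\<^sub>F n in sequentially. std_normal_quantile (1 - 1 / real n) \<le> c * sqrt (real n)"
proof -
  interpret real_distribution std_normal_distribution by (rule real_dist_normal_dist)
  have tail: "1 - 3 / b ^ 4 \<le> cdf std_normal_distribution b" if "b > 0" for b
  proof -
    have m: "integrable std_normal_distribution (\<lambda>x. (x\<^sup>2)\<^sup>2)" "expectation (\<lambda>x. (x\<^sup>2)\<^sup>2) = 3"
      using std_normal_distribution_even_moments[of 2] by (simp_all add: fact_numeral flip: power_mult)
    have "prob {x \<in> space std_normal_distribution. \<bar>x\<^sup>2\<bar> \<ge> b\<^sup>2} \<le> expectation (\<lambda>x. (x\<^sup>2)\<^sup>2) / (b\<^sup>2)\<^sup>2"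
      by (rule second_moment_method) (use m that in auto)
    then have le: "prob {x \<in> space std_normal_distribution. \<bar>x\<^sup>2\<bar> \<ge> b\<^sup>2} \<le> 3 / b ^ 4"
      using m(2) by (simp flip: power_mult)
    have "prob (UNIV - {..b}) \<le> prob {x \<in> space std_normal_distribution. \<bar>x\<^sup>2\<bar> \<ge> b\<^sup>2}"
    proof (rule finite_measure_mono)
      show "UNIV - {..b} \<subseteq> {x \<in> space std_normal_distribution. \<bar>x\<^sup>2\<bar> \<ge> b\<^sup>2}"
        using that by (auto intro!: power_mono)
    qed simp
    moreover have "prob (UNIV - {..b}) = 1 - cdf std_normal_distribution b"
      unfolding cdf_def using prob_compl[of "{..b}"] by simp
    ultimately show ?thesis using le by simp
  qed
  \<comment> \<open>For \<open>b = c * sqrt n\<close> the tail bound \<open>3 / b ^ 4\<close> is at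
    most \<open>1 / n\<close> exactly when \<open>n\<close> is at least
    \<open>3 / c ^ 4\<close>.\<close>
  have "\<forall>\<^sub>F n in sequentially. 3 / c ^ 4 \<le> real n"
    by (rule eventually_compose_filterlim[OF eventually_ge_at_top filterlim_real_sequentially])
  \<comment> \<open>\<open>n = 1\<close> is excluded because the level would be 0, while
    \<open>quantile_le\<close> needs a positive level.\<close>
  then show ?thesis using eventually_gt_at_top[of 1]
  proof eventually_elim
    case (elim n)
    have "(c * sqrt (real n)) ^ 4 = c ^ 4 * (real n * real n)"
    proof -
      have "sqrt (real n) ^ 4 = real n * real n" by (simp add: power4_eq_xxxx mult.assoc)
      then show ?thesis by (simp add: power_mult_distrib)
    qed
    moreover have "3 / (c ^ 4 * (real n * real n)) \<le> 1 / real n"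
      using elim assms by (simp add: field_simps)
    ultimately have "1 - 1 / real n \<le> cdf std_normal_distribution (c * sqrt (real n))"
      using tail[of "c * sqrt (real n)"] elim assms by simp
    then show ?case unfolding std_normal_quantile_def using elim
      by (intro quantile_le) auto
  qed
qed

subsection \<open>The central limit theorem for the sample\<close>

text \<open>Observations are numbered from 1, whereas the central limit theorem sums over
  \<open>i < n\<close>.\<close>

lemma (in prob_space) indep_vars_shift:
  assumes "indep_vars (\<lambda>_. N) X {1..}"
  shows "indep_vars (\<lambda>_. N) (\<lambda>i. X (Suc i)) UNIV"
  unfolding indep_vars_def
proof (intro conjI ballI indep_setsI)
  have rv: "X l \<in> measurable M N" if "l \<ge> 1" for l
    using assms that unfolding indep_vars_def by auto
  then show "random_variable N (X (Suc i))" for i by simp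
  have sub: "sigma_sets (space M) {X l -` A \<inter> space M |A. A \<in> sets N} \<subseteq> events" if "l \<ge> 1" for l
    using rv[OF that] by (intro sets.sigma_sets_subset) (auto intro: measurable_sets)
  then show "sigma_sets (space M) {X (Suc i) -` A \<inter> space M |A. A \<in> sets N} \<subseteq> events" for i by simp
  fix A J assume J: "J \<noteq> {}" "J \<subseteq> UNIV" "finite J"
    and A: "\<forall>j\<in>J. A j \<in> sigma_sets (space M) {X (Suc j) -` A \<inter> space M |A. A \<in> sets N}"
  have "indep_sets (\<lambda>i. sigma_sets (space M) {X i -` A \<inter> space M |A. A \<in> sets N}) {1..}"
    using assms by (simp add: indep_vars_def)
  then have "prob (\<Inter>j\<in>Suc ` J. A (j - 1)) = (\<Prod>j\<in>Suc ` J. prob (A (j - 1)))"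
    by (rule indep_setsD) (use J A in auto)
  then show "prob (\<Inter>j\<in>J. A j) = (\<Prod>j\<in>J. prob (A j))"
    by (simp add: prod.reindex)
qed

lemma exp_gt_self: "x < exp (x::real)"
  using exp_ge_add_one_self[of x] by linarith

locale iid_sample = prob_space \<Omega> for \<Omega> :: "'a measure" +
  fixes X :: "nat \<Rightarrow> 'a \<Rightarrow> int" and p :: "int pmf" and k :: nat and m M :: int
  assumes k: "k \<ge> 1" and m_le: "m \<le> M - int k"
    and supp: "set_pmf p = {m..M}"
    and indep: "indep_vars (\<lambda>_. count_space UNIV) X {1..}"
    and distr_X: "\<And>i. i \<ge> 1 \<Longrightarrow> distr \<Omega> (count_space UNIV) (X i) = measure_pmf p"
begin

abbreviation "S \<equiv> {m..M}"
abbreviation "J \<equiv> {m..M - int k}"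

definition mean :: "(int \<Rightarrow> real) \<Rightarrow> real" where
  "mean g = (\<Sum>x\<in>S. pmf p x * g x)"

definition dev :: "nat \<Rightarrow> (int \<Rightarrow> real) \<Rightarrow> 'a \<Rightarrow> real" where
  "dev n g \<omega> = (\<Sum>l=1..n. g (X l \<omega>) - mean g) / sqrt (real n)"

lemma measurable_X [measurable]: "l \<ge> 1 \<Longrightarrow> X l \<in> measurable \<Omega> (count_space UNIV)"
  using indep unfolding indep_vars_def by auto

lemma measurable_gX [measurable]: "l \<ge> 1 \<Longrightarrow> (\<lambda>\<omega>. g (X l \<omega>)) \<in> borel_measurable \<Omega>"
  by (rule measurable_compose[OF measurable_X]) auto

lemma measurable_dev [measurable]: "dev n g \<in> borel_measurable \<Omega>"
  unfolding dev_def[abs_def] by (intro borel_measurable_divide borel_measurable_sum borel_measurable_diff) auto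

lemma sum_pmf: "(\<Sum>x\<in>S. pmf p x) = 1"
  by (rule sum_pmf_eq_1) (auto simp: supp)

lemma pmf_pos: "x \<in> S \<Longrightarrow> pmf p x > 0"
  using supp by (simp add: pmf_positive)

lemma expectation_gX:
  fixes g :: "int \<Rightarrow> real"
  assumes "l \<ge> 1" shows "expectation (\<lambda>\<omega>. g (X l \<omega>)) = mean g"
proof -
  have "expectation (\<lambda>\<omega>. g (X l \<omega>)) = (\<integral>x. g x \<partial>distr \<Omega> (count_space UNIV) (X l))"
    using assms by (subst integral_distr) auto
  also have "\<dots> = (\<Sum>x\<in>S. g x * pmf p x)"
    unfolding distr_X[OF assms] by (rule integral_measure_pmf_real) (auto simp: supp)
  finally show ?thesis by (simp add: mean_def mult.commute)
qed

lemma AE_X: "l \<ge> 1 \<Longrightarrow> AE \<omega> in \<Omega>. X l \<omega> \<in> S"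
proof -
  assume l: "l \<ge> 1"
  have "AE x in distr \<Omega> (count_space UNIV) (X l). x \<in> S"
    unfolding distr_X[OF l] supp[symmetric] by (rule AE_measure_pmf)
  then show ?thesis using l by (subst (asm) AE_distr_iff) auto
qed

lemma AE_sample: "AE \<omega> in \<Omega>. \<forall>l\<in>{1..n}. X l \<omega> \<in> S"
  by (rule AE_finite_allI) (use AE_X in auto)

lemma AE_gX_bounded:
  fixes g :: "int \<Rightarrow> real"
  assumes "l \<ge> 1"
  shows "AE \<omega> in \<Omega>. \<bar>g (X l \<omega>)\<bar> \<le> 1 + (\<Sum>x\<in>S. \<bar>g x\<bar>)"
proof -
  from AE_X[OF assms] show ?thesis
  proof eventually_elim
    case (elim \<omega>)
    then have "\<bar>g (X l \<omega>)\<bar> \<le> (\<Sum>x\<in>S. \<bar>g x\<bar>)" by (intro member_le_sum[where f = "\<lambda>x. \<bar>g x\<bar>"]) auto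
    then show ?case by simp
  qed
qed

text \<open>Hoeffding's inequality applies because the support is finite, and the scaling by
  \<open>sqrt n\<close> cancels \<open>n\<close> from the exponent. The bound serves for tightness
  and, with growing thresholds, for consistency.\<close>

lemma dev_tail:
  assumes "\<epsilon> > 0"
  shows "\<exists>L>0. \<forall>n\<ge>1. prob {\<omega> \<in> space \<Omega>. \<bar>dev n g \<omega>\<bar> \<ge> L} < \<epsilon>"
proof -
  \<comment> \<open>The summand 1 keeps the total range positive, as Hoeffding's inequality demands,
    even when \<open>g\<close> vanishes on the support.\<close>
  define B where "B = 1 + (\<Sum>x\<in>S. \<bar>g x\<bar>)"
  have "B > 0" by (simp add: B_def sum_nonneg add_pos_nonneg)
  \<comment> \<open>Chosen so that the Hoeffding exponent is \<open>- (2 / \<epsilon>)\<close>; then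
    \<open>x < exp x\<close> at \<open>x = 2 / \<epsilon>\<close> gives
    \<open>2 * exp (- (2 / \<epsilon>)) < \<epsilon>\<close>.\<close>
  define L where "L = B * sqrt (2 * (2 / \<epsilon>))"
  have "L > 0" using \<open>B > 0\<close> assms by (simp add: L_def)
  have "L\<^sup>2 / (2 * B\<^sup>2) = 2 / \<epsilon>"
    using \<open>B > 0\<close> assms by (simp add: L_def power_mult_distrib)
  moreover have "2 * exp (- (2 / \<epsilon>)) < \<epsilon>"
    using exp_gt_self[of "2 / \<epsilon>"] assms by (simp add: exp_minus field_simps)
  ultimately have L: "2 * exp (- (L\<^sup>2 / (2 * B\<^sup>2))) < \<epsilon>" "L > 0" using \<open>L > 0\<close> by simp_all
  have "prob {\<omega> \<in> space \<Omega>. \<bar>dev n g \<omega>\<bar> \<ge> L} < \<epsilon>" if n: "n \<ge> 1" for n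
  proof -
    interpret H: Hoeffding_ineq \<Omega> "{1..n}" "\<lambda>l \<omega>. g (X l \<omega>)" "\<lambda>_. - B" "\<lambda>_. B" "real n * mean g"
    proof unfold_locales
      show "indep_vars (\<lambda>_. borel) (\<lambda>l \<omega>. g (X l \<omega>)) {1..n}"
        by (rule indep_vars_compose2[OF indep_vars_subset[OF indep]]) auto
      show "AE \<omega> in \<Omega>. g (X i \<omega>) \<in> {- B..B}" if "i \<in> {1..n}" for i
        using that by (intro eventually_mono[OF AE_gX_bounded[of i g]]) (auto simp: B_def abs_le_iff)
      show "real n * mean g \<equiv> \<Sum>i\<in>{1..n}. expectation (\<lambda>\<omega>. g (X i \<omega>))"
        by (rule eq_reflection) (simp add: expectation_gX)
    qed simp
    have pos: "(\<Sum>i\<in>{1..n}. (B - (- B))\<^sup>2) > 0" using \<open>B > 0\<close> n by simp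
    have "{\<omega> \<in> space \<Omega>. \<bar>dev n g \<omega>\<bar> \<ge> L}
      = {\<omega> \<in> space \<Omega>. \<bar>(\<Sum>l\<in>{1..n}. g (X l \<omega>)) - real n * mean g\<bar> \<ge> L * sqrt (real n)}"
      using n by (auto simp: dev_def sum_subtractf pos_le_divide_eq)
    also have "prob \<dots> \<le> 2 * exp (-2 * (L * sqrt (real n))\<^sup>2 / (\<Sum>i\<in>{1..n}. (B - (- B))\<^sup>2))"
      by (rule H.Hoeffding_ineq_abs_ge[OF _ pos]) (use L in simp)
    also have "-2 * (L * sqrt (real n))\<^sup>2 / (\<Sum>i\<in>{1..n}. (B - (- B))\<^sup>2) = - (L\<^sup>2 / (2 * B\<^sup>2))"
      using n \<open>B > 0\<close> by (simp add: power_mult_distrib field_simps)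
    finally show ?thesis using L by simp
  qed
  with L(2) show ?thesis by blast
qed

text \<open>If \<open>v g = 0\<close>, then \<open>g\<close> is constant on the support and the
  deviation vanishes almost surely. Otherwise the central limit theorem is applied to the
  standardised sums, and evaluating the characteristic function at \<open>\<sigma>\<close> instead
  of 1 undoes the standardisation.\<close>

lemma dev_char:
  defines "v g \<equiv> (\<Sum>x\<in>S. pmf p x * (g x - mean g)\<^sup>2)"
  shows "(\<lambda>n. \<integral>\<omega>. iexp (dev n g \<omega>) \<partial>\<Omega>) \<longlonglongrightarrow> complex_of_real (exp (- v g / 2))"
proof (cases "v g = 0")
  case True
  have "dev n g \<omega> = 0" if "\<And>l. l \<in> {1..n} \<Longrightarrow> X l \<omega> \<in> S" for n \<omega>
  proof -
    have "\<forall>x\<in>S. pmf p x * (g x - mean g)\<^sup>2 = 0"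
      using True unfolding v_def by (subst (asm) sum_nonneg_eq_0_iff) auto
    then have "g x = mean g" if "x \<in> S" for x using that pmf_pos[OF that]
      by (metis less_irrefl mult_eq_0_iff power_eq_0_iff right_minus_eq)
    then show ?thesis using that by (simp add: dev_def)
  qed
  then have dev0: "AE \<omega> in \<Omega>. dev n g \<omega> = 0" for n
    using AE_sample[of n] by (auto elim!: eventually_mono)
  have "(\<integral>\<omega>. iexp (dev n g \<omega>) \<partial>\<Omega>) = (\<integral>\<omega>. 1 \<partial>\<Omega>)" for n
  proof (rule integral_cong_AE)
    show "AE \<omega> in \<Omega>. iexp (dev n g \<omega>) = 1" using dev0[of n] by (rule eventually_mono) simp
  qed measurable
  then show ?thesis using True by (simp add: prob_space)
next
  case False
  have "v g \<ge> 0" unfolding v_def by (simp add: sum_nonneg)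
  define \<sigma> where "\<sigma> = sqrt (v g)"
  have \<sigma>: "\<sigma> > 0" "\<sigma>\<^sup>2 = v g" using False \<open>v g \<ge> 0\<close> by (auto simp: \<sigma>_def)
  define Y where "Y i \<omega> = g (X (Suc i) \<omega>) - mean g" for i \<omega>
  have E0: "expectation (Y i) = 0" for i
  proof -
    have "expectation (Y i) = mean (\<lambda>x. g x - mean g)"
      unfolding Y_def[abs_def] by (rule expectation_gX) simp
    also have "\<dots> = 0"
      using sum_pmf by (simp add: mean_def right_diff_distrib sum_subtractf sum_distrib_right[symmetric])
    finally show ?thesis .
  qed
  have weak: "weak_conv_m (\<lambda>n. distr \<Omega> borel (\<lambda>\<omega>. (\<Sum>i<n. Y i \<omega>) / sqrt (real n * \<sigma>\<^sup>2))) std_normal_distribution"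
  proof (rule central_limit_theorem_zero_mean[OF _ E0 \<sigma>(1)])
    show "indep_vars (\<lambda>_. borel) Y UNIV"
      unfolding Y_def[abs_def] by (rule indep_vars_compose2[OF indep_vars_shift[OF indep]]) auto
    show "integrable \<Omega> (\<lambda>\<omega>. (Y i \<omega>)\<^sup>2)" for i
    proof (rule integrable_const_bound)
      show "AE \<omega> in \<Omega>. norm ((Y i \<omega>)\<^sup>2) \<le> 1 + (\<Sum>x\<in>S. \<bar>(g x - mean g)\<^sup>2\<bar>)"
        using AE_gX_bounded[of "Suc i" "\<lambda>x. (g x - mean g)\<^sup>2"] by (simp add: Y_def)
      show "(\<lambda>\<omega>. (Y i \<omega>)\<^sup>2) \<in> borel_measurable \<Omega>"
        unfolding Y_def using measurable_gX[of "Suc i" "\<lambda>x. (g x - mean g)\<^sup>2"] by simp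
    qed
    show "variance (Y i) = \<sigma>\<^sup>2" for i
      using expectation_gX[of "Suc i" "\<lambda>x. (g x - mean g)\<^sup>2"]
      by (simp add: E0 \<sigma> v_def mean_def Y_def)
    show "distr \<Omega> borel (Y i) = distr (measure_pmf p) borel (\<lambda>x. g x - mean g)" for i
      unfolding distr_X[of "Suc i", simplified, symmetric]
      by (subst distr_distr) (auto simp: comp_def Y_def[abs_def])
  qed
  have [measurable]: "Y i \<in> borel_measurable \<Omega>" for i
    unfolding Y_def[abs_def] using measurable_gX[of "Suc i" "\<lambda>x. g x - mean g"] by simp
  have "(\<lambda>n. char (distr \<Omega> borel (\<lambda>\<omega>. (\<Sum>i<n. Y i \<omega>) / sqrt (real n * \<sigma>\<^sup>2))) \<sigma>) \<longlonglongrightarrow> char std_normal_distribution \<sigma>"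
    by (rule levy_continuity1[OF _ real_dist_normal_dist weak]) (rule real_distribution_distr, measurable)
  moreover have "char (distr \<Omega> borel (\<lambda>\<omega>. (\<Sum>i<n. Y i \<omega>) / sqrt (real n * \<sigma>\<^sup>2))) \<sigma> = (\<integral>\<omega>. iexp (dev n g \<omega>) \<partial>\<Omega>)" for n
  proof -
    have "dev n g \<omega> = (\<Sum>i<n. Y i \<omega>) / sqrt (real n)" for \<omega>
      unfolding dev_def Y_def by (simp add: sum.atLeast1_atMost_eq)
    then have *: "\<sigma> * ((\<Sum>i<n. Y i \<omega>) / sqrt (real n * \<sigma>\<^sup>2)) = dev n g \<omega>" for \<omega>
      using \<sigma>(1) by (simp add: real_sqrt_mult)
    have "char (distr \<Omega> borel (\<lambda>\<omega>. (\<Sum>i<n. Y i \<omega>) / sqrt (real n * \<sigma>\<^sup>2))) \<sigma>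
      = (\<integral>\<omega>. iexp (\<sigma> * ((\<Sum>i<n. Y i \<omega>) / sqrt (real n * \<sigma>\<^sup>2))) \<partial>\<Omega>)"
      unfolding char_def by (rule integral_distr) measurable
    then show ?thesis by (simp only: *)
  qed
  ultimately show ?thesis by (simp add: char_std_normal_distribution \<sigma>)
qed

section \<open>Joint limit law of the scaled differences\<close>

lemma mean_sum: "mean (\<lambda>x. \<Sum>j\<in>A. t j * g j x) = (\<Sum>j\<in>A. t j * mean (g j))"
proof -
  have "mean (\<lambda>x. \<Sum>j\<in>A. t j * g j x) = (\<Sum>x\<in>S. \<Sum>j\<in>A. t j * (pmf p x * g j x))"
    by (simp add: mean_def sum_distrib_left mult_ac)
  also have "\<dots> = (\<Sum>j\<in>A. t j * mean (g j))"
    by (subst sum.swap) (simp add: mean_def sum_distrib_left)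
  finally show ?thesis .
qed

lemma dev_sum: "dev n (\<lambda>x. \<Sum>j\<in>A. t j * g j x) \<omega> = (\<Sum>j\<in>A. t j * dev n (g j) \<omega>)"
proof -
  have "(\<Sum>l=1..n. (\<Sum>j\<in>A. t j * g j (X l \<omega>)) - (\<Sum>j\<in>A. t j * mean (g j)))
    = (\<Sum>l=1..n. \<Sum>j\<in>A. t j * (g j (X l \<omega>) - mean (g j)))"
    by (simp add: right_diff_distrib sum_subtractf)
  also have "\<dots> = (\<Sum>j\<in>A. t j * (\<Sum>l=1..n. g j (X l \<omega>) - mean (g j)))"
    by (subst sum.swap) (simp only: sum_distrib_left)
  finally show ?thesis
    unfolding dev_def mean_sum by (simp only: sum_divide_distrib[where A = A] times_divide_eq_right)
qed

abbreviation "sqrt_cov \<equiv> root_cov k S (pmf p)"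

lemma mean_cell: "mean (\<lambda>x. cell k x j) = wmean k S (pmf p) j"
  by (simp add: mean_def wmean_def)

text \<open>Matches the variance from the scalar limit theorem with the quadratic form of the
  limiting covariance.\<close>

lemma variance_combination:
  "(\<Sum>x\<in>S. pmf p x * ((\<Sum>j\<in>A. t j * cell k x j) - mean (\<lambda>x. \<Sum>j\<in>A. t j * cell k x j))\<^sup>2)
    = (\<Sum>i\<in>A. \<Sum>j\<in>A. t i * t j * (\<Sum>x\<in>S. sqrt_cov i x * sqrt_cov j x))"
proof -
  have "pmf p x * ((\<Sum>j\<in>A. t j * cell k x j) - mean (\<lambda>x. \<Sum>j\<in>A. t j * cell k x j))\<^sup>2
      = (\<Sum>i\<in>A. \<Sum>j\<in>A. t i * t j * (sqrt_cov i x * sqrt_cov j x))" for x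
  proof -
    have "(\<Sum>j\<in>A. t j * cell k x j) - mean (\<lambda>x. \<Sum>j\<in>A. t j * cell k x j) = (\<Sum>j\<in>A. t j * (cell k x j - wmean k S (pmf p) j))"
      unfolding mean_sum mean_cell by (simp add: right_diff_distrib sum_subtractf)
    then have "pmf p x * ((\<Sum>j\<in>A. t j * cell k x j) - mean (\<lambda>x. \<Sum>j\<in>A. t j * cell k x j))\<^sup>2
      = (sqrt (pmf p x) * (\<Sum>j\<in>A. t j * (cell k x j - wmean k S (pmf p) j)))\<^sup>2"
      by (simp add: power_mult_distrib)
    also have "sqrt (pmf p x) * (\<Sum>j\<in>A. t j * (cell k x j - wmean k S (pmf p) j)) = (\<Sum>j\<in>A. t j * sqrt_cov j x)"
      by (simp add: root_cov_def sum_distrib_left mult_ac)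
    finally show ?thesis by (simp add: power2_eq_square sum_product mult_ac)
  qed
  then have "(\<Sum>x\<in>S. pmf p x * ((\<Sum>j\<in>A. t j * cell k x j) - mean (\<lambda>x. \<Sum>j\<in>A. t j * cell k x j))\<^sup>2)
    = (\<Sum>x\<in>S. \<Sum>i\<in>A. \<Sum>j\<in>A. t i * t j * (sqrt_cov i x * sqrt_cov j x))" by simp
  also have "\<dots> = (\<Sum>i\<in>A. \<Sum>x\<in>S. \<Sum>j\<in>A. t i * t j * (sqrt_cov i x * sqrt_cov j x))"
    by (rule sum.swap)
  also have "\<dots> = (\<Sum>i\<in>A. \<Sum>j\<in>A. \<Sum>x\<in>S. t i * t j * (sqrt_cov i x * sqrt_cov j x))"
    by (intro sum.cong refl sum.swap)
  finally show ?thesis by (simp add: sum_distrib_left)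
qed

definition dev_law :: "nat \<Rightarrow> (int \<Rightarrow> real) measure" where
  "dev_law n = distr \<Omega> (\<Pi>\<^sub>M j\<in>J. borel) (\<lambda>\<omega>. \<lambda>j\<in>J. dev n (\<lambda>x. cell k x j) \<omega>)"

lemma measurable_dev_vector [measurable]:
  "(\<lambda>\<omega>. \<lambda>j\<in>J. dev n (\<lambda>x. cell k x j) \<omega>) \<in> measurable \<Omega> (\<Pi>\<^sub>M j\<in>J. borel)"
  by (intro measurable_restrict measurable_dev)

text \<open>Since \<open>dev\<close> is linear in its function argument, a combination of
  coordinates is the deviation of one function, to which \<open>dev_char\<close> applies. Tightness
  is \<open>dev_tail\<close>.\<close>

sublocale clt: cramer_wold J dev_law "linear_image J S sqrt_cov"
proof (rule cramer_wold.intro)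
  have gauss: "is_centred_gaussian J (\<lambda>i j. \<Sum>x\<in>S. sqrt_cov i x * sqrt_cov j x) (linear_image J S sqrt_cov)"
    by (rule linear_image_gaussian) auto
  then show "prob_space (linear_image J S sqrt_cov)" "sets (linear_image J S sqrt_cov) = sets (\<Pi>\<^sub>M j\<in>J. borel)"
    by (auto simp: is_centred_gaussian_def)
  show "prob_space (dev_law n)" for n unfolding dev_law_def by (rule prob_space_distr) measurable
  show "sets (dev_law n) = sets (\<Pi>\<^sub>M j\<in>J. borel)" for n by (simp add: dev_law_def)
  show "(\<lambda>n. \<integral>z. iexp (\<Sum>j\<in>J. t j * z j) \<partial>dev_law n) \<longlonglongrightarrow> (\<integral>z. iexp (\<Sum>j\<in>J. t j * z j) \<partial>linear_image J S sqrt_cov)" for t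
  proof -
    have "(\<integral>z. iexp (\<Sum>j\<in>J. t j * z j) \<partial>dev_law n) = (\<integral>\<omega>. iexp (dev n (\<lambda>x. \<Sum>j\<in>J. t j * cell k x j) \<omega>) \<partial>\<Omega>)" for n
    proof -
      have "(\<integral>z. iexp (\<Sum>j\<in>J. t j * z j) \<partial>dev_law n)
        = (\<integral>\<omega>. iexp (\<Sum>j\<in>J. t j * (\<lambda>j\<in>J. dev n (\<lambda>x. cell k x j) \<omega>) j) \<partial>\<Omega>)"
        unfolding dev_law_def by (rule integral_distr) measurable
      also have "(\<lambda>\<omega>. \<Sum>j\<in>J. t j * (\<lambda>j\<in>J. dev n (\<lambda>x. cell k x j) \<omega>) j) = (\<lambda>\<omega>. dev n (\<lambda>x. \<Sum>j\<in>J. t j * cell k x j) \<omega>)"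
        by (simp add: dev_sum)
      finally show ?thesis .
    qed
    then show ?thesis
      using dev_char[of "\<lambda>x. \<Sum>j\<in>J. t j * cell k x j"]
      by (simp only: is_centred_gaussian_char[OF finite_atLeastAtMost_int gauss] variance_combination)
  qed
  show "\<exists>L>0. \<forall>\<^sub>F n in sequentially. measure (dev_law n) {z \<in> space (dev_law n). \<bar>z j\<bar> > L} < \<epsilon>"
    if j: "j \<in> J" and "\<epsilon> > 0" for j \<epsilon>
  proof -
    obtain L where L: "L > 0" "\<And>n. n \<ge> 1 \<Longrightarrow> prob {\<omega> \<in> space \<Omega>. \<bar>dev n (\<lambda>x. cell k x j) \<omega>\<bar> \<ge> L} < \<epsilon>"
      using dev_tail[OF \<open>\<epsilon> > 0\<close>] by blast
    have "measure (dev_law n) {z \<in> space (dev_law n). \<bar>z j\<bar> > L} < \<epsilon>" if "n \<ge> 1" for n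
    proof -
      have "measure (dev_law n) {z \<in> space (dev_law n). \<bar>z j\<bar> > L} = prob {\<omega> \<in> space \<Omega>. \<bar>dev n (\<lambda>x. cell k x j) \<omega>\<bar> > L}"
        unfolding dev_law_def
        by (subst measure_distr) (use j in \<open>auto intro!: arg_cong[where f = prob] simp: space_PiM\<close>)
      also have "\<dots> \<le> prob {\<omega> \<in> space \<Omega>. \<bar>dev n (\<lambda>x. cell k x j) \<omega>\<bar> \<ge> L}"
        by (intro finite_measure_mono) auto
      finally show ?thesis using L(2)[OF that] by simp
    qed
    then show ?thesis using L(1) by (auto simp: eventually_sequentially)
  qed
qed simp

text \<open>A vanishing row would make the contributions of the observations \<open>j\<close> and
  \<open>j + 1\<close> equal to their common mean, but these are \<open>1\<close> and
  \<open>- real k\<close>. Both points carry mass, the second one because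
  \<open>k \<ge> 1\<close>.\<close>

lemma root_nondegenerate:
  assumes "j \<in> J"
  shows "(\<Sum>x\<in>S. (sqrt_cov j x)\<^sup>2) > 0"
proof -
  have in_S: "j \<in> S" "j + 1 \<in> S" using assms k by auto
  have "\<exists>x\<in>S. sqrt_cov j x \<noteq> 0"
  proof (rule ccontr)
    assume "\<not> ?thesis"
    then have "sqrt_cov j j = 0" "sqrt_cov j (j + 1) = 0" using in_S by blast+
    then have "1 = wmean k S (pmf p) j" "- real k = wmean k S (pmf p) j"
      using pmf_pos[OF in_S(1)] pmf_pos[OF in_S(2)] by (auto simp: root_cov_def cell_at cell_next)
    then show False by linarith
  qed
  then obtain x where x: "x \<in> S" "sqrt_cov j x \<noteq> 0" by blast
  have "0 < (sqrt_cov j x)\<^sup>2" using x by simp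
  also have "\<dots> \<le> (\<Sum>x\<in>S. (sqrt_cov j x)\<^sup>2)" by (rule member_le_sum[OF x(1)]) auto
  finally show ?thesis .
qed

text \<open>A minimum exceeds \<open>t\<close> exactly when all coordinates do. The null condition
  on the hyperplanes is \<open>min_law_no_atom\<close> for the one-element index set
  \<open>{j}\<close>.\<close>

lemma dev_orthant_tendsto:
  assumes "I \<subseteq> J" and "I \<noteq> {}"
  shows "(\<lambda>n. prob {\<omega> \<in> space \<Omega>. \<forall>j\<in>I. t < dev n (\<lambda>x. cell k x j) \<omega>})
    \<longlonglongrightarrow> 1 - cdf (min_law I S sqrt_cov) t"
proof -
  have finI: "finite I" using assms(1) finite_subset by blast
  interpret W: prob_space "white_noise S" by (rule prob_space_white_noise)
  have Q0: "measure (linear_image J S sqrt_cov) {z \<in> space (linear_image J S sqrt_cov). z j = t} = 0" if "j \<in> I" for j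
  proof -
    have j: "j \<in> J" using that assms(1) by blast
    have "measure (linear_image J S sqrt_cov) {z \<in> space (linear_image J S sqrt_cov). z j = t}
      = measure (white_noise S) {w \<in> space (white_noise S). min_form {j} S sqrt_cov w = t}"
      unfolding linear_image_def
      by (subst measure_distr) (use j in \<open>auto intro!: arg_cong[where f = "measure _"] simp: space_PiM min_form_def\<close>)
    also have "\<dots> = 0" by (rule min_law_no_atom) (use root_nondegenerate[OF j] in auto)
    finally show ?thesis .
  qed
  have sp: "{z \<in> space (\<Pi>\<^sub>M j\<in>J. borel). \<forall>j\<in>I. t < z j} \<in> sets (\<Pi>\<^sub>M j\<in>J. borel :: real measure)"
    by (rule sets_orthant(1)[OF refl finI assms(1)])
  have "measure (dev_law n) {z \<in> space (dev_law n). \<forall>j\<in>I. t < z j}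
      = prob {\<omega> \<in> space \<Omega>. \<forall>j\<in>I. t < dev n (\<lambda>x. cell k x j) \<omega>}" for n
    unfolding dev_law_def space_distr
    by (subst measure_distr[OF measurable_dev_vector sp])
      (use assms(1) in \<open>auto intro!: arg_cong[where f = prob] simp: space_PiM\<close>)
  moreover have "measure (linear_image J S sqrt_cov) {z \<in> space (linear_image J S sqrt_cov). \<forall>j\<in>I. t < z j}
      = 1 - cdf (min_law I S sqrt_cov) t"
  proof -
    have "measure (linear_image J S sqrt_cov) {z \<in> space (linear_image J S sqrt_cov). \<forall>j\<in>I. t < z j}
      = measure (white_noise S) {w \<in> space (white_noise S). \<not> min_form I S sqrt_cov w \<le> t}"
      unfolding linear_image_def space_distr
      by (subst measure_distr[OF measurable_linear_map sp])
        (use assms finI in \<open>auto intro!: arg_cong[where f = "measure _"] simp: space_PiM min_form_def not_le\<close>)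
    also have "\<dots> = 1 - measure (white_noise S) {w \<in> space (white_noise S). min_form I S sqrt_cov w \<le> t}"
      by (rule W.prob_neg) (use measurable_min_form[OF finI] in measurable)
    finally show ?thesis by (simp add: cdf_min_law[OF finI])
  qed
  ultimately show ?thesis
    using clt.orthant_tendsto[OF assms(1) Q0] by simp
qed

end

subsection \<open>Events of probability tending to one\<close>

lemma scaled_deviation:
  assumes "n \<ge> (1::nat)"
  shows "(a - real n * b) / sqrt (real n) = sqrt (real n) * (a / real n - b)"
proof -
  define s where "s = sqrt (real n)"
  have "real n = s * s" "s > 0" using assms by (simp_all add: s_def)
  then show ?thesis unfolding s_def[symmetric] by (simp add: field_simps)
qed

context iid_sample
begin

text \<open>Asking for measurable inner events \<open>A n\<close> spares the measurability of \<open>Q n\<close>.\<close>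

definition whp :: "(nat \<Rightarrow> 'a \<Rightarrow> bool) \<Rightarrow> bool" where
  "whp Q \<longleftrightarrow> (\<exists>A. (\<forall>n. A n \<in> events) \<and> (\<lambda>n. prob (A n)) \<longlonglongrightarrow> 1 \<and>
     (\<forall>\<^sub>F n in sequentially. \<forall>\<omega>\<in>A n. Q n \<omega>))"

lemma whp_mono:
  assumes "whp Q" and "\<forall>\<^sub>F n in sequentially. \<forall>\<omega>\<in>space \<Omega>. Q n \<omega> \<longrightarrow> R n \<omega>"
  shows "whp R"
proof -
  obtain A where A: "\<forall>n. A n \<in> events" "(\<lambda>n. prob (A n)) \<longlonglongrightarrow> 1" "\<forall>\<^sub>F n in sequentially. \<forall>\<omega>\<in>A n. Q n \<omega>"
    using assms(1) by (auto simp: whp_def)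
  have "\<forall>\<^sub>F n in sequentially. \<forall>\<omega>\<in>A n. R n \<omega>"
    using A(3) assms(2)
  proof eventually_elim
    case (elim n)
    have "A n \<subseteq> space \<Omega>" using A(1) sets.sets_into_space by blast
    with elim show ?case by blast
  qed
  with A show ?thesis by (auto simp: whp_def)
qed

lemma whp_eventually: "\<forall>\<^sub>F n in sequentially. P n \<Longrightarrow> whp (\<lambda>n _. P n)"
  unfolding whp_def by (intro exI[of _ "\<lambda>_. space \<Omega>"]) (auto simp: prob_space elim: eventually_mono)

lemma whp_conj:
  assumes "whp Q" and "whp R"
  shows "whp (\<lambda>n \<omega>. Q n \<omega> \<and> R n \<omega>)"
proof -
  obtain A where A: "\<And>n. A n \<in> events" "(\<lambda>n. prob (A n)) \<longlonglongrightarrow> 1" "\<forall>\<^sub>F n in sequentially. \<forall>\<omega>\<in>A n. Q n \<omega>"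
    using assms(1) by (auto simp: whp_def)
  obtain B where B: "\<And>n. B n \<in> events" "(\<lambda>n. prob (B n)) \<longlonglongrightarrow> 1" "\<forall>\<^sub>F n in sequentially. \<forall>\<omega>\<in>B n. R n \<omega>"
    using assms(2) by (auto simp: whp_def)
  have "(\<lambda>n. prob (A n \<inter> B n)) \<longlonglongrightarrow> 1"
  proof (rule tendsto_sandwich)
    show "\<forall>\<^sub>F n in sequentially. prob (A n) + prob (B n) - 1 \<le> prob (A n \<inter> B n)"
    proof (rule always_eventually, rule allI)
      fix n
      have "prob (A n) \<le> prob ((A n \<inter> B n) \<union> (space \<Omega> - B n))"
        using A(1) B(1) sets.sets_into_space[OF A(1)] by (intro finite_measure_mono) auto
      also have "\<dots> \<le> prob (A n \<inter> B n) + prob (space \<Omega> - B n)"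
        using A(1) B(1) by (intro measure_Un_le) auto
      finally show "prob (A n) + prob (B n) - 1 \<le> prob (A n \<inter> B n)" by (simp add: prob_compl B(1))
    qed
    show "(\<lambda>n. prob (A n) + prob (B n) - 1) \<longlonglongrightarrow> 1"
      using tendsto_diff[OF tendsto_add[OF A(2) B(2)] tendsto_const[of 1]] by simp
  qed auto
  moreover have "\<forall>\<^sub>F n in sequentially. \<forall>\<omega>\<in>A n \<inter> B n. Q n \<omega> \<and> R n \<omega>"
    using A(3) B(3) by eventually_elim auto
  ultimately show ?thesis
    unfolding whp_def using A(1) B(1) by (intro exI[of _ "\<lambda>n. A n \<inter> B n"]) auto
qed

lemma whp_ball:
  assumes "finite A" and "\<And>a. a \<in> A \<Longrightarrow> whp (Q a)"
  shows "whp (\<lambda>n \<omega>. \<forall>a\<in>A. Q a n \<omega>)"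
  using assms
proof induction
  case empty
  show ?case using whp_eventually[of "\<lambda>_. True"] by simp
next
  case (insert a A)
  then show ?case using whp_conj[of "Q a" "\<lambda>n \<omega>. \<forall>a\<in>A. Q a n \<omega>"] by simp
qed

text \<open>Outside the good event \<open>A n\<close> the implication may fail, which costs at most
  its complementary probability. In this form implications with high probability sandwich the
  rejection probability.\<close>

lemma whp_le:
  assumes "whp (\<lambda>n \<omega>. \<omega> \<in> E n \<longrightarrow> \<omega> \<in> F n)" and E: "\<And>n. E n \<in> events" and F: "\<And>n. F n \<in> events" and "\<eta> > 0"
  shows "\<forall>\<^sub>F n in sequentially. prob (E n) \<le> prob (F n) + \<eta>"
proof -
  obtain A where A: "\<And>n. A n \<in> events" "(\<lambda>n. prob (A n)) \<longlonglongrightarrow> 1" "\<forall>\<^sub>F n in sequentially. \<forall>\<omega>\<in>A n. \<omega> \<in> E n \<longrightarrow> \<omega> \<in> F n"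
    using assms(1) by (auto simp: whp_def)
  have "\<forall>\<^sub>F n in sequentially. 1 - \<eta> < prob (A n)"
    using A(2) \<open>\<eta> > 0\<close> by (intro order_tendstoD(1)) auto
  with A(3) show ?thesis
  proof eventually_elim
    case (elim n)
    have "prob (E n) \<le> prob (F n \<union> (space \<Omega> - A n))"
      using elim F A(1) subsetD[OF sets.sets_into_space[OF E[of n]]] by (intro finite_measure_mono) auto
    also have "\<dots> \<le> prob (F n) + prob (space \<Omega> - A n)"
      using F A(1) by (intro measure_Un_le) auto
    finally show ?case using elim by (simp add: prob_compl A(1))
  qed
qed

text \<open>Any threshold tending to infinity is allowed: multiples of \<open>sqrt n\<close> give
  laws of large numbers, and multiples of the slower normal quantile handle the active set.\<close>

lemma whp_dev:
  assumes c: "filterlim c at_top sequentially"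
  shows "whp (\<lambda>n \<omega>. \<bar>dev n g \<omega>\<bar> < c n)"
proof -
  let ?A = "\<lambda>n. {\<omega> \<in> space \<Omega>. \<bar>dev n g \<omega>\<bar> < c n}"
  have "(\<lambda>n. prob (?A n)) \<longlonglongrightarrow> 1"
  proof (rule order_tendstoI)
    fix a :: real assume "a < 1"
    then obtain L where L: "\<And>n. n \<ge> 1 \<Longrightarrow> prob {\<omega> \<in> space \<Omega>. \<bar>dev n g \<omega>\<bar> \<ge> L} < 1 - a"
      using dev_tail[of "1 - a" g] by auto
    have "\<forall>\<^sub>F n in sequentially. L \<le> c n" using c by (simp add: filterlim_at_top)
    then show "\<forall>\<^sub>F n in sequentially. a < prob (?A n)" using eventually_ge_at_top[of 1]
    proof eventually_elim
      case (elim n)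
      have "prob {\<omega> \<in> space \<Omega>. \<not> \<bar>dev n g \<omega>\<bar> \<ge> L} = 1 - prob {\<omega> \<in> space \<Omega>. \<bar>dev n g \<omega>\<bar> \<ge> L}"
        by (rule prob_neg) measurable
      moreover have "prob {\<omega> \<in> space \<Omega>. \<not> \<bar>dev n g \<omega>\<bar> \<ge> L} \<le> prob (?A n)"
        using elim by (intro finite_measure_mono) auto
      ultimately show ?case using L[OF elim(2)] by linarith
    qed
  next
    fix a :: real assume "1 < a"
    then show "\<forall>\<^sub>F n in sequentially. prob (?A n) < a"
      by (intro always_eventually allI le_less_trans[OF prob_le_1])
  qed
  then show ?thesis unfolding whp_def by (intro exI[of _ ?A]) auto
qed

section \<open>Consistency of the empirical quantities\<close>

abbreviation sample :: "'a \<Rightarrow> nat \<Rightarrow> int" where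
  "sample \<omega> \<equiv> (\<lambda>i. X i \<omega>)"

lemma sqrt_at_top_seq: "c > 0 \<Longrightarrow> filterlim (\<lambda>n. c * sqrt (real n)) at_top sequentially"
  by (intro filterlim_tendsto_pos_mult_at_top[OF tendsto_const] filterlim_compose[OF sqrt_at_top] filterlim_real_sequentially)

lemma whp_sample: "whp (\<lambda>n \<omega>. sample \<omega> ` {1..n} \<subseteq> S)"
proof -
  have [measurable]: "{\<omega> \<in> space \<Omega>. \<forall>l\<in>{1..n}. X l \<omega> \<in> S} \<in> events" for n
    by (intro sets.sets_Collect_finite_All) auto
  have "prob {\<omega> \<in> space \<Omega>. \<forall>l\<in>{1..n}. X l \<omega> \<in> S} = 1" for n
    by (rule prob_Collect_eq_1[THEN iffD2]) (use AE_sample[of n] in auto)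
  then show ?thesis
    unfolding whp_def
    by (intro exI[of _ "\<lambda>n. {\<omega> \<in> space \<Omega>. \<forall>l\<in>{1..n}. X l \<omega> \<in> S}"] conjI allI always_eventually) auto
qed

lemma whp_emp_pmf:
  assumes "x \<in> S" and "\<delta> > 0"
  shows "whp (\<lambda>n \<omega>. \<bar>emp_pmf n (sample \<omega>) x - pmf p x\<bar> < \<delta>)"
proof (rule whp_mono[OF whp_dev[OF sqrt_at_top_seq[OF \<open>\<delta> > 0\<close>], where g = "\<lambda>y. of_bool (y = x)"]])
  have m: "mean (\<lambda>y. of_bool (y = x)) = pmf p x"
    using assms(1) by (simp add: mean_def of_bool_def if_distrib[of "\<lambda>u. _ * u"] cong: if_cong)
  show "\<forall>\<^sub>F n in sequentially. \<forall>\<omega>\<in>space \<Omega>. \<bar>dev n (\<lambda>y. of_bool (y = x)) \<omega>\<bar> < \<delta> * sqrt (real n) \<longrightarrow>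
      \<bar>emp_pmf n (sample \<omega>) x - pmf p x\<bar> < \<delta>"
    using eventually_gt_at_top[of 0]
  proof eventually_elim
    case (elim n)
    have "dev n (\<lambda>y. of_bool (y = x)) \<omega> = sqrt (real n) * (emp_pmf n (sample \<omega>) x - pmf p x)" for \<omega>
    proof -
      have "dev n (\<lambda>y. of_bool (y = x)) \<omega> = ((\<Sum>l=1..n. of_bool (X l \<omega> = x)) - real n * pmf p x) / sqrt (real n)"
        unfolding dev_def m sum_subtractf by simp
      also have "\<dots> = sqrt (real n) * ((\<Sum>l=1..n. of_bool (X l \<omega> = x)) / real n - pmf p x)"
        using elim by (intro scaled_deviation) simp
      finally show ?thesis by (simp only: emp_pmf_def)
    qed
    then show ?case using elim by (simp add: abs_mult mult.commute)
  qed
qed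

lemma whp_continuous:
  fixes \<Phi> :: "(int \<Rightarrow> real) \<Rightarrow> real"
  assumes "\<And>w. (\<And>x. x \<in> S \<Longrightarrow> (\<lambda>n. w n x) \<longlonglongrightarrow> pmf p x) \<Longrightarrow> (\<lambda>n. \<Phi> (w n)) \<longlonglongrightarrow> \<Phi> (pmf p)"
    and "\<epsilon> > 0"
  shows "whp (\<lambda>n \<omega>. \<bar>\<Phi> (emp_pmf n (sample \<omega>)) - \<Phi> (pmf p)\<bar> < \<epsilon>)"
proof -
  obtain \<delta> where \<delta>: "\<delta> > 0" "\<And>w. \<forall>x\<in>S. \<bar>w x - pmf p x\<bar> < \<delta> \<Longrightarrow> \<bar>\<Phi> w - \<Phi> (pmf p)\<bar> < \<epsilon>"
    using sequentially_continuous_delta[of S "pmf p" \<Phi> \<epsilon>] assms by blast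
  have "whp (\<lambda>n \<omega>. \<forall>x\<in>S. \<bar>emp_pmf n (sample \<omega>) x - pmf p x\<bar> < \<delta>)"
    by (rule whp_ball) (auto intro: whp_emp_pmf \<delta>(1))
  then show ?thesis by (rule whp_mono) (use \<delta>(2) in auto)
qed

lemma whp_emp_supp: "whp (\<lambda>n \<omega>. emp_supp k n (sample \<omega>) = J)"
proof -
  have S: "m \<in> S" "M \<in> S" using m_le by auto
  \<comment> \<open>An error smaller than the true probability forces a positive frequency, so both
    endpoints of the support have been observed.\<close>
  have "whp (\<lambda>n \<omega>. sample \<omega> ` {1..n} \<subseteq> S \<and> \<bar>emp_pmf n (sample \<omega>) m - pmf p m\<bar> < pmf p m
      \<and> \<bar>emp_pmf n (sample \<omega>) M - pmf p M\<bar> < pmf p M)"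
    using S by (intro whp_conj whp_sample whp_emp_pmf pmf_pos)
  then show ?thesis
  proof (rule whp_mono, intro always_eventually allI ballI impI)
    fix n \<omega>
    assume "sample \<omega> ` {1..n} \<subseteq> S \<and> \<bar>emp_pmf n (sample \<omega>) m - pmf p m\<bar> < pmf p m
      \<and> \<bar>emp_pmf n (sample \<omega>) M - pmf p M\<bar> < pmf p M"
    then show "emp_supp k n (sample \<omega>) = J"
      by (intro emp_supp_eq) linarith+
  qed
qed

lemma whp_emp_sd:
  assumes "\<epsilon> > 0"
  shows "whp (\<lambda>n \<omega>. \<bar>emp_sd k n (sample \<omega>) j - sqrt (\<Sum>x\<in>S. (sqrt_cov j x)\<^sup>2)\<bar> < \<epsilon>)"
proof -
  have "whp (\<lambda>n \<omega>. sample \<omega> ` {1..n} \<subseteq> S \<and>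
    \<bar>sqrt (\<Sum>x\<in>S. (root_cov k S (emp_pmf n (sample \<omega>)) j x)\<^sup>2) - sqrt (\<Sum>x\<in>S. (sqrt_cov j x)\<^sup>2)\<bar> < \<epsilon>)"
    by (intro whp_conj whp_sample whp_continuous[where \<Phi> = "\<lambda>w. sqrt (\<Sum>x\<in>S. (root_cov k S w j x)\<^sup>2)"] assms)
      (intro tendsto_intros tendsto_root_cov)
  then show ?thesis
    by (rule whp_mono, intro eventually_mono[OF eventually_ge_at_top[of 1]] ballI impI)
      (subst emp_sd_eq[where S = S], auto)
qed

lemma nondegenerate_min_sqrt_cov:
  assumes "I \<subseteq> J" and "I \<noteq> {}" and "0 < \<alpha>" and "\<alpha> < 1"
  shows "nondegenerate_min I S sqrt_cov \<alpha>"
  using assms root_nondegenerate finite_subset[OF assms(1)] by unfold_locales auto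

lemma whp_crit_val:
  assumes I: "I \<subseteq> J" "I \<noteq> {}" and \<alpha>: "0 < \<alpha>" "\<alpha> < 1" and "\<epsilon> > 0"
  shows "whp (\<lambda>n \<omega>. \<bar>crit_val k m M \<alpha> n (sample \<omega>) I - quantile (min_law I S sqrt_cov) \<alpha>\<bar> < \<epsilon>)"
proof -
  interpret law: nondegenerate_min I S sqrt_cov \<alpha> by (rule nondegenerate_min_sqrt_cov[OF I \<alpha>])
  have "whp (\<lambda>n \<omega>. sample \<omega> ` {1..n} \<subseteq> S \<and>
    \<bar>quantile (min_law I S (root_cov k S (emp_pmf n (sample \<omega>)))) \<alpha> - quantile (min_law I S sqrt_cov) \<alpha>\<bar> < \<epsilon>)"
    by (intro whp_conj whp_sample whp_continuous[where \<Phi> = "\<lambda>w. quantile (min_law I S (root_cov k S w)) \<alpha>"] \<open>\<epsilon> > 0\<close>)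
      (intro law.quantile_min_law_tendsto tendsto_root_cov)
  then show ?thesis
    by (rule whp_mono, intro eventually_mono[OF eventually_ge_at_top[of 1]] ballI impI)
      (subst crit_val_eq[where S = S, OF _ _ _ I], auto)
qed

section \<open>Drift against noise, and identification of the active set\<close>

abbreviation slope :: "int \<Rightarrow> real" where
  "slope j \<equiv> nabla k (pmf p) j"

lemma slope_eq: "slope j = wmean k S (pmf p) j"
proof -
  have "pmf p a = (\<Sum>x\<in>S. pmf p x * of_bool (x = a))" for a
  proof (cases "a \<in> S")
    case True
    then show ?thesis by (simp add: of_bool_def if_distrib[of "\<lambda>u. _ * u"] cong: if_cong)
  next
    case False
    then have "pmf p a = 0" unfolding supp[symmetric] set_pmf_iff by simp
    moreover have "(\<Sum>x\<in>S. pmf p x * of_bool (x = a)) = 0"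
      using False by (intro sum.neutral) auto
    ultimately show ?thesis by simp
  qed
  then have "pmf p = (\<lambda>a. \<Sum>x\<in>S. pmf p x * of_bool (x = a))" by blast
  then show ?thesis
    using nabla_sum[of k "pmf p" "\<lambda>x a. of_bool (x = a)" S j] unfolding wmean_def by metis
qed

text \<open>Separates a drift of order \<open>sqrt n\<close>, governed by the sign of the slope,
  from noise that is bounded in probability.\<close>

lemma scaled_stat_eq:
  assumes "n \<ge> 1"
  shows "sqrt (real n) * nabla k (emp_pmf n (sample \<omega>)) j = sqrt (real n) * slope j + dev n (\<lambda>x. cell k x j) \<omega>"
proof -
  have "dev n (\<lambda>x. cell k x j) \<omega> = ((\<Sum>l=1..n. cell k (X l \<omega>) j) - real n * slope j) / sqrt (real n)"
    unfolding dev_def mean_cell slope_eq sum_subtractf by simp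
  also have "\<dots> = sqrt (real n) * ((\<Sum>l=1..n. cell k (X l \<omega>) j) / real n - slope j)"
    by (rule scaled_deviation[OF assms])
  finally show ?thesis by (simp add: nabla_emp_pmf right_diff_distrib)
qed

lemma whp_slope_pos:
  assumes "slope j > 0"
  shows "whp (\<lambda>n \<omega>. sqrt (real n) * nabla k (emp_pmf n (sample \<omega>)) j > slope j / 2 * sqrt (real n))"
proof (rule whp_mono[OF whp_dev[OF sqrt_at_top_seq, where g = "\<lambda>x. cell k x j"]])
  show "slope j / 2 > 0" using assms by simp
  show "\<forall>\<^sub>F n in sequentially. \<forall>\<omega>\<in>space \<Omega>. \<bar>dev n (\<lambda>x. cell k x j) \<omega>\<bar> < slope j / 2 * sqrt (real n) \<longrightarrow>
      sqrt (real n) * nabla k (emp_pmf n (sample \<omega>)) j > slope j / 2 * sqrt (real n)"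
    using eventually_ge_at_top[of 1]
    by eventually_elim (auto simp: scaled_stat_eq field_simps abs_less_iff)
qed

lemma whp_slope_neg:
  assumes "slope j < 0"
  shows "whp (\<lambda>n \<omega>. sqrt (real n) * nabla k (emp_pmf n (sample \<omega>)) j < slope j / 2 * sqrt (real n))"
proof (rule whp_mono[OF whp_dev[OF sqrt_at_top_seq, where g = "\<lambda>x. cell k x j"]])
  show "- slope j / 2 > 0" using assms by simp
  show "\<forall>\<^sub>F n in sequentially. \<forall>\<omega>\<in>space \<Omega>. \<bar>dev n (\<lambda>x. cell k x j) \<omega>\<bar> < - slope j / 2 * sqrt (real n) \<longrightarrow>
      sqrt (real n) * nabla k (emp_pmf n (sample \<omega>)) j < slope j / 2 * sqrt (real n)"
    using eventually_ge_at_top[of 1]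
    by eventually_elim (auto simp: scaled_stat_eq field_simps abs_less_iff)
qed

lemma whp_not_active:
  assumes "slope j > 0"
  shows "whp (\<lambda>n \<omega>. j \<notin> active_set k n (sample \<omega>))"
proof -
  \<comment> \<open>With high probability this bounds the empirical standard deviation, which is
    within 1 of its limit.\<close>
  define b where "b = sqrt (\<Sum>x\<in>S. (sqrt_cov j x)\<^sup>2) + 1"
  have "b > 0" by (simp add: b_def sum_nonneg add_nonneg_pos)
  have "whp (\<lambda>n \<omega>. sample \<omega> ` {1..n} \<subseteq> S \<and> \<bar>emp_sd k n (sample \<omega>) j - sqrt (\<Sum>x\<in>S. (sqrt_cov j x)\<^sup>2)\<bar> < 1
     \<and> sqrt (real n) * nabla k (emp_pmf n (sample \<omega>)) j > slope j / 2 * sqrt (real n))"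
    by (intro whp_conj whp_sample whp_emp_sd whp_slope_pos assms) simp
  then show ?thesis
  proof (rule whp_mono)
    \<comment> \<open>With this constant in \<open>std_normal_quantile_small\<close> the threshold
      is at most \<open>slope j / 2 * sqrt n\<close>, half of the drift. Nonnegativity of the
      quantile is what permits replacing the standard deviation by \<open>b\<close>.\<close>
    have "slope j / (2 * b) > 0" using assms \<open>b > 0\<close> by simp
    from std_normal_quantile_small[OF this] std_normal_quantile_at_top[of 0] eventually_ge_at_top[of 1]
    show "\<forall>\<^sub>F n in sequentially. \<forall>\<omega>\<in>space \<Omega>. sample \<omega> ` {1..n} \<subseteq> S
        \<and> \<bar>emp_sd k n (sample \<omega>) j - sqrt (\<Sum>x\<in>S. (sqrt_cov j x)\<^sup>2)\<bar> < 1
        \<and> sqrt (real n) * nabla k (emp_pmf n (sample \<omega>)) j > slope j / 2 * sqrt (real n)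
        \<longrightarrow> j \<notin> active_set k n (sample \<omega>)"
    proof eventually_elim
      case (elim n)
      let ?z = "std_normal_quantile (1 - 1 / real n)"
      show ?case
      proof (intro ballI impI)
        fix \<omega> assume \<omega>: "sample \<omega> ` {1..n} \<subseteq> S \<and> \<bar>emp_sd k n (sample \<omega>) j - sqrt (\<Sum>x\<in>S. (sqrt_cov j x)\<^sup>2)\<bar> < 1
          \<and> sqrt (real n) * nabla k (emp_pmf n (sample \<omega>)) j > slope j / 2 * sqrt (real n)"
        then have "emp_sd k n (sample \<omega>) j \<le> b" by (simp add: b_def abs_less_iff)
        then have "?z * emp_sd k n (sample \<omega>) j \<le> ?z * b" using elim(2) by (rule mult_left_mono)
        also have "\<dots> \<le> slope j / (2 * b) * sqrt (real n) * b"
          using elim(1) \<open>b > 0\<close> by (intro mult_right_mono) auto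
        also have "\<dots> = slope j / 2 * sqrt (real n)" using \<open>b > 0\<close> by simp
        finally show "j \<notin> active_set k n (sample \<omega>)"
          using \<omega> active_set_iff[OF finite_atLeastAtMost_int, of "sample \<omega>" n m M j k] elim(3) by linarith
      qed
    qed
  qed
qed

lemma whp_active:
  assumes j: "j \<in> J" and "slope j = 0"
  shows "whp (\<lambda>n \<omega>. j \<in> active_set k n (sample \<omega>))"
proof -
  \<comment> \<open>Half of the limiting standard deviation is a lower bound for the empirical one.
    The threshold is then at least \<open>s\<close> times a quantile tending to infinity, which the
    driftless noise does not reach.\<close>
  define s where "s = sqrt (\<Sum>x\<in>S. (sqrt_cov j x)\<^sup>2) / 2"
  have "s > 0" using root_nondegenerate[OF j] by (simp add: s_def)
  let ?z = "\<lambda>n::nat. std_normal_quantile (1 - 1 / real n)"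
  have z: "filterlim (\<lambda>n. s * ?z n) at_top sequentially"
    using \<open>s > 0\<close> std_normal_quantile_at_top
    by (intro filterlim_tendsto_pos_mult_at_top[OF tendsto_const]) (auto simp: filterlim_at_top)
  have "whp (\<lambda>n \<omega>. sample \<omega> ` {1..n} \<subseteq> S \<and> emp_supp k n (sample \<omega>) = J
     \<and> \<bar>emp_sd k n (sample \<omega>) j - sqrt (\<Sum>x\<in>S. (sqrt_cov j x)\<^sup>2)\<bar> < s
     \<and> \<bar>dev n (\<lambda>x. cell k x j) \<omega>\<bar> < s * ?z n)"
    by (intro whp_conj whp_sample whp_emp_supp whp_emp_sd whp_dev z \<open>s > 0\<close>)
  then show ?thesis
  proof (rule whp_mono)
    from std_normal_quantile_at_top[of 0] eventually_ge_at_top[of 1]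
    show "\<forall>\<^sub>F n in sequentially. \<forall>\<omega>\<in>space \<Omega>. sample \<omega> ` {1..n} \<subseteq> S \<and> emp_supp k n (sample \<omega>) = J
     \<and> \<bar>emp_sd k n (sample \<omega>) j - sqrt (\<Sum>x\<in>S. (sqrt_cov j x)\<^sup>2)\<bar> < s
     \<and> \<bar>dev n (\<lambda>x. cell k x j) \<omega>\<bar> < s * ?z n \<longrightarrow> j \<in> active_set k n (sample \<omega>)"
    proof eventually_elim
      case (elim n)
      show ?case
      proof (intro ballI impI)
        fix \<omega> assume \<omega>: "sample \<omega> ` {1..n} \<subseteq> S \<and> emp_supp k n (sample \<omega>) = J
          \<and> \<bar>emp_sd k n (sample \<omega>) j - sqrt (\<Sum>x\<in>S. (sqrt_cov j x)\<^sup>2)\<bar> < s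
          \<and> \<bar>dev n (\<lambda>x. cell k x j) \<omega>\<bar> < s * ?z n"
        then have "\<bar>emp_sd k n (sample \<omega>) j - sqrt (\<Sum>x\<in>S. (sqrt_cov j x)\<^sup>2)\<bar> < s" by blast
        then have "s \<le> emp_sd k n (sample \<omega>) j" unfolding s_def by linarith
        then have "s * ?z n \<le> emp_sd k n (sample \<omega>) j * ?z n" using elim(1) by (rule mult_right_mono)
        moreover have "sqrt (real n) * nabla k (emp_pmf n (sample \<omega>)) j < s * ?z n"
          using \<omega> scaled_stat_eq[OF elim(2), of \<omega> j] assms(2) by (simp add: abs_less_iff)
        ultimately show "j \<in> active_set k n (sample \<omega>)"
          using \<omega> j active_set_iff[OF finite_atLeastAtMost_int, of "sample \<omega>" n m M j k] elim(2)
          by (simp add: mult.commute)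
      qed
    qed
  qed
qed

lemma whp_active_set:
  assumes "\<And>j. j \<in> J \<Longrightarrow> slope j \<ge> 0"
  shows "whp (\<lambda>n \<omega>. active_set k n (sample \<omega>) = {j \<in> J. slope j = 0})"
proof -
  have "whp (\<lambda>n \<omega>. j \<in> active_set k n (sample \<omega>) \<longleftrightarrow> slope j = 0)" if "j \<in> J" for j
  proof (cases "slope j = 0")
    case True
    then show ?thesis using whp_active[OF that] by simp
  next
    case False
    then show ?thesis using whp_not_active[of j] assms[OF that] by simp
  qed
  then have "whp (\<lambda>n \<omega>. \<forall>j\<in>J. j \<in> active_set k n (sample \<omega>) \<longleftrightarrow> slope j = 0)"
    by (intro whp_ball) auto
  then have "whp (\<lambda>n \<omega>. emp_supp k n (sample \<omega>) = J \<and> (\<forall>j\<in>J. j \<in> active_set k n (sample \<omega>) \<longleftrightarrow> slope j = 0))"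
    by (intro whp_conj whp_emp_supp)
  moreover have "active_set k n x \<subseteq> emp_supp k n x" for n x by (auto simp: active_set_def)
  ultimately show ?thesis
    by (elim whp_mono, intro always_eventually allI ballI impI) blast
qed

lemma test_stat_less_iff:
  assumes "emp_supp k n x = J"
  shows "test_stat k n x < c \<longleftrightarrow> (\<exists>j\<in>J. sqrt (real n) * nabla k (emp_pmf n x) j < c)"
proof -
  let ?f = "nabla k (emp_pmf n x)"
  have ne: "J \<noteq> {}" using m_le by auto
  have stat: "test_stat k n x = sqrt (real n) * Min (?f ` J)" using assms ne by (simp add: test_stat_def)
  have "Min (?f ` J) \<in> ?f ` J" using ne by (intro Min_in) auto
  then obtain j0 where j0: "j0 \<in> J" "Min (?f ` J) = ?f j0" by auto
  have le: "sqrt (real n) * Min (?f ` J) \<le> sqrt (real n) * ?f j" if "j \<in> J" for j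
    using that by (intro mult_left_mono Min_le) auto
  show ?thesis unfolding stat
  proof
    assume "sqrt (real n) * Min (?f ` J) < c"
    then show "\<exists>j\<in>J. sqrt (real n) * ?f j < c" using j0 by (intro bexI[of _ j0]) simp_all
  next
    assume "\<exists>j\<in>J. sqrt (real n) * ?f j < c"
    then obtain j where "j \<in> J" "sqrt (real n) * ?f j < c" by blast
    with le[OF this(1)] show "sqrt (real n) * Min (?f ` J) < c" by linarith
  qed
qed

section \<open>The three limits of the rejection probability\<close>

abbreviation reject :: "real \<Rightarrow> nat \<Rightarrow> 'a set" where
  "reject \<alpha> n \<equiv> {\<omega> \<in> space \<Omega>. sample \<omega> \<in> rejection_region k m M \<alpha> n}"

text \<open>Rejection depends only on the first \<open>n\<close> observations. These take values in
  a countable discrete product, where every set is measurable, so the Gaussian quantile need not be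
  analysed as a function of the sample.\<close>

lemma reject_event [measurable]: "reject \<alpha> n \<in> events"
proof -
  let ?P = "\<lambda>x. x \<in> rejection_region k m M \<alpha> n"
  have P: "?P y = ?P x" if eq: "\<And>l. l \<in> {1..n} \<Longrightarrow> y l = x l" for x y
  proof -
    have e: "emp_pmf n y = emp_pmf n x"
      by (intro ext) (simp only: emp_pmf_def eq cong: sum.cong)
    have "y ` {1..n} = x ` {1..n}" by (intro image_cong refl eq)
    then have s: "emp_supp k n y = emp_supp k n x" by (simp only: emp_supp_def)
    have c: "emp_cov k n y = emp_cov k n x"
      by (intro ext) (simp only: emp_cov_def e eq cong: sum.cong)
    have sd: "emp_sd k n y = emp_sd k n x" by (intro ext) (simp only: emp_sd_def c)
    show ?thesis
      by (simp only: rejection_region_def test_stat_def crit_val_def active_set_def e s c sd mem_Collect_eq)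
  qed
  have "(\<lambda>\<omega>. \<lambda>l\<in>{1..n}. X l \<omega>) \<in> measurable \<Omega> (\<Pi>\<^sub>M l\<in>{1..n}. count_space UNIV)"
    by (intro measurable_restrict measurable_X) auto
  then have "(\<lambda>\<omega>. \<lambda>l\<in>{1..n}. X l \<omega>) \<in> measurable \<Omega> (count_space (\<Pi>\<^sub>E l\<in>{1..n}. UNIV))"
    by (simp add: count_space_PiM_finite)
  then have "(\<lambda>\<omega>. \<lambda>l\<in>{1..n}. X l \<omega>) -` {x \<in> (\<Pi>\<^sub>E l\<in>{1..n}. UNIV). ?P x} \<inter> space \<Omega> \<in> events"
    by (rule measurable_sets) auto
  moreover have "(\<lambda>\<omega>. \<lambda>l\<in>{1..n}. X l \<omega>) -` {x \<in> (\<Pi>\<^sub>E l\<in>{1..n}. UNIV). ?P x} \<inter> space \<Omega> = reject \<alpha> n"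
    using P[of "\<lambda>l\<in>{1..n}. X l \<omega>" "sample \<omega>" for \<omega>] by auto
  ultimately show ?thesis by simp
qed

lemma Min_slope:
  "(\<And>j. j \<in> J \<Longrightarrow> rho k m M p \<le> slope j)" "\<exists>j\<in>J. slope j = rho k m M p"
proof -
  have ne: "J \<noteq> {}" using m_le by auto
  show "rho k m M p \<le> slope j" if "j \<in> J" for j using that by (simp add: rho_def)
  have "Min (slope ` J) \<in> slope ` J" using ne by (intro Min_in) auto
  then show "\<exists>j\<in>J. slope j = rho k m M p" by (auto simp: rho_def)
qed

lemma reject_tendsto_0:
  assumes "rho k m M p > 0"
  shows "(\<lambda>n. prob (reject \<alpha> n)) \<longlonglongrightarrow> 0"
proof -
  have pos: "slope j > 0" if "j \<in> J" for j using Min_slope(1)[OF that] assms by simp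
  then have "{j \<in> J. slope j = 0} = {}" by force
  moreover have "whp (\<lambda>n \<omega>. active_set k n (sample \<omega>) = {j \<in> J. slope j = 0})"
    by (intro whp_active_set less_imp_le pos)
  ultimately have act: "whp (\<lambda>n \<omega>. active_set k n (sample \<omega>) = {})" by (simp only:)
  have "whp (\<lambda>n \<omega>. emp_supp k n (sample \<omega>) = J \<and> active_set k n (sample \<omega>) = {} \<and>
     (\<forall>j\<in>J. sqrt (real n) * nabla k (emp_pmf n (sample \<omega>)) j > slope j / 2 * sqrt (real n)))"
    by (intro whp_conj whp_emp_supp act whp_ball whp_slope_pos pos) auto
  then have w: "whp (\<lambda>n \<omega>. \<omega> \<in> reject \<alpha> n \<longrightarrow> \<omega> \<in> {})"
  proof (rule whp_mono, intro always_eventually allI ballI impI)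
    fix n \<omega>
    assume a: "emp_supp k n (sample \<omega>) = J \<and> active_set k n (sample \<omega>) = {} \<and>
     (\<forall>j\<in>J. sqrt (real n) * nabla k (emp_pmf n (sample \<omega>)) j > slope j / 2 * sqrt (real n))"
      and r: "\<omega> \<in> reject \<alpha> n"
    have "test_stat k n (sample \<omega>) < 0" using r a by (simp add: rejection_region_def crit_val_def)
    then obtain j where j: "j \<in> J" "sqrt (real n) * nabla k (emp_pmf n (sample \<omega>)) j < 0"
      using test_stat_less_iff[of n "sample \<omega>" 0] a by blast
    have "slope j / 2 * sqrt (real n) \<ge> 0" using pos[OF j(1)] by simp
    moreover have "sqrt (real n) * nabla k (emp_pmf n (sample \<omega>)) j > slope j / 2 * sqrt (real n)"
      using a j(1) by blast
    ultimately show "\<omega> \<in> {}" using j(2) by linarith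
  qed
  show ?thesis
  proof (rule tendstoI)
    fix e :: real assume "e > 0"
    then have "\<forall>\<^sub>F n in sequentially. prob (reject \<alpha> n) \<le> prob {} + e / 2"
      using w by (intro whp_le) auto
    then show "\<forall>\<^sub>F n in sequentially. dist (prob (reject \<alpha> n)) 0 < e"
      using \<open>e > 0\<close> by (auto elim!: eventually_mono)
  qed
qed

text \<open>The active set is not identified here. One index with negative drift makes the statistic
  drop below a bound valid for the critical values of all possible index sets.\<close>

lemma reject_tendsto_1:
  assumes "rho k m M p < 0" and \<alpha>: "0 < \<alpha>" "\<alpha> < 1"
  shows "(\<lambda>n. prob (reject \<alpha> n)) \<longlonglongrightarrow> 1"
proof -
  obtain j where j: "j \<in> J" "slope j < 0" using Min_slope(2) assms(1) by metis
  let ?q = "\<lambda>I. quantile (min_law I S sqrt_cov) \<alpha>"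
  let ?A = "Pow J - {{}}"
  \<comment> \<open>The sum covers the limiting critical values of all nonempty subsets. The 1
    absorbs the tolerance in \<open>crit\<close> and keeps \<open>- K\<close> below the default
    critical value 0 of an empty active set.\<close>
  define K where "K = 1 + (\<Sum>I\<in>?A. \<bar>?q I\<bar>)"
  have "K \<ge> 1" by (simp add: K_def sum_nonneg)
  have crit: "whp (\<lambda>n \<omega>. \<forall>I\<in>?A. \<bar>crit_val k m M \<alpha> n (sample \<omega>) I - ?q I\<bar> < 1)"
    by (intro whp_ball whp_crit_val \<alpha>) auto
  have "- slope j / 2 > 0" using j by simp
  from filterlim_at_top[THEN iffD1, OF sqrt_at_top_seq[OF this], rule_format, of K]
  have big: "whp (\<lambda>n _. K \<le> - slope j / 2 * sqrt (real n))" by (rule whp_eventually)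
  have "whp (\<lambda>n \<omega>. emp_supp k n (sample \<omega>) = J \<and> (\<forall>I\<in>?A. \<bar>crit_val k m M \<alpha> n (sample \<omega>) I - ?q I\<bar> < 1)
     \<and> sqrt (real n) * nabla k (emp_pmf n (sample \<omega>)) j < slope j / 2 * sqrt (real n)
     \<and> K \<le> - slope j / 2 * sqrt (real n))"
    by (intro whp_conj whp_emp_supp crit whp_slope_neg j big)
  then have w: "whp (\<lambda>n \<omega>. \<omega> \<in> space \<Omega> \<longrightarrow> \<omega> \<in> reject \<alpha> n)"
  proof (rule whp_mono, intro always_eventually allI ballI impI)
    fix n \<omega>
    assume a: "emp_supp k n (sample \<omega>) = J \<and> (\<forall>I\<in>?A. \<bar>crit_val k m M \<alpha> n (sample \<omega>) I - ?q I\<bar> < 1)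
     \<and> sqrt (real n) * nabla k (emp_pmf n (sample \<omega>)) j < slope j / 2 * sqrt (real n)
     \<and> K \<le> - slope j / 2 * sqrt (real n)" and "\<omega> \<in> space \<Omega>"
    let ?I = "active_set k n (sample \<omega>)"
    have "?I \<subseteq> J" using a by (auto simp: active_set_def)
    have "- K \<le> crit_val k m M \<alpha> n (sample \<omega>) ?I"
    proof (cases "?I = {}")
      case True
      then show ?thesis using \<open>K \<ge> 1\<close> by (simp add: crit_val_def)
    next
      case False
      with \<open>?I \<subseteq> J\<close> have I: "?I \<in> ?A" by blast
      then have "\<bar>?q ?I\<bar> \<le> (\<Sum>I\<in>?A. \<bar>?q I\<bar>)" by (intro member_le_sum[where f = "\<lambda>I. \<bar>?q I\<bar>"]) auto
      moreover have "\<bar>crit_val k m M \<alpha> n (sample \<omega>) ?I - ?q ?I\<bar> < 1" using a I by blast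
      ultimately show ?thesis unfolding K_def by linarith
    qed
    moreover have "sqrt (real n) * nabla k (emp_pmf n (sample \<omega>)) j < - K" using a by linarith
    ultimately have "test_stat k n (sample \<omega>) < crit_val k m M \<alpha> n (sample \<omega>) ?I"
      using a j(1) by (subst test_stat_less_iff) (auto intro!: bexI[of _ j])
    then show "\<omega> \<in> reject \<alpha> n" using \<open>\<omega> \<in> space \<Omega>\<close> by (simp add: rejection_region_def)
  qed
  show ?thesis
  proof (rule tendstoI)
    fix e :: real assume "e > 0"
    then have "\<forall>\<^sub>F n in sequentially. prob (space \<Omega>) \<le> prob (reject \<alpha> n) + e / 2"
      using w by (intro whp_le) auto
    then show "\<forall>\<^sub>F n in sequentially. dist (prob (reject \<alpha> n)) 1 < e"
    proof eventually_elim
      case (elim n)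
      moreover have "prob (reject \<alpha> n) \<le> 1" by simp
      ultimately show ?case using \<open>e > 0\<close> by (simp add: prob_space dist_real_def)
    qed
  qed
qed

text \<open>Acceptance is treated instead of rejection because it says that all coordinates reach
  the critical value, which is an orthant condition. With the critical value within
  \<open>\<epsilon>\<close> of its limit and the indices outside \<open>I\<close> beyond
  \<open>law.q + \<epsilon>\<close> by their drift, acceptance lies between two orthant events at
  \<open>law.q + \<epsilon>\<close> and \<open>law.q - \<epsilon>\<close>.\<close>

lemma reject_tendsto_level:
  assumes "rho k m M p = 0" and \<alpha>: "0 < \<alpha>" "\<alpha> < 1"
  shows "(\<lambda>n. prob (reject \<alpha> n)) \<longlonglongrightarrow> \<alpha>"
proof -
  define I where "I = {j \<in> J. slope j = 0}"
  have nn: "slope j \<ge> 0" if "j \<in> J" for j using Min_slope(1)[OF that] assms(1) by simp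
  have I: "I \<subseteq> J" "I \<noteq> {}" using Min_slope(2) assms(1) by (auto simp: I_def)
  interpret law: nondegenerate_min I S sqrt_cov \<alpha> by (rule nondegenerate_min_sqrt_cov[OF I \<alpha>])
  define F where "F = cdf (min_law I S sqrt_cov)"
  define U where "U t n = {\<omega> \<in> space \<Omega>. \<forall>j\<in>I. t < dev n (\<lambda>x. cell k x j) \<omega>}" for t n
  have "finite I" using I(1) finite_subset by blast
  then have U[measurable]: "U t n \<in> events" for t n
    unfolding U_def by (intro sets.sets_Collect_finite_All) auto
  have limU: "(\<lambda>n. prob (U t n)) \<longlonglongrightarrow> 1 - F t" for t
    unfolding U_def F_def by (rule dev_orthant_tendsto[OF I])
  let ?N = "\<lambda>n. space \<Omega> - reject \<alpha> n"
  have good: "whp (\<lambda>n \<omega>. n \<ge> 1 \<and> emp_supp k n (sample \<omega>) = J \<and> active_set k n (sample \<omega>) = I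
      \<and> \<bar>crit_val k m M \<alpha> n (sample \<omega>) I - law.q\<bar> < \<epsilon>
      \<and> (\<forall>j\<in>J - I. sqrt (real n) * nabla k (emp_pmf n (sample \<omega>)) j > law.q + \<epsilon>))" if "\<epsilon> > 0" for \<epsilon>
  proof -
    have "whp (\<lambda>n \<omega>. sqrt (real n) * nabla k (emp_pmf n (sample \<omega>)) j > law.q + \<epsilon>)" if "j \<in> J - I" for j
    proof -
      have s: "slope j > 0" using that nn[of j] by (auto simp: I_def less_le)
      then have "slope j / 2 > 0" by simp
      from filterlim_at_top[THEN iffD1, OF sqrt_at_top_seq[OF this], rule_format, of "law.q + \<epsilon>"]
      have "\<forall>\<^sub>F n in sequentially. law.q + \<epsilon> \<le> slope j / 2 * sqrt (real n)" .
      then show ?thesis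
        by (intro whp_mono[OF whp_slope_pos[OF s]]) (auto elim!: eventually_mono)
    qed
    then show ?thesis
      using whp_active_set[OF nn] unfolding I_def[symmetric]
      by (intro whp_conj whp_eventually whp_emp_supp whp_crit_val I \<alpha> whp_ball that eventually_ge_at_top) auto
  qed
  have stat: "sqrt (real n) * nabla k (emp_pmf n (sample \<omega>)) j = dev n (\<lambda>x. cell k x j) \<omega>"
    if "j \<in> I" "n \<ge> 1" for j n \<omega>
    using that by (simp add: scaled_stat_eq I_def)
  have upper: "whp (\<lambda>n \<omega>. \<omega> \<in> ?N n \<longrightarrow> \<omega> \<in> U (law.q - \<epsilon>) n)" if "\<epsilon> > 0" for \<epsilon>
  proof (rule whp_mono[OF good[OF that]], intro always_eventually allI ballI impI)
    fix n \<omega>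
    assume a: "n \<ge> 1 \<and> emp_supp k n (sample \<omega>) = J \<and> active_set k n (sample \<omega>) = I
      \<and> \<bar>crit_val k m M \<alpha> n (sample \<omega>) I - law.q\<bar> < \<epsilon>
      \<and> (\<forall>j\<in>J - I. sqrt (real n) * nabla k (emp_pmf n (sample \<omega>)) j > law.q + \<epsilon>)"
      and \<omega>: "\<omega> \<in> ?N n"
    then have "\<not> test_stat k n (sample \<omega>) < crit_val k m M \<alpha> n (sample \<omega>) I"
      by (auto simp: rejection_region_def)
    moreover have supp: "emp_supp k n (sample \<omega>) = J" and n: "n \<ge> 1"
      and crit: "\<bar>crit_val k m M \<alpha> n (sample \<omega>) I - law.q\<bar> < \<epsilon>" using a by blast+
    ultimately have ge: "\<not> sqrt (real n) * nabla k (emp_pmf n (sample \<omega>)) j < crit_val k m M \<alpha> n (sample \<omega>) I"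
      if "j \<in> J" for j
      using that unfolding test_stat_less_iff[OF supp] by blast
    have "law.q - \<epsilon> < dev n (\<lambda>x. cell k x j) \<omega>" if "j \<in> I" for j
      using ge[OF subsetD[OF I(1) that]] crit unfolding stat[OF that n] by linarith
    then show "\<omega> \<in> U (law.q - \<epsilon>) n" using \<omega> by (auto simp: U_def)
  qed
  have lower: "whp (\<lambda>n \<omega>. \<omega> \<in> U (law.q + \<epsilon>) n \<longrightarrow> \<omega> \<in> ?N n)" if "\<epsilon> > 0" for \<epsilon>
  proof (rule whp_mono[OF good[OF that]], intro always_eventually allI ballI impI)
    fix n \<omega>
    assume a: "n \<ge> 1 \<and> emp_supp k n (sample \<omega>) = J \<and> active_set k n (sample \<omega>) = I
      \<and> \<bar>crit_val k m M \<alpha> n (sample \<omega>) I - law.q\<bar> < \<epsilon>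
      \<and> (\<forall>j\<in>J - I. sqrt (real n) * nabla k (emp_pmf n (sample \<omega>)) j > law.q + \<epsilon>)"
      and \<omega>: "\<omega> \<in> U (law.q + \<epsilon>) n"
    have "\<not> sqrt (real n) * nabla k (emp_pmf n (sample \<omega>)) j < crit_val k m M \<alpha> n (sample \<omega>) I" if "j \<in> J" for j
    proof -
      have "law.q + \<epsilon> < sqrt (real n) * nabla k (emp_pmf n (sample \<omega>)) j"
      proof (cases "j \<in> I")
        case True
        then show ?thesis using \<omega> a stat[OF True, of n \<omega>] by (auto simp: U_def)
      next
        case False
        then show ?thesis using a that by blast
      qed
      moreover have "crit_val k m M \<alpha> n (sample \<omega>) I < law.q + \<epsilon>" using a by linarith
      ultimately show ?thesis by linarith
    qed
    then have "\<not> test_stat k n (sample \<omega>) < crit_val k m M \<alpha> n (sample \<omega>) I"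
      using a by (subst test_stat_less_iff) auto
    then show "\<omega> \<in> ?N n" using \<omega> a by (simp add: U_def rejection_region_def)
  qed
  show ?thesis
  proof (rule tendstoI)
    fix e :: real assume "e > 0"
    have cont: "isCont F law.q" unfolding F_def by (rule law.isCont_cdf_min_law)
    have Fq: "F law.q = \<alpha>" unfolding F_def by (rule law.cdf_quantile)
    \<comment> \<open>Three errors of \<open>e / 4\<close> are incurred on each side: the
      exceptional event, the convergence of the orthant probability, and the shift of
      \<open>F\<close> away from \<open>law.q\<close>.\<close>
    from cont \<open>e > 0\<close> obtain d where d: "d > 0" "\<And>t. \<bar>t - law.q\<bar> < d \<Longrightarrow> \<bar>F t - \<alpha>\<bar> < e / 4"
      unfolding continuous_at_eps_delta Fq dist_real_def by (metis divide_pos_pos zero_less_numeral)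
    define \<epsilon> where "\<epsilon> = d / 2"
    have \<epsilon>: "\<epsilon> > 0" "\<bar>F (law.q - \<epsilon>) - \<alpha>\<bar> < e / 4" "\<bar>F (law.q + \<epsilon>) - \<alpha>\<bar> < e / 4"
      using d by (auto simp: \<epsilon>_def)
    have e4: "e / 4 > 0" using \<open>e > 0\<close> by simp
    have 1: "\<forall>\<^sub>F n in sequentially. prob (?N n) \<le> prob (U (law.q - \<epsilon>) n) + e / 4"
      by (rule whp_le[OF upper[OF \<epsilon>(1)] _ _ e4]) auto
    have 2: "\<forall>\<^sub>F n in sequentially. prob (U (law.q + \<epsilon>) n) \<le> prob (?N n) + e / 4"
      by (rule whp_le[OF lower[OF \<epsilon>(1)] _ _ e4]) auto
    have 3: "\<forall>\<^sub>F n in sequentially. dist (prob (U (law.q - \<epsilon>) n)) (1 - F (law.q - \<epsilon>)) < e / 4"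
      and 4: "\<forall>\<^sub>F n in sequentially. dist (prob (U (law.q + \<epsilon>) n)) (1 - F (law.q + \<epsilon>)) < e / 4"
      by (rule tendstoD[OF limU e4])+
    from 1 2 3 4 show "\<forall>\<^sub>F n in sequentially. dist (prob (reject \<alpha> n)) \<alpha> < e"
    proof eventually_elim
      case (elim n)
      have "prob (?N n) = 1 - prob (reject \<alpha> n)" by (rule prob_compl) simp
      with elim \<epsilon>(2,3) show ?case unfolding dist_real_def by linarith
    qed
  qed
qed

end

theorem corollary1:
  fixes \<Omega> :: "'a measure" and X :: "nat \<Rightarrow> 'a \<Rightarrow> int" and p :: "int pmf"
    and k :: nat and m M :: int and \<alpha> :: real
  assumes "prob_space \<Omega>"
    and "k \<ge> 1" and "m \<le> M - int k"
    and "set_pmf p = {m..M}"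
    and "prob_space.indep_vars \<Omega> (\<lambda>_. count_space UNIV) X {1..}"
    and "\<And>i. i \<ge> 1 \<Longrightarrow> distr \<Omega> (count_space UNIV) (X i) = measure_pmf p"
    and "0 < \<alpha>" and "\<alpha> < 1"
  shows "(rho k m M p \<ge> 0 \<and> rho k m M p = 0 \<longrightarrow>
           (\<lambda>n. measure \<Omega> {\<omega> \<in> space \<Omega>. (\<lambda>i. X i \<omega>) \<in> rejection_region k m M \<alpha> n})
             \<longlonglongrightarrow> \<alpha>)
       \<and> (rho k m M p \<ge> 0 \<and> rho k m M p > 0 \<longrightarrow>
           (\<lambda>n. measure \<Omega> {\<omega> \<in> space \<Omega>. (\<lambda>i. X i \<omega>) \<in> rejection_region k m M \<alpha> n})
             \<longlonglongrightarrow> 0)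
       \<and> (rho k m M p < 0 \<longrightarrow>
           (\<lambda>n. measure \<Omega> {\<omega> \<in> space \<Omega>. (\<lambda>i. X i \<omega>) \<in> rejection_region k m M \<alpha> n})
             \<longlonglongrightarrow> 1)"
proof -
  interpret iid_sample \<Omega> X p k m M
    using assms(1-6) by (simp add: iid_sample_def iid_sample_axioms_def)
  show ?thesis
    using reject_tendsto_level reject_tendsto_0 reject_tendsto_1 assms(7,8) by blast
qed

end
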